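(* Let $\Gamma$ be a finite quiver without oriented cycles, $t\in\Gamma_0$ and $d\in\mathbb N$ with $V^t_d\ne0$. (a) Let $g^t_d:\Big(\bigoplus_{s(\gamma)=t}V^{e(\gamma)}_{d}\Big)\oplus\Big(\bigoplus_{e(\gamma)=t}V^{s(\gamma)}_{d-1}\Big)\to V^t_d$ be the map induced by the right multiplications by $a(\gamma)\beta$, $V^{e(\gamma)}_d\to V^t_d$, for $s(\gamma)=t$, and by $-b(\gamma)\beta^*$, $V^{s(\gamma)}_{d-1}\to V^t_d$, for $e(\gamma)=t$, where $\gamma\in\Gamma_1$. For a general choice of $k$-subspaces $U^{e(\gamma)}_d\subset V^{e(\gamma)}_d$ and $U^{s(\gamma)}_{d-1}\subset V^{s(\gamma)}_{d-1}$, the restriction of $g^t_d$ to $\Big(\bigoplus_{s(\gamma)=t}U^{e(\gamma)}_{d}\Big)\oplus\Big(\bigoplus_{e(\gamma)=t}U^{s(\gamma)}_{d-1}\Big)$ has maximal rank. (b) Let $f^t_d:V^t_d\to\Big(\bigoplus_{s(\gamma)=t}V^{e(\gamma)}_{d+1}\Big)\oplus\Big(\bigoplus_{e(\gamma)=t}V^{s(\gamma)}_{d}\Big)$ be the map induced by the right multiplications by $\beta^*$, $V^t_d\to V^{e(\gamma)}_{d+1}$, for $s(\gamma)=t$, and by $\beta$, $V^t_d\to V^{s(\gamma)}_d$, for $e(\gamma)=t$, where $\gamma\in\Gamma_1$. For a general choice of $k$-subspaces $U^{e(\gamma)}_{d+1}\subset V^{e(\gamma)}_{d+1}$ and $U^{s(\gamma)}_d\subset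 V^{s(\gamma)}_d$, denote by $\sigma^{e(\gamma)}_{d+1}:V^{e(\gamma)}_{d+1}\to V^{e(\gamma)}_{d+1}/U^{e(\gamma)}_{d+1}$ and $\sigma^{s(\gamma)}_d:V^{s(\gamma)}_d\to V^{s(\gamma)}_d/U^{s(\gamma)}_d$ the natural projections. Then the linear transformation $\Big(\big(\bigoplus_{s(\gamma)=t}\sigma^{e(\gamma)}_{d+1}\big)\oplus\big(\bigoplus_{e(\gamma)=t}\sigma^{s(\gamma)}_{d}\big)\Big)\circ f^t_d$ has maximal rank.
   Context: $k$ is a fixed algebraically closed field. $\Gamma=(\Gamma_0,\Gamma_1)$ is a finite quiver (vertices $\Gamma_0$, arrows $\Gamma_1$) without oriented cycles; $s(\gamma)$ and $e(\gamma)$ are the starting and end points of $\gamma\in\Gamma_1$. $\bar\Gamma$ is the quiver with the same vertices and with arrows $\Gamma_1\cup\Gamma_1^*$ (disjoint union), where for each $\gamma:t\to v$ in $\Gamma_1$ there is exactly one arrow $\gamma^*:v\to t$ in $\Gamma_1^*$. In the path algebra $k\bar\Gamma$ a product $pq$ of paths means "first $q$, then $p$" (so paths starting at a fixed vertex span a left ideal). $k\bar\Gamma$ is graded by giving trivial paths $e_t$ and arrows of $\Gamma_1$ degree $0$ and arrows of $\Gamma_1^*$ degree $1$. Fix functions $a,b:\Gamma_1\to k$ with $a(\gamma)\ne0$, $b(\gamma)\ne0$ for all $\gamma$. Let $m_t=\sum_{\gamma\in\Gamma_1,\,s(\gamma)=t}a(\gamma)\gamma^*\gamma-\sum_{\gamma\in\Gamma_1,\,e(\gamma)=t}b(\gamma)\gamma\gamma^*$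 and let $J$ be the two-sided ideal of $k\bar\Gamma$ generated by $\sum_{t\in\Gamma_0}m_t$. The $(a,b)$-preprojective algebra is the graded algebra $\mathcal P_k(\Gamma)_{a,b}=k\bar\Gamma/J$, with projection $\pi:k\bar\Gamma\to\mathcal P_k(\Gamma)_{a,b}$. For $t\in\Gamma_0$, $d\in\mathbb N=\{0,1,2,\dots\}$, $V^t_d$ is the (finite dimensional) $k$-span in $\mathcal P_k(\Gamma)_{a,b}$ of the images of all paths of $\bar\Gamma$ of degree $d$ starting at $t$; set $V^t_{-1}=0$. For $\gamma\in\Gamma_1$, write $\beta=\pi(\gamma)$ and $\beta^*=\pi(\gamma^* )$ (so $\beta,\beta^*$ depend on $\gamma$). A linear map has maximal rank if it is injective or surjective. The subspaces are chosen one for each module $V^{u}_{c}$ occurring (so the same subspace is used in all copies of $V^u_c$ indexed by different arrows with the same endpoint $u$). "For a general choice of subspaces" means: once the dimensions of the subspaces are fixed (arbitrarily), there is a dense Zariski open subset of the corresponding product of Grassmannians such that the assertion holds whenever the tuple of subspaces belongs to it. *)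

theory Defs
  imports
    "HOL-Analysis.Abstract_Topology"
    "HOL-Library.Poly_Mapping"
    "HOL-Algebra.QuotRing"
    "Graph_Theory.Graph_Theory"
    "Jordan_Normal_Form.VS_Connect"
begin

section \<open>Path algebras\<close>

text \<open>
  Quivers are multi-digraphs; \<open>tail\<close> is the starting point and \<open>head\<close> the end point of an arrow.
  A path is a pair of its starting vertex and the list of its arrows in the order in which they
  are traversed; \<open>(v, [])\<close> is the trivial path at \<open>v\<close>.
\<close>

definition paths :: "('v, 'e) pre_digraph \<Rightarrow> ('v \<times> 'e list) set" where
  "paths Q = {(u, p). \<exists>v. pre_digraph.awalk Q u p v}"

text \<open>
  The product \<open>p q\<close> of paths is ``first \<open>q\<close>, then \<open>p\<close>'', and \<open>0\<close> unless \<open>q\<close> ends where \<open>p\<close> starts.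
\<close>

definition path_mult :: "('v, 'e) pre_digraph \<Rightarrow> ('v \<times> 'e list \<Rightarrow>\<^sub>0 'k::field)
    \<Rightarrow> ('v \<times> 'e list \<Rightarrow>\<^sub>0 'k) \<Rightarrow> ('v \<times> 'e list \<Rightarrow>\<^sub>0 'k)" where
  "path_mult Q x y =
     (\<Sum>p\<in>Poly_Mapping.keys x. \<Sum>q\<in>Poly_Mapping.keys y.
        if pre_digraph.awalk Q (fst q) (snd q) (fst p)
        then Poly_Mapping.single (fst q, snd q @ snd p)
               (Poly_Mapping.lookup x p * Poly_Mapping.lookup y q)
        else 0)"

definition path_algebra :: "('v, 'e) pre_digraph \<Rightarrow> ('k::field, 'v \<times> 'e list \<Rightarrow>\<^sub>0 'k) module" where
  "path_algebra Q =
     \<lparr>carrier = {x. Poly_Mapping.keys x \<subseteq> paths Q},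
      monoid.mult = path_mult Q,
      one = (\<Sum>v\<in>verts Q. Poly_Mapping.single (v, []) 1),
      zero = 0,
      add = (+),
      smult = (\<lambda>c. Poly_Mapping.map ((*) c))\<rparr>"

definition arrow :: "('v, 'e) pre_digraph \<Rightarrow> 'e \<Rightarrow> ('v \<times> 'e list \<Rightarrow>\<^sub>0 'k::field)" where
  "arrow Q x = Poly_Mapping.single (tail Q x, [x]) 1"


section \<open>The \<open>(a,b)\<close>-preprojective algebra\<close>

text \<open>In the double quiver, \<open>Inl \<gamma>\<close> is the arrow \<open>\<gamma>\<close> and \<open>Inr \<gamma>\<close> is the reversed arrow \<open>\<gamma>\<^sup>*\<close>.\<close>

definition double_quiver :: "('v, 'e) pre_digraph \<Rightarrow> ('v, 'e + 'e) pre_digraph" where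
  "double_quiver \<Gamma> =
     \<lparr>verts = verts \<Gamma>,
      arcs = Inl ` arcs \<Gamma> \<union> Inr ` arcs \<Gamma>,
      tail = case_sum (tail \<Gamma>) (head \<Gamma>),
      head = case_sum (head \<Gamma>) (tail \<Gamma>)\<rparr>"

definition path_degree :: "'v \<times> ('e + 'e) list \<Rightarrow> int" where
  "path_degree p = int (length (filter (\<lambda>x. \<not> isl x) (snd p)))"

definition mesh :: "('v, 'e) pre_digraph \<Rightarrow> ('e \<Rightarrow> 'k::field) \<Rightarrow> ('e \<Rightarrow> 'k) \<Rightarrow> 'v
    \<Rightarrow> ('v \<times> ('e + 'e) list \<Rightarrow>\<^sub>0 'k)" where
  "mesh \<Gamma> a b t =
    (let Q = double_quiver \<Gamma>; A = path_algebra Q in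
      (\<Oplus>\<^bsub>A\<^esub>\<gamma>\<in>out_arcs \<Gamma> t. a \<gamma> \<odot>\<^bsub>A\<^esub> (arrow Q (Inr \<gamma>) \<otimes>\<^bsub>A\<^esub> arrow Q (Inl \<gamma>)))
      \<ominus>\<^bsub>A\<^esub>
      (\<Oplus>\<^bsub>A\<^esub>\<gamma>\<in>in_arcs \<Gamma> t. b \<gamma> \<odot>\<^bsub>A\<^esub> (arrow Q (Inl \<gamma>) \<otimes>\<^bsub>A\<^esub> arrow Q (Inr \<gamma>))))"

definition preproj_ideal :: "('v, 'e) pre_digraph \<Rightarrow> ('e \<Rightarrow> 'k::field) \<Rightarrow> ('e \<Rightarrow> 'k)
    \<Rightarrow> ('v \<times> ('e + 'e) list \<Rightarrow>\<^sub>0 'k) set" where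
  "preproj_ideal \<Gamma> a b =
    (let A = path_algebra (double_quiver \<Gamma>) in Idl\<^bsub>A\<^esub> {\<Oplus>\<^bsub>A\<^esub>t\<in>verts \<Gamma>. mesh \<Gamma> a b t})"

text \<open>
  The scalar multiplication of the quotient is written as a union over the coset, as in
  \<^const>\<open>rcoset_mult\<close>; thus \<open>c \<odot> (J + x) = J + c x\<close>, also for \<open>c = 0\<close>.
\<close>

definition preproj_algebra :: "('v, 'e) pre_digraph \<Rightarrow> ('e \<Rightarrow> 'k::field) \<Rightarrow> ('e \<Rightarrow> 'k)
    \<Rightarrow> ('k, ('v \<times> ('e + 'e) list \<Rightarrow>\<^sub>0 'k) set) module" where
  "preproj_algebra \<Gamma> a b =
    (let A = path_algebra (double_quiver \<Gamma>); J = preproj_ideal \<Gamma> a b; R = A Quot J in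
     \<lparr>carrier = carrier R, monoid.mult = monoid.mult R, one = one R, zero = zero R, add = add R,
      smult = (\<lambda>c X. \<Union>x\<in>X. J +>\<^bsub>A\<^esub> (c \<odot>\<^bsub>A\<^esub> x))\<rparr>)"

definition preproj_proj :: "('v, 'e) pre_digraph \<Rightarrow> ('e \<Rightarrow> 'k::field) \<Rightarrow> ('e \<Rightarrow> 'k)
    \<Rightarrow> ('v \<times> ('e + 'e) list \<Rightarrow>\<^sub>0 'k) \<Rightarrow> ('v \<times> ('e + 'e) list \<Rightarrow>\<^sub>0 'k) set" where
  "preproj_proj \<Gamma> a b x = preproj_ideal \<Gamma> a b +>\<^bsub>path_algebra (double_quiver \<Gamma>)\<^esub> x"

definition beta :: "('v, 'e) pre_digraph \<Rightarrow> ('e \<Rightarrow> 'k::field) \<Rightarrow> ('e \<Rightarrow> 'k) \<Rightarrow> 'e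
    \<Rightarrow> ('v \<times> ('e + 'e) list \<Rightarrow>\<^sub>0 'k) set" where
  "beta \<Gamma> a b \<gamma> = preproj_proj \<Gamma> a b (arrow (double_quiver \<Gamma>) (Inl \<gamma>))"

definition beta_star :: "('v, 'e) pre_digraph \<Rightarrow> ('e \<Rightarrow> 'k::field) \<Rightarrow> ('e \<Rightarrow> 'k) \<Rightarrow> 'e
    \<Rightarrow> ('v \<times> ('e + 'e) list \<Rightarrow>\<^sub>0 'k) set" where
  "beta_star \<Gamma> a b \<gamma> = preproj_proj \<Gamma> a b (arrow (double_quiver \<Gamma>) (Inr \<gamma>))"

text \<open>
  \<open>V\<^sup>t\<^sub>d\<close> is indexed by an integer degree \<open>d\<close>: there are no paths of degree \<open>-1\<close>, so the span of the
  empty set gives the convention \<open>V\<^sup>t\<^sub>-\<^sub>1 = 0\<close>.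
\<close>

definition graded_piece :: "('v, 'e) pre_digraph \<Rightarrow> ('e \<Rightarrow> 'k::field) \<Rightarrow> ('e \<Rightarrow> 'k) \<Rightarrow> 'v \<times> int
    \<Rightarrow> ('v \<times> ('e + 'e) list \<Rightarrow>\<^sub>0 'k) set set" where
  "graded_piece \<Gamma> a b = (\<lambda>(t, d).
     LinearCombinations.module.span class_ring (preproj_algebra \<Gamma> a b)
       {preproj_proj \<Gamma> a b (Poly_Mapping.single p 1) | p.
          p \<in> paths (double_quiver \<Gamma>) \<and> fst p = t \<and> path_degree p = d})"


section \<open>Products of Grassmannians with the Zariski topology\<close>

text \<open>
  Throughout, \<open>M\<close> is an ambient vector space over \<open>'k\<close>, \<open>V i\<close> (\<open>i \<in> I\<close>) are finite dimensional
  subspaces of \<open>M\<close>, and \<open>r i\<close> is the dimension of the subspaces of \<open>V i\<close> to be parametrised.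
\<close>

definition linear_forms :: "('k::field, 'm) module \<Rightarrow> 'm set \<Rightarrow> ('m \<Rightarrow> 'k) set" where
  "linear_forms M W =
     module_hom class_ring (M\<lparr>carrier := W\<rparr>)
       \<lparr>carrier = UNIV, monoid.mult = (*), one = 1, zero = 0, add = (+), smult = (*)\<rparr>"

definition tuple_space :: "'i set \<Rightarrow> ('i \<Rightarrow> 'm set) \<Rightarrow> ('i \<Rightarrow> nat) \<Rightarrow> ('i \<Rightarrow> nat \<Rightarrow> 'm) set" where
  "tuple_space I V r = (\<Pi>\<^sub>E i\<in>I. {..<r i} \<rightarrow>\<^sub>E V i)"

text \<open>Polynomial functions on the affine space \<open>\<Prod>\<^sub>i (V i)\<^bsup>r i\<^esup>\<close>, without choosing coordinates.\<close>

inductive_set poly_funs :: "('k::field, 'm) module \<Rightarrow> 'i set \<Rightarrow> ('i \<Rightarrow> 'm set) \<Rightarrow> ('i \<Rightarrow> nat)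
    \<Rightarrow> (('i \<Rightarrow> nat \<Rightarrow> 'm) \<Rightarrow> 'k) set"
  for M I V r where
  const: "(\<lambda>x. c) \<in> poly_funs M I V r"
| linear: "i \<in> I \<Longrightarrow> j < r i \<Longrightarrow> \<phi> \<in> linear_forms M (V i) \<Longrightarrow> (\<lambda>x. \<phi> (x i j)) \<in> poly_funs M I V r"
| add: "p \<in> poly_funs M I V r \<Longrightarrow> q \<in> poly_funs M I V r \<Longrightarrow> (\<lambda>x. p x + q x) \<in> poly_funs M I V r"
| mult: "p \<in> poly_funs M I V r \<Longrightarrow> q \<in> poly_funs M I V r \<Longrightarrow> (\<lambda>x. p x * q x) \<in> poly_funs M I V r"

definition zariski_affine :: "('k::field, 'm) module \<Rightarrow> 'i set \<Rightarrow> ('i \<Rightarrow> 'm set) \<Rightarrow> ('i \<Rightarrow> nat)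
    \<Rightarrow> ('i \<Rightarrow> nat \<Rightarrow> 'm) topology" where
  "zariski_affine M I V r =
     topology_generated_by ((\<lambda>p. {x \<in> tuple_space I V r. p x \<noteq> 0}) ` poly_funs M I V r)"

definition frames :: "('k::field, 'm) module \<Rightarrow> 'i set \<Rightarrow> ('i \<Rightarrow> 'm set) \<Rightarrow> ('i \<Rightarrow> nat)
    \<Rightarrow> ('i \<Rightarrow> nat \<Rightarrow> 'm) set" where
  "frames M I V r = {x \<in> tuple_space I V r. \<forall>i\<in>I. inj_on (x i) {..<r i} \<and>
     \<not> LinearCombinations.module.lin_dep class_ring M (x i ` {..<r i})}"

definition frame_span :: "('k::field, 'm) module \<Rightarrow> 'i set \<Rightarrow> ('i \<Rightarrow> nat)
    \<Rightarrow> ('i \<Rightarrow> nat \<Rightarrow> 'm) \<Rightarrow> ('i \<Rightarrow> 'm set)" where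
  "frame_span M I r x =
     (\<lambda>i\<in>I. LinearCombinations.module.span class_ring M (x i ` {..<r i}))"

definition grassmannians :: "('k::field, 'm) module \<Rightarrow> 'i set \<Rightarrow> ('i \<Rightarrow> 'm set) \<Rightarrow> ('i \<Rightarrow> nat)
    \<Rightarrow> ('i \<Rightarrow> 'm set) set" where
  "grassmannians M I V r =
     (\<Pi>\<^sub>E i\<in>I. {U. subspace class_ring U (M\<lparr>carrier := V i\<rparr>)
                 \<and> vectorspace.dim class_ring (M\<lparr>carrier := U\<rparr>) = r i})"

text \<open>
  A product of Grassmannians is the quotient of the variety of tuples of frames (an open subvariety
  of affine space) by the product of the groups \<open>GL\<^bsub>r i\<^esub>\<close>; its Zariski topology is the quotient
  topology along the map sending a tuple of frames to the tuple of their spans.  In particular this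
  is not the product of the Zariski topologies of the factors.
\<close>

definition zariski_grassmannians :: "('k::field, 'm) module \<Rightarrow> 'i set \<Rightarrow> ('i \<Rightarrow> 'm set)
    \<Rightarrow> ('i \<Rightarrow> nat) \<Rightarrow> ('i \<Rightarrow> 'm set) topology" where
  "zariski_grassmannians M I V r = topology (\<lambda>W. W \<subseteq> grassmannians M I V r \<and>
     openin (subtopology (zariski_affine M I V r) (frames M I V r))
       {x \<in> frames M I V r. frame_span M I r x \<in> W})"

lemma openin_zariski_grassmannians:
  "openin (zariski_grassmannians M I V r) W \<longleftrightarrow> W \<subseteq> grassmannians M I V r \<and>
     openin (subtopology (zariski_affine M I V r) (frames M I V r))
       {x \<in> frames M I V r. frame_span M I r x \<in> W}"
proof -
  let ?F = "frames M I V r" and ?s = "frame_span M I r"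
  let ?X = "subtopology (zariski_affine M I V r) ?F"
  have "istopology (\<lambda>W. W \<subseteq> grassmannians M I V r \<and> openin ?X {x \<in> ?F. ?s x \<in> W})"
    unfolding istopology_def
  proof (intro conjI allI impI; (elim conjE)?)
    fix S T assume "openin ?X {x \<in> ?F. ?s x \<in> S}" "openin ?X {x \<in> ?F. ?s x \<in> T}"
    then have "openin ?X ({x \<in> ?F. ?s x \<in> S} \<inter> {x \<in> ?F. ?s x \<in> T})" by blast
    then show "openin ?X {x \<in> ?F. ?s x \<in> S \<inter> T}"
      by (rule back_subst) auto
  next
    fix \<K> assume "\<forall>K\<in>\<K>. K \<subseteq> grassmannians M I V r \<and> openin ?X {x \<in> ?F. ?s x \<in> K}"
    then have "openin ?X (\<Union>K\<in>\<K>. {x \<in> ?F. ?s x \<in> K})" by blast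
    then show "openin ?X {x \<in> ?F. ?s x \<in> \<Union>\<K>}"
      by (rule back_subst) auto
  qed auto
  then show ?thesis
    unfolding zariski_grassmannians_def by (simp add: topology_inverse')
qed

lemma topspace_zariski_grassmannians:
  assumes "vectorspace class_ring (M::('k::field,'m) module)" "\<And>i. i \<in> I \<Longrightarrow> subspace class_ring (V i) M"
  shows "topspace (zariski_grassmannians M I V r) = grassmannians M I V r"
proof -
  interpret M: vectorspace class_ring M by fact
  have "frame_span M I r x \<in> grassmannians M I V r" if x: "x \<in> frames M I V r" for x
    unfolding frame_span_def grassmannians_def
  proof (rule restrict_PiE_iff[THEN iffD2], intro ballI CollectI conjI)
    fix i assume i: "i \<in> I"
    let ?S = "x i ` {..<r i}"
    have SV: "?S \<subseteq> V i" and li: "\<not> M.lin_dep ?S" and inj: "inj_on (x i) {..<r i}" using x i by (auto simp: frames_def tuple_space_def PiE_iff Pi_def)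
    have sm: "submodule class_ring (V i) M" using assms(2)[OF i] by (simp add: subspace_def)
    have VM: "V i \<subseteq> carrier M" using sm by (simp add: submodule_def)
    interpret Vi: vectorspace class_ring "M\<lparr>carrier := V i\<rparr>" by (rule M.subspace_is_vs[OF assms(2)[OF i]])
    have sp: "M.span ?S \<subseteq> V i" by (rule M.span_is_subset[OF SV sm])
    have sub: "subspace class_ring (M.span ?S) M" by (rule M.span_is_subspace) (use SV VM in auto)
    show "subspace class_ring (M.span ?S) (M\<lparr>carrier := V i\<rparr>)"
      using sub sp Vi.vectorspace_axioms Vi.module_axioms assms(2)[OF i]
      unfolding subspace_def submodule_def  by auto
    interpret W: vectorspace class_ring "M\<lparr>carrier := M.span ?S\<rparr>" by (rule M.subspace_is_vs[OF sub])
    have ss: "?S \<subseteq> M.span ?S" by (rule M.in_own_span) (use SV VM in auto)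
    have sbm: "submodule class_ring (M.span ?S) M" using sub by (simp add: subspace_def)
    have "W.lin_indpt ?S" using M.span_li_not_depend(2)[OF ss sbm] li by simp
    moreover have "W.span ?S = M.span ?S" using M.span_li_not_depend(1)[OF ss sbm] by simp
    ultimately have "W.basis ?S" unfolding W.basis_def using ss by simp
    then have "W.dim = card ?S" by (intro W.dim_basis) auto
    then show "W.dim = r i" using inj by (simp add: card_image)
  qed
  then have "{x \<in> frames M I V r. frame_span M I r x \<in> grassmannians M I V r} = frames M I V r" by auto
  moreover have "tuple_space I V r \<subseteq> topspace (zariski_affine M I V r)"
  proof
    fix x assume "x \<in> tuple_space I V r"
    then have "x \<in> {x \<in> tuple_space I V r. (\<lambda>_. 1 :: 'k) x \<noteq> 0}" by simp
    then show "x \<in> topspace (zariski_affine M I V r)"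
      unfolding zariski_affine_def topology_generated_by_topspace
      by (rule UnionI[OF imageI[OF poly_funs.const[of 1 M I V r]]])
  qed
  then have "frames M I V r \<subseteq> topspace (zariski_affine M I V r)" by (auto simp: frames_def)
  then have "openin (subtopology (zariski_affine M I V r) (frames M I V r)) (frames M I V r)"
    by (metis openin_topspace topspace_subtopology_subset)
  ultimately have "openin (zariski_grassmannians M I V r) (grassmannians M I V r)"
    by (simp add: openin_zariski_grassmannians)
  then show ?thesis
    using openin_topspace[of "zariski_grassmannians M I V r"]
    unfolding openin_zariski_grassmannians[of M I V r "topspace _"]
    by (intro subset_antisym) (simp_all add: openin_subset)
qed

text \<open>\<open>P U\<close> holds for a general choice of subspaces \<open>U i \<subseteq> V i\<close> of any fixed dimensions.\<close>

definition for_general_subspaces :: "('k::field, 'm) module \<Rightarrow> 'i set \<Rightarrow> ('i \<Rightarrow> 'm set)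
    \<Rightarrow> (('i \<Rightarrow> 'm set) \<Rightarrow> bool) \<Rightarrow> bool" where
  "for_general_subspaces M I V P \<longleftrightarrow>
     (\<forall>r. \<exists>W. openin (zariski_grassmannians M I V r) W
            \<and> zariski_grassmannians M I V r closure_of W = grassmannians M I V r
            \<and> (\<forall>U\<in>W. P U))"


section \<open>The maps \<open>g\<^sup>t\<^sub>d\<close> and \<open>f\<^sup>t\<^sub>d\<close>\<close>

text \<open>
  A direct sum over the arrows starting and the arrows ending at \<open>t\<close> is a product of two dependent
  function spaces.
\<close>

definition out_in_sum :: "('v, 'e) pre_digraph \<Rightarrow> 'v \<Rightarrow> ('e \<Rightarrow> 'm set) \<Rightarrow> ('e \<Rightarrow> 'm set)
    \<Rightarrow> (('e \<Rightarrow> 'm) \<times> ('e \<Rightarrow> 'm)) set" where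
  "out_in_sum \<Gamma> t X Y = (\<Pi>\<^sub>E \<gamma>\<in>out_arcs \<Gamma> t. X \<gamma>) \<times> (\<Pi>\<^sub>E \<gamma>\<in>in_arcs \<Gamma> t. Y \<gamma>)"

definition maximal_rank :: "('x \<Rightarrow> 'y) \<Rightarrow> 'x set \<Rightarrow> 'y set \<Rightarrow> bool" where
  "maximal_rank h X Y \<longleftrightarrow> inj_on h X \<or> h ` X = Y"

definition g_map :: "('v, 'e) pre_digraph \<Rightarrow> ('e \<Rightarrow> 'k::field) \<Rightarrow> ('e \<Rightarrow> 'k) \<Rightarrow> 'v
    \<Rightarrow> ('e \<Rightarrow> ('v \<times> ('e + 'e) list \<Rightarrow>\<^sub>0 'k) set) \<times> ('e \<Rightarrow> ('v \<times> ('e + 'e) list \<Rightarrow>\<^sub>0 'k) set)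
    \<Rightarrow> ('v \<times> ('e + 'e) list \<Rightarrow>\<^sub>0 'k) set" where
  "g_map \<Gamma> a b t = (\<lambda>(x, y). let P = preproj_algebra \<Gamma> a b in
     (\<Oplus>\<^bsub>P\<^esub>\<gamma>\<in>out_arcs \<Gamma> t. x \<gamma> \<otimes>\<^bsub>P\<^esub> (a \<gamma> \<odot>\<^bsub>P\<^esub> beta \<Gamma> a b \<gamma>))
     \<oplus>\<^bsub>P\<^esub>
     (\<Oplus>\<^bsub>P\<^esub>\<gamma>\<in>in_arcs \<Gamma> t. y \<gamma> \<otimes>\<^bsub>P\<^esub> ((- b \<gamma>) \<odot>\<^bsub>P\<^esub> beta_star \<Gamma> a b \<gamma>)))"

definition f_map :: "('v, 'e) pre_digraph \<Rightarrow> ('e \<Rightarrow> 'k::field) \<Rightarrow> ('e \<Rightarrow> 'k) \<Rightarrow> 'v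
    \<Rightarrow> ('v \<times> ('e + 'e) list \<Rightarrow>\<^sub>0 'k) set
    \<Rightarrow> ('e \<Rightarrow> ('v \<times> ('e + 'e) list \<Rightarrow>\<^sub>0 'k) set) \<times> ('e \<Rightarrow> ('v \<times> ('e + 'e) list \<Rightarrow>\<^sub>0 'k) set)" where
  "f_map \<Gamma> a b t v = (let P = preproj_algebra \<Gamma> a b in
     (\<lambda>\<gamma>\<in>out_arcs \<Gamma> t. v \<otimes>\<^bsub>P\<^esub> beta_star \<Gamma> a b \<gamma>,
      \<lambda>\<gamma>\<in>in_arcs \<Gamma> t. v \<otimes>\<^bsub>P\<^esub> beta \<Gamma> a b \<gamma>))"

text \<open>The cosets of \<open>U\<close>: \<open>quot_proj \<Gamma> a b U\<close> is the projection and its image of \<open>V\<close> is \<open>V / U\<close>.\<close>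

definition quot_proj :: "('v, 'e) pre_digraph \<Rightarrow> ('e \<Rightarrow> 'k::field) \<Rightarrow> ('e \<Rightarrow> 'k)
    \<Rightarrow> ('v \<times> ('e + 'e) list \<Rightarrow>\<^sub>0 'k) set set \<Rightarrow> ('v \<times> ('e + 'e) list \<Rightarrow>\<^sub>0 'k) set
    \<Rightarrow> ('v \<times> ('e + 'e) list \<Rightarrow>\<^sub>0 'k) set set" where
  "quot_proj \<Gamma> a b U v = U +>\<^bsub>preproj_algebra \<Gamma> a b\<^esub> v"

definition out_in_map :: "('v, 'e) pre_digraph \<Rightarrow> 'v \<Rightarrow> ('e \<Rightarrow> 'm \<Rightarrow> 'n) \<Rightarrow> ('e \<Rightarrow> 'm \<Rightarrow> 'n)
    \<Rightarrow> ('e \<Rightarrow> 'm) \<times> ('e \<Rightarrow> 'm) \<Rightarrow> ('e \<Rightarrow> 'n) \<times> ('e \<Rightarrow> 'n)" where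
  "out_in_map \<Gamma> t \<sigma> \<tau> =
     (\<lambda>(x, y). (\<lambda>\<gamma>\<in>out_arcs \<Gamma> t. \<sigma> \<gamma> (x \<gamma>), \<lambda>\<gamma>\<in>in_arcs \<Gamma> t. \<tau> \<gamma> (y \<gamma>)))"

text \<open>The index pairs \<open>(u, c)\<close> of the modules \<open>V\<^sup>u\<^sub>c\<close> occurring at \<open>t\<close>.\<close>

definition neighbours :: "('v, 'e) pre_digraph \<Rightarrow> 'v \<Rightarrow> int \<Rightarrow> int \<Rightarrow> ('v \<times> int) set" where
  "neighbours \<Gamma> t c c' =
     (\<lambda>\<gamma>. (head \<Gamma> \<gamma>, c)) ` out_arcs \<Gamma> t \<union> (\<lambda>\<gamma>. (tail \<Gamma> \<gamma>, c')) ` in_arcs \<Gamma> t"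

end

theory Submission
  imports Defs "HOL-Library.Function_Algebras"
begin

text \<open>
  Let \<open>\<delta> x = 0\<close> for the arrows \<open>x\<close> of \<open>\<Gamma>\<close> and \<open>\<delta> x = 1\<close> for the reversed ones. For each vertex \<open>t\<close> and
  degree \<open>c\<close>, the presentation of the algebra makes \<open>V\<^sup>t\<^sub>c\<^sub>-\<^sub>1 \<rightarrow> \<Oplus> V\<^sup>h\<^sub>c\<^sub>-\<^sub>\<delta> \<rightarrow> V\<^sup>t\<^sub>c\<close> exact in the middle, and for
  \<open>c > 0\<close> also on the right. Along these sequences, reflections at sinks carry the spaces \<open>V\<^sup>u\<^sub>c\<close> on a slice of
  the translation quiver to those on the next slice, and they preserve the vanishing of the
  self-extensions of this representation of the slice, starting from zero spaces. Vanishing means that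
  every tuple of linear maps \<open>h\<close> along the arrows is of the form \<open>\<phi> R - R \<phi>\<close> with endomorphisms \<open>\<phi>\<close>
  of the spaces at the vertices.

  Suppose that the restriction of \<open>g\<close> to \<open>\<Oplus> U\<close> is not of maximal rank: it kills some \<open>n \<noteq> 0\<close> and misses
  some \<open>w\<close>. Writing a tuple \<open>h\<close> with \<open>\<Sum> h n = - w\<close> in the above form gives endomorphisms \<open>\<phi>\<close> such that
  the restriction of \<open>g\<close> to the deformed subspaces \<open>(1 + e \<phi>) U\<close> has larger rank for general \<open>e\<close>. So the maximal rank is
  attained, and by irreducibility of the space of frames it is attained on a dense open set. The
  argument for \<open>f\<close> is the same, applied to the sum of \<open>f\<close> and the inclusion of \<open>\<Oplus> U\<close>.
\<close>

section \<open>Linear algebra of families of vectors\<close>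

text \<open>The obstacle is that arrows with a common end point share one subspace. Endomorphisms
  chosen separately for each arrow would be easy to find but do not deform the shared subspaces
  consistently. Rigidity bridges this gap: a tuple \<open>h\<close> indexed by arrows is realised by
  a tuple \<phi> indexed by vertices.

  Two slices through \<open>(t, d)\<close> are used. In one, \<open>(t, d)\<close> is a sink and the
  maps into it are the components of \<open>g\<close>; in the other it is a source and the maps out
  of it are the components of \<open>f\<close>. On a kernel vector \<open>n\<close> of
  \<open>g\<close> the contribution of \<phi> at \<open>t\<close> drops out, because there \<phi> is
  applied to \<open>g n = 0\<close>. For \<open>f\<close> the corresponding contribution stays in
  the image of \<open>f\<close>. What remains in both cases is the first-order change caused by
  moving the subspaces along \<phi>.

  In degree 0 the trivial paths prevent \<open>g\<close> from being onto. This does no harm to the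
  reflections, because the term on the left of the sequence then has degree -1 and is zero.\<close>

lemma infinite_UNIV_alg_closed: "infinite (UNIV :: 'k::alg_closed_field set)"
proof
  assume fin: "finite (UNIV :: 'k set)"
  \<comment> \<open>\<open>?q\<close> vanishes everywhere, so \<open>?q + 1\<close> has positive
    degree but no root.\<close>
  let ?q = "\<Prod>c\<in>(UNIV :: 'k set). [:- c, 1:]"
  have val: "poly (?q + 1) x = 1" for x
  proof -
    have "(\<Prod>c\<in>(UNIV :: 'k set). poly [:- c, 1:] x) = 0"
      by (rule prod_zero[OF fin]) (rule bexI[of _ x], simp_all)
    then show ?thesis by (simp only: poly_add poly_prod poly_1 add_0)
  qed
  have "degree ?q = card (UNIV :: 'k set)"
    by (subst degree_prod_eq_sum_degree) simp_all
  then have dq: "degree ?q > 0"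
    using finite_UNIV_card_ge_0[OF fin] by (simp only:)
  then have "degree (?q + 1) = degree ?q"
    by (intro degree_add_eq_left) (simp only: degree_1)
  then have "degree (?q + 1) > 0" using dq by (simp only:)
  from alg_closed_imp_poly_has_root[OF this] obtain x where "poly (?q + 1) x = 0" ..
  then show False
    unfolding val by (rule notE[OF one_neq_zero])
qed

lemma poly_nonzero_value:
  fixes p :: "'k::field poly"
  assumes inf: "infinite (UNIV :: 'k set)" and p: "p \<noteq> 0"
  shows "\<exists>x. poly p x \<noteq> 0"
proof -
  have "infinite (UNIV - {x. poly p x = 0})"
    by (rule Diff_infinite_finite[OF poly_roots_finite[OF p] inf])
  then obtain x where "x \<in> UNIV - {x. poly p x = 0}"
    using infinite_imp_nonempty by blast
  then show ?thesis by blast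
qed

text \<open>Coefficients are indexed by \<open>S\<close> and not by the vectors: the columns of a
  varying matrix may coincide, and a repetition has to count as a dependence.\<close>

definition indep_family :: "('k::zero \<Rightarrow> 'n \<Rightarrow> 'n::comm_monoid_add) \<Rightarrow> 's set \<Rightarrow> ('s \<Rightarrow> 'n) \<Rightarrow> bool" where
  "indep_family scale S y \<longleftrightarrow> (\<forall>c. (\<Sum>s\<in>S. scale (c s) (y s)) = 0 \<longrightarrow> (\<forall>s\<in>S. c s = 0))"

locale vec_space = vector_space scale
  for scale :: "'k::field \<Rightarrow> 'n::ab_group_add \<Rightarrow> 'n"
begin

lemma span_family:
  assumes "finite S"
  shows "span (y ` S) = {\<Sum>s\<in>S. scale (c s) (y s) | c. True}"
proof
  show "span (y ` S) \<subseteq> {\<Sum>s\<in>S. scale (c s) (y s) | c. True}"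
  proof (rule span_minimal)
    show "y ` S \<subseteq> {\<Sum>s\<in>S. scale (c s) (y s) | c. True}"
    proof clarify
      fix s assume s: "s \<in> S"
      have "y s = (\<Sum>s'\<in>S. scale (if s' = s then 1 else 0) (y s'))"
        using assms s by (subst sum.remove[OF assms s]) (auto intro!: sum.neutral)
      then show "\<exists>c. y s = (\<Sum>s\<in>S. scale (c s) (y s)) \<and> True"
        by (intro exI[of _ "\<lambda>s'. if s' = s then 1 else 0"]) simp
    qed
    show "subspace {\<Sum>s\<in>S. scale (c s) (y s) | c. True}"
    proof (rule subspaceI)
      show "0 \<in> {\<Sum>s\<in>S. scale (c s) (y s) | c. True}"
        by (auto intro!: exI[of _ "\<lambda>_. 0"])
    next
      fix u v
      assume "u \<in> {\<Sum>s\<in>S. scale (c s) (y s) | c. True}" "v \<in> {\<Sum>s\<in>S. scale (c s) (y s) | c. True}"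
      then obtain c c' where "u = (\<Sum>s\<in>S. scale (c s) (y s))" "v = (\<Sum>s\<in>S. scale (c' s) (y s))"
        by auto
      then have "u + v = (\<Sum>s\<in>S. scale (c s + c' s) (y s))"
        by (simp add: scale_left_distrib sum.distrib)
      then show "u + v \<in> {\<Sum>s\<in>S. scale (c s) (y s) | c. True}"
        by (auto intro!: exI[of _ "\<lambda>s. c s + c' s"])
    next
      fix k u assume "u \<in> {\<Sum>s\<in>S. scale (c s) (y s) | c. True}"
      then obtain c where "u = (\<Sum>s\<in>S. scale (c s) (y s))" by auto
      then have "scale k u = (\<Sum>s\<in>S. scale (k * c s) (y s))"
        by (simp add: scale_sum_right)
      then show "scale k u \<in> {\<Sum>s\<in>S. scale (c s) (y s) | c. True}"
        by (auto intro!: exI[of _ "\<lambda>s. k * c s"])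
    qed
  qed
  show "{\<Sum>s\<in>S. scale (c s) (y s) | c. True} \<subseteq> span (y ` S)"
    by (auto intro!: span_sum span_scale intro: span_base)
qed

lemma indep_family_iff:
  assumes fin: "finite S"
  shows "indep_family scale S y \<longleftrightarrow> inj_on y S \<and> independent (y ` S)"
proof
  assume L: "indep_family scale S y"
  have inj: "inj_on y S"
  proof (rule inj_onI, rule ccontr)
    fix s s' assume s: "s \<in> S" "s' \<in> S" "y s = y s'" "s \<noteq> s'"
    let ?c = "\<lambda>u. if u = s then 1 else if u = s' then - 1 else 0 :: 'k"
    have "(\<Sum>u\<in>S. scale (?c u) (y u)) = (\<Sum>u\<in>{s, s'}. scale (?c u) (y u))"
      using fin s by (intro sum.mono_neutral_right) auto
    also have "\<dots> = 0" using s by simp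
    finally have "\<forall>u\<in>S. ?c u = 0"
      using L[unfolded indep_family_def, THEN spec[of _ ?c]] by blast
    then have "?c s = 0" using s(1) by (rule bspec)
    then show False by simp
  qed
  moreover have "independent (y ` S)"
  proof (rule independent_if_scalars_zero)
    fix f x assume f: "(\<Sum>x\<in>y ` S. scale (f x) x) = 0" and "x \<in> y ` S"
    then obtain s where s: "s \<in> S" "x = y s" by auto
    have "(\<Sum>s\<in>S. scale (f (y s)) (y s)) = 0"
      using f by (simp add: sum.reindex[OF inj])
    then have "\<forall>s\<in>S. f (y s) = 0"
      using L[unfolded indep_family_def, rule_format, of "\<lambda>s. f (y s)"] by auto
    then show "f x = 0" using s by simp
  qed (use fin in simp)
  ultimately show "inj_on y S \<and> independent (y ` S)" ..
next
  assume R: "inj_on y S \<and> independent (y ` S)"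
  show "indep_family scale S y"
    unfolding indep_family_def
  proof (intro allI impI ballI)
    fix c s assume c: "(\<Sum>s\<in>S. scale (c s) (y s)) = 0" and s: "s \<in> S"
    have inj: "inj_on y S" using R by simp
    have "(\<Sum>v\<in>y ` S. scale (c (the_inv_into S y v)) v) = 0"
      unfolding sum.reindex[OF inj] using c by (simp add: the_inv_into_f_f[OF inj])
    then have "c (the_inv_into S y (y s)) = 0"
      using R s fin independentD[of "y ` S" "y ` S" "\<lambda>v. c (the_inv_into S y v)" "y s"] by auto
    then show "c s = 0" using s inj by (simp add: the_inv_into_f_f)
  qed
qed

lemma family_basis_exists:
  assumes "finite S"
  obtains T where "T \<subseteq> S" "indep_family scale T y" "y ` S \<subseteq> span (y ` T)"
proof -
  obtain B where B: "B \<subseteq> y ` S" "independent B" "y ` S \<subseteq> span B"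
    using maximal_independent_subset[of "y ` S"] by auto
  then obtain T where T: "T \<subseteq> S" "inj_on y T" "B = y ` T"
    using subset_image_inj[of B y S] by auto
  have "finite T" using T assms finite_subset by auto
  then have "indep_family scale T y" using T B by (simp add: indep_family_iff)
  then show ?thesis using T B that by auto
qed

lemma indep_family_card_le:
  assumes "finite S" "indep_family scale S y" "y ` S \<subseteq> span B" "finite B"
  shows "card S \<le> card B"
proof -
  have "inj_on y S" "independent (y ` S)"
    using assms indep_family_iff by auto
  then have "card (y ` S) \<le> card B"
    using independent_span_bound[of B "y ` S"] assms by auto
  then show ?thesis
    using card_image[OF \<open>inj_on y S\<close>] by simp
qed

lemma indep_family_dim:
  assumes "finite S" "indep_family scale S y"
  shows "dim (span (y ` S)) = card S"
  using assms indep_family_iff[of S y] dim_span_eq_card_independent[of "y ` S"] card_image[of y S]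
  by metis

lemma linear_functional_exists:
  assumes "x \<noteq> 0"
  obtains \<psi> where "Vector_Spaces.linear scale (*) \<psi>" "\<psi> x = 1"
proof -
  interpret K: vector_space "(*) :: 'k \<Rightarrow> 'k \<Rightarrow> 'k"
    by unfold_locales (auto simp: algebra_simps)
  interpret P: vector_space_pair scale "(*) :: 'k \<Rightarrow> 'k \<Rightarrow> 'k" ..
  have "independent {x}" using assms by simp
  from P.linear_independent_extend[OF this, of "\<lambda>_. 1"] show ?thesis
    using that by auto
qed

text \<open>
  Elimination replaces minors here: once some functional does not vanish on the vector \<open>y s\<close>,
  the remaining vectors are independent modulo \<open>y s\<close> iff their projections along \<open>y s\<close> are.
\<close>

lemma indep_family_open:
  fixes y :: "'s \<Rightarrow> 'x \<Rightarrow> 'n"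
  assumes const: "\<And>c. (\<lambda>_. c) \<in> \<P>"
    and add: "\<And>p q. p \<in> \<P> \<Longrightarrow> q \<in> \<P> \<Longrightarrow> (\<lambda>x. p x + q x) \<in> \<P>"
    and mult: "\<And>p q. p \<in> \<P> \<Longrightarrow> q \<in> \<P> \<Longrightarrow> (\<lambda>x. p x * q x) \<in> \<P>"
    and "finite S"
    and "\<And>s \<psi>. s \<in> S \<Longrightarrow> Vector_Spaces.linear scale (*) \<psi> \<Longrightarrow> \<exists>p\<in>\<P>. \<forall>x\<in>X. \<psi> (y s x) = p x"
    and "x1 \<in> X" and "indep_family scale S (\<lambda>s. y s x1)"
  shows "\<exists>p\<in>\<P>. p x1 \<noteq> 0 \<and> (\<forall>x\<in>X. p x \<noteq> 0 \<longrightarrow> indep_family scale S (\<lambda>s. y s x))"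
  using assms(4,5,7)
proof (induction S arbitrary: y rule: finite_induct)
  case empty
  then show ?case using const[of 1] by (intro bexI[of _ "\<lambda>_. 1"]) (auto simp: indep_family_def)
next
  case (insert s0 S)
  have "y s0 x1 \<noteq> 0"
  proof
    assume 0: "y s0 x1 = 0"
    let ?c = "\<lambda>s. if s = s0 then 1 else 0 :: 'k"
    have "(\<Sum>s\<in>insert s0 S. scale (?c s) (y s x1)) = 0"
      using 0 insert.hyps by (auto intro!: sum.neutral)
    then have "?c s0 = 0"
      using insert.prems(2)[unfolded indep_family_def, THEN spec[of _ ?c]] by blast
    then show False by simp
  qed
  then obtain \<psi> where \<psi>: "Vector_Spaces.linear scale (*) \<psi>" "\<psi> (y s0 x1) = 1"
    by (rule linear_functional_exists)
  interpret psi: Vector_Spaces.linear scale "(*)" \<psi> by (rule \<psi>(1))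
  \<comment> \<open>The projection along \<open>y s0 x\<close> into the kernel of \<psi>, multiplied
    by \<open>\<psi> (y s0 x)\<close>. Clearing this denominator keeps the coordinates inside the
    class of functions.\<close>
  define y' where "y' = (\<lambda>s x. scale (\<psi> (y s0 x)) (y s x) - scale (\<psi> (y s x)) (y s0 x))"
  have sum_y': "(\<Sum>s\<in>S. scale (c s) (y' s x)) =
      scale (\<psi> (y s0 x)) (\<Sum>s\<in>S. scale (c s) (y s x)) - scale (\<Sum>s\<in>S. c s * \<psi> (y s x)) (y s0 x)" for c x
    by (simp add: y'_def scale_right_diff_distrib sum_subtractf scale_sum_right scale_sum_left mult.commute)
  have "\<exists>p\<in>\<P>. \<forall>x\<in>X. \<phi> (y' s x) = p x"
    if s: "s \<in> S" and \<phi>: "Vector_Spaces.linear scale (*) \<phi>" for s \<phi>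
  proof -
    interpret phi: Vector_Spaces.linear scale "(*)" \<phi> by (rule \<phi>)
    have sS: "s \<in> insert s0 S" "s0 \<in> insert s0 S" using s by auto
    obtain p1 where p1: "p1 \<in> \<P>" "\<forall>x\<in>X. \<psi> (y s0 x) = p1 x"
      using insert.prems(1)[OF sS(2) \<psi>(1)] by blast
    obtain p2 where p2: "p2 \<in> \<P>" "\<forall>x\<in>X. \<phi> (y s x) = p2 x"
      using insert.prems(1)[OF sS(1) \<phi>] by blast
    obtain p3 where p3: "p3 \<in> \<P>" "\<forall>x\<in>X. \<psi> (y s x) = p3 x"
      using insert.prems(1)[OF sS(1) \<psi>(1)] by blast
    obtain p4 where p4: "p4 \<in> \<P>" "\<forall>x\<in>X. \<phi> (y s0 x) = p4 x"
      using insert.prems(1)[OF sS(2) \<phi>] by blast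
    note p = p1 p2 p3 p4
    have "(\<lambda>x. p1 x * p2 x + (- 1) * (p3 x * p4 x)) \<in> \<P>"
      using p by (intro add mult const)
    moreover have "\<forall>x\<in>X. \<phi> (y' s x) = p1 x * p2 x + (- 1) * (p3 x * p4 x)"
      using p by (simp add: y'_def phi.diff phi.scale)
    ultimately show ?thesis
      by (intro bexI[of _ "\<lambda>x. p1 x * p2 x + (- 1) * (p3 x * p4 x)"])
  qed
  moreover have "indep_family scale S (\<lambda>s. y' s x1)"
    unfolding indep_family_def
  proof (intro allI impI ballI)
    fix c s assume "(\<Sum>s\<in>S. scale (c s) (y' s x1)) = 0" and s: "s \<in> S"
    then have eq: "(\<Sum>s\<in>S. scale (c s) (y s x1)) - scale (\<Sum>s\<in>S. c s * \<psi> (y s x1)) (y s0 x1) = 0"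
      unfolding sum_y' \<psi>(2) by simp
    \<comment> \<open>As \<psi> is 1 on \<open>y s0 x1\<close>, this coefficient at
      \<open>s0\<close> turns a relation among the projections into one among the original
      vectors.\<close>
    define c' where "c' = c(s0 := - (\<Sum>s\<in>S. c s * \<psi> (y s x1)))"
    have "(\<Sum>s\<in>S. scale (c' s) (y s x1)) = (\<Sum>s\<in>S. scale (c s) (y s x1))"
      using insert.hyps by (intro sum.cong) (auto simp: c'_def)
    then have "(\<Sum>s\<in>insert s0 S. scale (c' s) (y s x1)) = 0"
      using eq insert.hyps by (simp add: c'_def)
    then have "c' s = 0"
      using insert.prems(2)[unfolded indep_family_def, THEN spec[of _ c']] s by blast
    moreover have "s \<noteq> s0" using s insert.hyps by blast
    ultimately show "c s = 0" by (simp add: c'_def)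
  qed
  ultimately obtain p where p: "p \<in> \<P>" "p x1 \<noteq> 0"
    "\<And>x. x \<in> X \<Longrightarrow> p x \<noteq> 0 \<Longrightarrow> indep_family scale S (\<lambda>s. y' s x)"
    using insert.IH[of y'] by metis
  obtain q where q: "q \<in> \<P>" "\<And>x. x \<in> X \<Longrightarrow> \<psi> (y s0 x) = q x"
    using insert.prems(1)[OF _ \<psi>(1), of s0] by auto
  \<comment> \<open>The factor \<open>q\<close> is \<psi> on \<open>y s0 x\<close>. Where it is
    nonzero the elimination can be reversed, and it is 1 at \<open>x1\<close>.\<close>
  have "(\<lambda>x. p x * q x) \<in> \<P>" using p q by (intro mult)
  moreover have "p x1 * q x1 \<noteq> 0" using p q(2)[OF \<open>x1 \<in> X\<close>] \<psi>(2) by simp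
  moreover have "indep_family scale (insert s0 S) (\<lambda>s. y s x)" if x: "x \<in> X" and nz: "p x * q x \<noteq> 0" for x
    unfolding indep_family_def
  proof (intro allI impI)
    fix c assume "(\<Sum>s\<in>insert s0 S. scale (c s) (y s x)) = 0"
    then have eq: "(\<Sum>s\<in>S. scale (c s) (y s x)) = - scale (c s0) (y s0 x)"
      using insert.hyps by (simp add: eq_neg_iff_add_eq_0 add.commute)
    have "\<psi> (\<Sum>s\<in>S. scale (c s) (y s x)) = (\<Sum>s\<in>S. c s * \<psi> (y s x))"
      by (simp add: psi.sum psi.scale)
    then have "(\<Sum>s\<in>S. c s * \<psi> (y s x)) = - (c s0 * \<psi> (y s0 x))"
      unfolding eq by (simp add: psi.neg psi.scale)
    then have "(\<Sum>s\<in>S. scale (c s) (y' s x)) = 0"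
      unfolding sum_y' eq by (simp add: mult.commute)
    then have c0: "\<forall>s\<in>S. c s = 0"
      using p(3)[OF x] nz unfolding indep_family_def by auto
    then have "scale (c s0) (y s0 x) = 0" using eq by simp
    moreover have "y s0 x \<noteq> 0" using q(2)[OF x] nz psi.zero by auto
    ultimately show "\<forall>s\<in>insert s0 S. c s = 0" using c0 by simp
  qed
  ultimately show ?case by (intro bexI[of _ "\<lambda>x. p x * q x"]) auto
qed

text \<open>A subfamily \<open>T\<close> that is a basis of the span at \<open>x1\<close> stays
  independent on an open set. All vectors stay in \<open>E\<close>, which generates a space of
  dimension at most \<open>card T\<close>, so \<open>T\<close> goes on spanning it.\<close>

lemma span_family_open:
  fixes y :: "'s \<Rightarrow> 'x \<Rightarrow> 'n"
  assumes const: "\<And>c. (\<lambda>_. c) \<in> \<P>"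
    and add: "\<And>p q. p \<in> \<P> \<Longrightarrow> q \<in> \<P> \<Longrightarrow> (\<lambda>x. p x + q x) \<in> \<P>"
    and mult: "\<And>p q. p \<in> \<P> \<Longrightarrow> q \<in> \<P> \<Longrightarrow> (\<lambda>x. p x * q x) \<in> \<P>"
    and fin: "finite S"
    and poly: "\<And>s \<psi>. s \<in> S \<Longrightarrow> Vector_Spaces.linear scale (*) \<psi> \<Longrightarrow> \<exists>p\<in>\<P>. \<forall>x\<in>X. \<psi> (y s x) = p x"
    and x1: "x1 \<in> X" and yE: "\<And>s x. s \<in> S \<Longrightarrow> x \<in> X \<Longrightarrow> y s x \<in> E" and E: "E \<subseteq> span ((\<lambda>s. y s x1) ` S)"
  shows "\<exists>p\<in>\<P>. p x1 \<noteq> 0 \<and> (\<forall>x\<in>X. p x \<noteq> 0 \<longrightarrow> E \<subseteq> span ((\<lambda>s. y s x) ` S))"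
proof -
  obtain T where T: "T \<subseteq> S" "indep_family scale T (\<lambda>s. y s x1)" "(\<lambda>s. y s x1) ` S \<subseteq> span ((\<lambda>s. y s x1) ` T)"
    using family_basis_exists[OF fin, of "\<lambda>s. y s x1"] by blast
  have finT: "finite T" using T fin finite_subset by blast
  obtain p where p: "p \<in> \<P>" "p x1 \<noteq> 0" "\<And>x. x \<in> X \<Longrightarrow> p x \<noteq> 0 \<Longrightarrow> indep_family scale T (\<lambda>s. y s x)"
    using indep_family_open[OF const add mult finT, of X y x1] poly x1 T(1,2) by blast
  have "E \<subseteq> span ((\<lambda>s. y s x) ` S)" if x: "x \<in> X" "p x \<noteq> 0" for x
  proof (rule ccontr)
    assume "\<not> ?thesis"
    then obtain w where w: "w \<in> E" "w \<notin> span ((\<lambda>s. y s x) ` S)" by auto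
    then have w': "w \<notin> span ((\<lambda>s. y s x) ` T)" using span_mono[of "(\<lambda>s. y s x) ` T" "(\<lambda>s. y s x) ` S"] T by blast
    let ?B = "(\<lambda>s. y s x) ` T"
    have ind: "inj_on (\<lambda>s. y s x) T" "independent ?B"
      using p(3)[OF x] finT indep_family_iff[of T "\<lambda>s. y s x"] by auto
    have "independent (insert w ?B)" using independent_insertI[OF w' ind(2)] .
    moreover have "insert w ?B \<subseteq> span ((\<lambda>s. y s x1) ` T)"
    proof -
      have "insert w ?B \<subseteq> E" using w yE x T by auto
      also have "E \<subseteq> span (span ((\<lambda>s. y s x1) ` T))"
        using E span_mono[OF T(3)] by blast
      finally show ?thesis by (simp add: span_span)
    qed
    ultimately have "card (insert w ?B) \<le> card ((\<lambda>s. y s x1) ` T)"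
      using independent_span_bound finT by auto
    also have "\<dots> \<le> card T" by (rule card_image_le[OF finT])
    also have "card T = card ?B" using ind by (simp add: card_image)
    also have "\<dots> < card (insert w ?B)" using w' span_base[of w ?B] finT by (subst card_insert_disjoint) auto
    finally show False by simp
  qed
  then show ?thesis using p by blast
qed

text \<open>Put \<open>w = \<Sum> c z\<close>. As \<open>\<Sum> c y = 0\<close>, the deformed
  combination \<open>\<Sum> c (y + e z)\<close> is \<open>e w\<close>, so for
  \<open>e \<noteq> 0\<close> the deformed span contains \<open>w\<close>. A basis taken from
  \<open>y\<close> together with \<open>w\<close> is independent at \<open>e = 0\<close>, hence
  stays so at general \<open>e\<close>, and it has one element more than the old rank.\<close>

lemma rank_jump:
  fixes y z :: "'s \<Rightarrow> 'n"
  assumes fin: "finite S" and c0: "(\<Sum>s\<in>S. scale (c s) (y s)) = 0"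
    and cz: "(\<Sum>s\<in>S. scale (c s) (z s)) \<notin> span (y ` S)"
  shows "\<exists>q. q \<noteq> 0 \<and> (\<forall>e. poly q e \<noteq> 0 \<longrightarrow> dim (span (y ` S)) < dim (span ((\<lambda>s. y s + scale e (z s)) ` S)))"
proof -
  obtain T where T: "T \<subseteq> S" "indep_family scale T y" "y ` S \<subseteq> span (y ` T)"
    using family_basis_exists[OF fin, of y] by blast
  have finT: "finite T" using T fin finite_subset by blast
  have spT: "span (y ` S) = span (y ` T)"
    using T span_mono[of "y ` T" "y ` S"] span_mono[OF T(3)] by (auto simp: span_span)
  define w where "w = (\<Sum>s\<in>S. scale (c s) (z s))"
  \<comment> \<open>The moving basis vectors and, at \<open>None\<close>, the fixed vector
    \<open>w\<close>.\<close>
  define u where "u = (\<lambda>s e. case s of None \<Rightarrow> w | Some s \<Rightarrow> y s + scale e (z s))"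
  define U where "U = insert None (Some ` T)"
  \<comment> \<open>The function class of \<open>indep_family_open\<close> is kept abstract for
    this: here it consists of polynomials in the parameter \<open>e\<close>, later of the polynomial
    functions of frames.\<close>
  define \<P> where "\<P> = range (\<lambda>q :: 'k poly. poly q)"
  have finU: "finite U" using finT by (simp add: U_def)
  have "\<exists>p\<in>\<P>. p 0 \<noteq> 0 \<and> (\<forall>x\<in>UNIV. p x \<noteq> 0 \<longrightarrow> indep_family scale U (\<lambda>s. u s x))"
  proof (rule indep_family_open[OF _ _ _ finU])
    show "(\<lambda>_. c) \<in> \<P>" for c :: 'k unfolding \<P>_def by (rule range_eqI[of _ _ "[:c:]"]) auto
    show "(\<lambda>x. p x + q x) \<in> \<P>" if "p \<in> \<P>" "q \<in> \<P>" for p q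
      using that unfolding \<P>_def by (auto simp flip: poly_add)
    show "(\<lambda>x. p x * q x) \<in> \<P>" if "p \<in> \<P>" "q \<in> \<P>" for p q
      using that unfolding \<P>_def by (auto simp flip: poly_mult)
    show "\<exists>p\<in>\<P>. \<forall>e\<in>UNIV. \<psi> (u s e) = p e" if s: "s \<in> U" and \<psi>: "Vector_Spaces.linear scale (*) \<psi>" for s \<psi>
    proof -
      interpret psi: Vector_Spaces.linear scale "(*)" \<psi> by (rule \<psi>)
      show ?thesis
      proof (cases s)
        case None
        then have "\<forall>e. \<psi> (u s e) = poly [:\<psi> w:] e" by (simp add: u_def)
        then show ?thesis unfolding \<P>_def by blast
      next
        case (Some s')
        then have "\<forall>e. \<psi> (u s e) = poly [:\<psi> (y s'), \<psi> (z s'):] e"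
          by (simp add: u_def psi.add psi.scale mult.commute)
        then show ?thesis unfolding \<P>_def by blast
      qed
    qed
    show "indep_family scale U (\<lambda>s. u s 0)"
      unfolding indep_family_def
    proof (intro allI impI)
      fix k assume "(\<Sum>s\<in>U. scale (k s) (u s 0)) = 0"
      then have eq: "scale (k None) w + (\<Sum>s\<in>T. scale (k (Some s)) (y s)) = 0"
        using finT by (simp add: U_def u_def sum.reindex)
      have kN: "k None = 0"
      proof (rule ccontr)
        assume nz: "k None \<noteq> 0"
        have "scale (k None) w = - (\<Sum>s\<in>T. scale (k (Some s)) (y s))"
          using eq by (simp add: eq_neg_iff_add_eq_0)
        also have "\<dots> \<in> span (y ` S)"
          using T by (intro span_neg span_sum span_scale span_base) auto
        finally have "scale (inverse (k None)) (scale (k None) w) \<in> span (y ` S)"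
          by (rule span_scale)
        then show False using nz cz by (simp add: w_def)
      qed
      then have "(\<Sum>s\<in>T. scale (k (Some s)) (y s)) = 0" using eq by simp
      then have "\<forall>s\<in>T. k (Some s) = 0"
        using T(2)[unfolded indep_family_def, rule_format, of "\<lambda>s. k (Some s)"] by blast
      then show "\<forall>s\<in>U. k s = 0" using kN by (auto simp: U_def)
    qed
  qed auto
  then obtain p where p: "poly p 0 \<noteq> 0" "\<And>e. poly p e \<noteq> 0 \<Longrightarrow> indep_family scale U (\<lambda>s. u s e)"
    by (auto simp: \<P>_def)
  \<comment> \<open>The factor \<open>[:0, 1:]\<close> excludes \<open>e = 0\<close>, where
    \<open>w\<close> is not in the span.\<close>
  define q where "q = p * [:0, 1:]"
  have "q \<noteq> 0" using p(1) by (auto simp: q_def)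
  moreover have "dim (span (y ` S)) < dim (span ((\<lambda>s. y s + scale e (z s)) ` S))" if e: "poly q e \<noteq> 0" for e
  proof -
    have e0: "e \<noteq> 0" and pe: "poly p e \<noteq> 0" using e by (auto simp: q_def)
    have "scale e w = (\<Sum>s\<in>S. scale (c s) (y s + scale e (z s)))"
      using c0 by (simp add: w_def scale_right_distrib sum.distrib scale_sum_right mult.commute)
    then have "scale e w \<in> span ((\<lambda>s. y s + scale e (z s)) ` S)"
      by (auto intro!: span_sum span_scale intro: span_base)
    then have "scale (inverse e) (scale e w) \<in> span ((\<lambda>s. y s + scale e (z s)) ` S)"
      by (rule span_scale)
    then have w: "w \<in> span ((\<lambda>s. y s + scale e (z s)) ` S)" using e0 by simp
    have sub: "(\<lambda>s. u s e) ` U \<subseteq> span ((\<lambda>s. y s + scale e (z s)) ` S)"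
      using w T(1) by (auto simp: U_def u_def intro!: span_base)
    obtain B where B: "B \<subseteq> (\<lambda>s. y s + scale e (z s)) ` S" "independent B"
      "(\<lambda>s. y s + scale e (z s)) ` S \<subseteq> span B"
      using maximal_independent_subset by blast
    have finB: "finite B" using B fin finite_subset by blast
    have spB: "span ((\<lambda>s. y s + scale e (z s)) ` S) = span B"
      using B span_mono[OF B(1)] span_mono[OF B(3)] by (auto simp: span_span)
    have "card U \<le> card B"
      using indep_family_card_le[OF finU p(2)[OF pe]] sub finB spB by auto
    moreover have "card U = Suc (card T)"
      using finT by (simp add: U_def card_image)
    ultimately show ?thesis
      unfolding spT spB indep_family_dim[OF finT T(2)] dim_span_eq_card_independent[OF B(2)] by simp
  qed
  ultimately show ?thesis by blast
qed

end

section \<open>Rigidity of slices\<close>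

definition fun_scale :: "('k \<Rightarrow> 'n \<Rightarrow> 'n) \<Rightarrow> 'k \<Rightarrow> ('x \<Rightarrow> 'n) \<Rightarrow> 'x \<Rightarrow> 'n" where
  "fun_scale scale c f = (\<lambda>x. scale c (f x))"

lemma fun_scale_apply [simp]: "fun_scale scale c f x = scale c (f x)"
  by (simp add: fun_scale_def)

lemma sum_fun_apply: "(\<Sum>a\<in>A. f a) x = (\<Sum>a\<in>A. f a x)"
  for f :: "'a \<Rightarrow> 'x \<Rightarrow> 'n::comm_monoid_add"
  by (induction A rule: infinite_finite_induct) (auto simp: zero_fun_def)

lemma (in vec_space) vector_space_fun: "vector_space (fun_scale scale)"
  by unfold_locales (auto simp: fun_eq_iff fun_scale_def algebra_simps)

section \<open>The double quiver and abstract mesh sequences\<close>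

abbreviation dbl_shift :: "'e + 'e \<Rightarrow> int" where
  "dbl_shift \<equiv> case_sum (\<lambda>_. 0) (\<lambda>_. 1)"

abbreviation dbl_bar :: "'e + 'e \<Rightarrow> 'e + 'e" where
  "dbl_bar \<equiv> case_sum Inr Inl"

lemma dbl_bar_bar [simp]: "dbl_bar (dbl_bar x) = x"
  and dbl_shift_bar [simp]: "dbl_shift (dbl_bar x) = 1 - dbl_shift x"
  and tail_dbl_bar [simp]: "tail (double_quiver \<Gamma>) (dbl_bar x) = head (double_quiver \<Gamma>) x"
  and head_dbl_bar [simp]: "head (double_quiver \<Gamma>) (dbl_bar x) = tail (double_quiver \<Gamma>) x"
  and arcs_dbl_bar [simp]: "dbl_bar x \<in> arcs (double_quiver \<Gamma>) \<longleftrightarrow> x \<in> arcs (double_quiver \<Gamma>)"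
  by (cases x; force simp: double_quiver_def)+

lemma fin_digraph_double_quiver:
  assumes "fin_digraph \<Gamma>"
  shows "fin_digraph (double_quiver \<Gamma>)"
proof -
  interpret fin_digraph \<Gamma> by fact
  show ?thesis by unfold_locales (auto simp: double_quiver_def)
qed

lemma verts_double_quiver [simp]: "verts (double_quiver \<Gamma>) = verts \<Gamma>"
  by (simp add: double_quiver_def)

text \<open>
  \<open>W (u, c)\<close> stands for \<open>V\<^sup>u\<^sub>c\<close> and \<open>R x\<close> for the right multiplication by the arrow \<open>x\<close> of the double
  quiver, which maps \<open>V\<^sup>h\<^sub>c\<close> to \<open>V\<^sup>t\<^sub>c\<close> or \<open>V\<^sup>t\<^sub>c\<^sub>+\<^sub>1\<close> where \<open>t\<close>, \<open>h\<close> are the end points of \<open>x\<close>. The last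
  three assumptions say that \<open>0 \<rightarrow> V\<^sup>t\<^sub>c\<^sub>-\<^sub>1 \<rightarrow> \<Oplus> \<rightarrow> V\<^sup>t\<^sub>c \<rightarrow> 0\<close> is exact in the middle and, for
  \<open>c > 0\<close>, on the right.
\<close>

locale mesh_system = vec_space scale + fin_digraph \<Gamma>
  for scale :: "'k::field \<Rightarrow> 'n::ab_group_add \<Rightarrow> 'n" and \<Gamma> :: "('v, 'e) pre_digraph" +
  fixes \<epsilon> :: "'e + 'e \<Rightarrow> 'k" and R :: "'e + 'e \<Rightarrow> 'n \<Rightarrow> 'n" and W :: "'v \<times> int \<Rightarrow> 'n set"
    and rk :: "'v \<Rightarrow> nat"
  assumes rk: "\<gamma> \<in> arcs \<Gamma> \<Longrightarrow> rk (tail \<Gamma> \<gamma>) < rk (head \<Gamma> \<gamma>)"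
    and eps: "x \<in> arcs (double_quiver \<Gamma>) \<Longrightarrow> \<epsilon> x \<noteq> 0"
    and R_lin: "Vector_Spaces.linear scale scale (R x)"
    and W_sub: "subspace (W i)"
    and R_W: "x \<in> arcs (double_quiver \<Gamma>) \<Longrightarrow> v \<in> W (head (double_quiver \<Gamma>) x, c) \<Longrightarrow>
      R x v \<in> W (tail (double_quiver \<Gamma>) x, c + dbl_shift x)"
    and W_neg: "c < 0 \<Longrightarrow> W (t, c) = {0}"
    and mesh_zero: "t \<in> verts \<Gamma> \<Longrightarrow> v \<in> W (t, c) \<Longrightarrow>
      (\<Sum>x\<in>out_arcs (double_quiver \<Gamma>) t. scale (\<epsilon> x) (R x (R (dbl_bar x) v))) = 0"
    and mesh_exact: "t \<in> verts \<Gamma> \<Longrightarrow>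
      (\<And>x. x \<in> out_arcs (double_quiver \<Gamma>) t \<Longrightarrow> n x \<in> W (head (double_quiver \<Gamma>) x, c - dbl_shift x)) \<Longrightarrow>
      (\<Sum>x\<in>out_arcs (double_quiver \<Gamma>) t. scale (\<epsilon> x) (R x (n x))) = 0 \<Longrightarrow>
      \<exists>v\<in>W (t, c - 1). \<forall>x\<in>out_arcs (double_quiver \<Gamma>) t. n x = R (dbl_bar x) v"
    and mesh_surj: "t \<in> verts \<Gamma> \<Longrightarrow> 0 < c \<Longrightarrow> w \<in> W (t, c) \<Longrightarrow>
      \<exists>n. (\<forall>x\<in>out_arcs (double_quiver \<Gamma>) t. n x \<in> W (head (double_quiver \<Gamma>) x, c - dbl_shift x))
        \<and> w = (\<Sum>x\<in>out_arcs (double_quiver \<Gamma>) t. scale (\<epsilon> x) (R x (n x)))"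
begin

sublocale Q: fin_digraph "double_quiver \<Gamma>"
  by (rule fin_digraph_double_quiver) (rule fin_digraph_axioms)

abbreviation Q where "Q \<equiv> double_quiver \<Gamma>"

abbreviation lin :: "('n \<Rightarrow> 'n) \<Rightarrow> bool" where "lin \<equiv> Vector_Spaces.linear scale scale"

lemma lin_iff: "lin f \<longleftrightarrow> (\<forall>x y. f (x + y) = f x + f y) \<and> (\<forall>c x. f (scale c x) = scale c (f x))"
  using vector_space_axioms by (auto simp: Vector_Spaces.linear_iff)

lemma rk_neq: "x \<in> arcs Q \<Longrightarrow> head Q x \<noteq> tail Q x"
  using rk by (force simp: double_quiver_def)

lemma mesh_W:
  assumes "\<And>x. x \<in> out_arcs Q t \<Longrightarrow> n x \<in> W (head Q x, c - dbl_shift x)"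
  shows "(\<Sum>x\<in>out_arcs Q t. scale (\<epsilon> x) (R x (n x))) \<in> W (t, c)"
  using R_W[of _ "n _" "c - dbl_shift _"] assms
  by (intro subspace_sum W_sub subspace_scale) (force simp: in_out_arcs_conv)+

text \<open>
  The graph of a slice function is a slice of the translation quiver. Each arrow of \<open>\<Gamma>\<close> contributes
  exactly one arrow to the slice, the active one of the pair \<open>Inl \<gamma>\<close>, \<open>Inr \<gamma>\<close>.
\<close>

definition slice :: "('v \<Rightarrow> int) \<Rightarrow> bool" where
  "slice c \<longleftrightarrow> (\<forall>\<gamma>\<in>arcs \<Gamma>. c (head \<Gamma> \<gamma>) = c (tail \<Gamma> \<gamma>) \<or> c (head \<Gamma> \<gamma>) = c (tail \<Gamma> \<gamma>) + 1)"

definition active :: "('v \<Rightarrow> int) \<Rightarrow> 'e + 'e \<Rightarrow> bool" where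
  "active c x \<longleftrightarrow> c (tail Q x) = c (head Q x) + dbl_shift x"

text \<open>
  Vanishing of the self-extensions of the representation of the slice formed by the \<open>W (u, c u)\<close>.
\<close>

definition rigid :: "('v \<Rightarrow> int) \<Rightarrow> bool" where
  "rigid c \<longleftrightarrow> (\<forall>h. (\<forall>x\<in>arcs Q. active c x \<longrightarrow>
        lin (h x) \<and> (\<forall>v\<in>W (head Q x, c (head Q x)). h x v \<in> W (tail Q x, c (tail Q x))))
     \<longrightarrow> (\<exists>\<phi>. (\<forall>u. lin (\<phi> u)) \<and> (\<forall>u\<in>verts \<Gamma>. \<forall>v\<in>W (u, c u). \<phi> u v \<in> W (u, c u))
         \<and> (\<forall>x\<in>arcs Q. active c x \<longrightarrow> (\<forall>v\<in>W (head Q x, c (head Q x)).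
               h x v = \<phi> (tail Q x) (R x v) - R x (\<phi> (head Q x) v)))))"

lemma rigidD:
  assumes "rigid c"
    and "\<And>x. x \<in> arcs Q \<Longrightarrow> active c x \<Longrightarrow> lin (h x)"
    and "\<And>x v. x \<in> arcs Q \<Longrightarrow> active c x \<Longrightarrow> v \<in> W (head Q x, c (head Q x)) \<Longrightarrow>
      h x v \<in> W (tail Q x, c (tail Q x))"
  obtains \<phi> where "\<And>u. lin (\<phi> u)" "\<And>u v. u \<in> verts \<Gamma> \<Longrightarrow> v \<in> W (u, c u) \<Longrightarrow> \<phi> u v \<in> W (u, c u)"
    "\<And>x v. x \<in> arcs Q \<Longrightarrow> active c x \<Longrightarrow> v \<in> W (head Q x, c (head Q x)) \<Longrightarrow>
      h x v = \<phi> (tail Q x) (R x v) - R x (\<phi> (head Q x) v)"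
proof -
  have "\<forall>x\<in>arcs Q. active c x \<longrightarrow>
        lin (h x) \<and> (\<forall>v\<in>W (head Q x, c (head Q x)). h x v \<in> W (tail Q x, c (tail Q x)))"
    using assms by blast
  from assms(1)[unfolded rigid_def, THEN spec, THEN mp, OF this] that show ?thesis by metis
qed

text \<open>
  Reflection at a sink \<open>t\<close> preserves rigidity, whether or not \<open>f\<close> is injective: a self-extension \<open>h\<close>
  of the reflected representation is pulled back along \<open>f\<close> and a section \<open>\<sigma>\<close> of \<open>g\<close> to a
  self-extension \<open>K\<close> of the original one, and a splitting of the latter induces a map on the
  cokernel of \<open>f\<close>.
\<close>

lemma rigid_reflect:
  assumes t: "t \<in> verts \<Gamma>" and ct: "0 \<le> c' t" and sink: "\<And>x. x \<in> out_arcs Q t \<Longrightarrow> active c' x"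
    and rig: "rigid (c'(t := c' t - 1))"
  shows "rigid c'"
  unfolding rigid_def
proof (intro allI impI)
  fix h
  assume hyp: "\<forall>x\<in>arcs Q. active c' x \<longrightarrow>
        lin (h x) \<and> (\<forall>v\<in>W (head Q x, c' (head Q x)). h x v \<in> W (tail Q x, c' (tail Q x)))"
  \<comment> \<open>The slice before the reflection. In it \<open>t\<close> is a source: the active
    arrows at \<open>t\<close> are the reversed ones, with maps out of
    \<open>W (t, c' t - 1)\<close>.\<close>
  define c where "c = c'(t := c' t - 1)"
  have rig: "rigid c" using rig by (simp add: c_def)
  define Ot where "Ot = out_arcs Q t"
  have finO: "finite Ot" unfolding Ot_def by (rule Q.finite_out_arcs)
  have OD: "x \<in> arcs Q" "tail Q x = t" "active c' x" "head Q x \<noteq> t" "c' (head Q x) = c' t - dbl_shift x"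
      "c (head Q x) = c' t - dbl_shift x" "head Q x \<in> verts \<Gamma>"
    if "x \<in> Ot" for x
  proof -
    show 1: "x \<in> arcs Q" "tail Q x = t" "active c' x"
      using that sink[of x] by (simp_all add: Ot_def)
    show 2: "head Q x \<noteq> t" using rk_neq[OF 1(1)] 1(2) by simp
    show 3: "c' (head Q x) = c' t - dbl_shift x" using 1 by (simp add: active_def)
    show "c (head Q x) = c' t - dbl_shift x" using 2 3 by (simp add: c_def)
    show "head Q x \<in> verts \<Gamma>" using Q.head_in_verts[OF 1(1)] by simp
  qed
  have h_lin: "lin (h x)" if "x \<in> Ot" for x
    using hyp[THEN bspec, OF OD(1)[OF that]] OD(3)[OF that] by simp
  have h_W: "h x v \<in> W (t, c' t)" if "x \<in> Ot" "v \<in> W (head Q x, c' t - dbl_shift x)" for x v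
    using hyp[THEN bspec, OF OD(1)[OF that(1)]] OD(2,3,5)[OF that(1)] that(2) by simp
  interpret F: vector_space "fun_scale scale :: 'k \<Rightarrow> ('e + 'e \<Rightarrow> 'n) \<Rightarrow> _"
    by (rule vector_space_fun)
  interpret FP: vector_space_pair "fun_scale scale :: 'k \<Rightarrow> ('e + 'e \<Rightarrow> 'n) \<Rightarrow> _" scale ..
  \<comment> \<open>The middle term of the mesh sequence, as functions on arrows. Vanishing outside
    \<open>Ot\<close> makes an element determined by its components.\<close>
  define N where "N = {n. (\<forall>x\<in>Ot. n x \<in> W (head Q x, c' t - dbl_shift x)) \<and> (\<forall>x. x \<notin> Ot \<longrightarrow> n x = 0)}"
  have N_sub: "F.subspace N"
    unfolding N_def
    by (rule F.subspaceI) (auto intro: subspace_add[OF W_sub] subspace_scale[OF W_sub] subspace_0[OF W_sub])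
  define G where "G = (\<lambda>n. \<Sum>x\<in>Ot. scale (\<epsilon> x) (R x (n x)))"
  have RL: "R x (v + w) = R x v + R x w" "R x (scale k v) = scale k (R x v)" for x v w k
    using R_lin[of x] by (auto simp: lin_iff)
  have G_add: "G (n + n') = G n + G n'" and G_scale: "G (fun_scale scale k n) = scale k (G n)" for n n' k
    by (simp_all add: G_def RL scale_right_distrib sum.distrib scale_sum_right mult.commute)
  have G_lin: "Vector_Spaces.linear (fun_scale scale) scale G"
    unfolding Vector_Spaces.linear_iff using G_add G_scale vector_space_axioms F.vector_space_axioms by simp
  have G_diff: "G (n - n') = G n - G n'" for n n' using G_add[of "n - n'" n'] by simp
  have G_W: "G n \<in> W (t, c' t)" if "n \<in> N" for n
    using mesh_W[of t n "c' t"] that by (simp add: G_def N_def Ot_def)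
  \<comment> \<open>A linear section of \<open>G\<close> on its image only, since in degree 0 the
    image can be smaller than \<open>W (t, c' t)\<close>.\<close>
  obtain \<sigma> where \<sigma>: "range \<sigma> \<subseteq> N" "Vector_Spaces.linear scale (fun_scale scale) \<sigma>"
      "\<And>w. w \<in> G ` N \<Longrightarrow> G (\<sigma> w) = w"
    using FP.linear_exists_right_inverse_on[OF G_lin N_sub] by metis
  have \<sigma>_add: "\<sigma> (v + w) = \<sigma> v + \<sigma> w" and \<sigma>_scale: "\<sigma> (scale k v) = fun_scale scale k (\<sigma> v)" for v w k
    using \<sigma>(2) by (auto simp: Vector_Spaces.linear_iff)
  define H where "H = (\<lambda>n. \<Sum>x\<in>Ot. scale (\<epsilon> x) (h x (n x)))"
  have hL: "h x (v + w) = h x v + h x w" "h x (scale k v) = scale k (h x v)" if "x \<in> Ot" for x v w k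
    using h_lin[OF that] by (auto simp: lin_iff)
  have H_add: "H (n + n') = H n + H n'" and H_scale: "H (fun_scale scale k n) = scale k (H n)" for n n' k
    by (simp_all add: H_def hL scale_right_distrib sum.distrib scale_sum_right mult.commute)
  have H_W: "H n \<in> W (t, c' t)" if "n \<in> N" for n
    unfolding H_def using that h_W
    by (intro subspace_sum[OF W_sub] subspace_scale[OF W_sub]) (auto simp: N_def)
  define f where "f = (\<lambda>v x. if x \<in> Ot then R (dbl_bar x) v else 0)"
  have f_add: "f (v + w) = f v + f w" and f_scale: "f (scale k v) = fun_scale scale k (f v)" for v w k
    by (auto simp: f_def fun_eq_iff RL)
  have f_N: "f v \<in> N" if "v \<in> W (t, c' t - 1)" for v
  proof -
    have "R (dbl_bar x) v \<in> W (head Q x, c' t - dbl_shift x)" if x: "x \<in> Ot" for x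
      using R_W[of "dbl_bar x" v "c' t - 1"] OD[OF x] \<open>v \<in> W (t, c' t - 1)\<close> by simp
    then show ?thesis by (simp add: N_def f_def)
  qed
  have exact: "\<exists>v\<in>W (t, c' t - 1). n = f v" if n: "n \<in> N" "G n = 0" for n
  proof -
    have "\<exists>v\<in>W (t, c' t - 1). \<forall>x\<in>out_arcs Q t. n x = R (dbl_bar x) v"
      by (rule mesh_exact[OF t]) (use n in \<open>simp_all add: N_def G_def Ot_def\<close>)
    then obtain v where "v \<in> W (t, c' t - 1)" "\<forall>x\<in>Ot. n x = R (dbl_bar x) v"
      unfolding Ot_def by blast
    then show ?thesis
      using n by (intro bexI[of _ v]) (auto simp: f_def N_def fun_eq_iff)
  qed
  have Gf: "G (f v) = 0" if "v \<in> W (t, c' t - 1)" for v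
    using mesh_zero[OF t that] by (simp add: G_def f_def Ot_def)
  have G_zero: "G 0 = 0" using G_diff[of 0 0] by simp
  have \<sigma>_zero: "\<sigma> 0 = 0" using \<sigma>_add[of 0 0] by simp
  \<comment> \<open>The pullback needs \<open>H (f v)\<close> in the domain where \<sigma> inverts
    \<open>G\<close>. In positive degree \<open>G\<close> is onto; in degree 0 the vector
    \<open>v\<close> has degree -1 and is zero.\<close>
  have Hf_im: "H (f v) \<in> G ` N" if v: "v \<in> W (t, c' t - 1)" for v
  proof (cases "c' t = 0")
    case True
    then have "v = 0" using v W_neg by auto
    then have "f v = 0" using f_scale[of 0 0] by (simp add: fun_eq_iff)
    moreover have "H 0 = 0" using H_add[of 0 0] by simp
    ultimately have "H (f v) = G 0" using G_zero by simp
    then show ?thesis using F.subspace_0[OF N_sub] by blast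
  next
    case False
    then obtain n where n: "\<forall>x\<in>Ot. n x \<in> W (head Q x, c' t - dbl_shift x)" "H (f v) = G n"
      using mesh_surj[OF t _ H_W[OF f_N[OF v]]] ct unfolding Ot_def G_def by auto
    let ?n = "\<lambda>x. if x \<in> Ot then n x else 0"
    have "G ?n = G n" by (simp add: G_def)
    moreover have "?n \<in> N" using n by (simp add: N_def)
    ultimately show ?thesis using n by (intro image_eqI[of _ _ ?n]) simp_all
  qed
  \<comment> \<open>The sign is chosen so that \<open>G (K v) = - H (f v)\<close>, which will cancel
    \<open>H\<close> on the kernel of \<open>G\<close>.\<close>
  define K where "K = (\<lambda>v. - \<sigma> (H (f v)))"
  have K_add: "K (v + w) = K v + K w" and K_scale: "K (scale k v) = fun_scale scale k (K v)" for v w k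
    by (simp_all add: K_def f_add f_scale H_add H_scale \<sigma>_add \<sigma>_scale F.scale_minus_right)
  have K_N: "K v \<in> N" for v
    unfolding K_def using \<sigma>(1) by (intro F.subspace_neg[OF N_sub]) auto
  \<comment> \<open>The self-extension on the slice \<open>c\<close>: the components of
    \<open>K\<close> on the maps out of \<open>t\<close>, and \<open>h\<close> itself on the arrows
    away from \<open>t\<close>.\<close>
  define h2 where "h2 = (\<lambda>z. if head Q z = t then (\<lambda>v. K v (dbl_bar z)) else h z)"
  have bar_O: "dbl_bar z \<in> Ot" if "z \<in> arcs Q" "head Q z = t" for z
    using that by (simp add: Ot_def)
  have tail_t: "tail Q z \<noteq> t" if z: "z \<in> arcs Q" "active c z" for z
  proof
    assume "tail Q z = t"
    then have zO: "z \<in> Ot" using z by (simp add: Ot_def)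
    from OD[OF this] z show False by (simp add: active_def c_def)
  qed
  obtain \<phi> where \<phi>: "\<And>u. lin (\<phi> u)" "\<And>u v. u \<in> verts \<Gamma> \<Longrightarrow> v \<in> W (u, c u) \<Longrightarrow> \<phi> u v \<in> W (u, c u)"
    "\<And>x v. x \<in> arcs Q \<Longrightarrow> active c x \<Longrightarrow> v \<in> W (head Q x, c (head Q x)) \<Longrightarrow>
      h2 x v = \<phi> (tail Q x) (R x v) - R x (\<phi> (head Q x) v)"
  proof (rule rigidD[OF rig, where h = h2])
    fix z assume z: "z \<in> arcs Q" "active c z"
    show "lin (h2 z)"
    proof (cases "head Q z = t")
      case True
      then show ?thesis by (simp add: h2_def lin_iff K_add K_scale)
    next
      case False
      then have "active c' z" using z tail_t[OF z] by (simp add: active_def c_def)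
      then show ?thesis using hyp z False by (simp add: h2_def)
    qed
    fix v assume v: "v \<in> W (head Q z, c (head Q z))"
    show "h2 z v \<in> W (tail Q z, c (tail Q z))"
    proof (cases "head Q z = t")
      case True
      have "c' (head Q (dbl_bar z)) = c' t - dbl_shift (dbl_bar z)"
        using OD(5)[OF bar_O[OF z(1) True]] .
      moreover have "K v (dbl_bar z) \<in> W (head Q (dbl_bar z), c' t - dbl_shift (dbl_bar z))"
        using K_N[of v] bar_O[OF z(1) True] unfolding N_def by blast
      ultimately show ?thesis using True tail_t[OF z] by (simp add: h2_def c_def)
    next
      case False
      then have "active c' z" using z tail_t[OF z] by (simp add: active_def c_def)
      then show ?thesis using hyp z False tail_t[OF z] v by (simp add: h2_def c_def)
    qed
  qed blast
  have \<phi>L: "\<phi> u (v + w) = \<phi> u v + \<phi> u w" "\<phi> u (scale k v) = scale k (\<phi> u v)" for u v w k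
    using \<phi>(1)[of u] by (auto simp: lin_iff)
  have ct1: "c t = c' t - 1" by (simp add: c_def)
  define \<Phi> where "\<Phi> = (\<lambda>n x. if x \<in> Ot then \<phi> (head Q x) (n x) else 0)"
  have \<Phi>_add: "\<Phi> (n + n') = \<Phi> n + \<Phi> n'" and \<Phi>_scale: "\<Phi> (fun_scale scale k n) = fun_scale scale k (\<Phi> n)" for n n' k
    by (auto simp: \<Phi>_def fun_eq_iff \<phi>L)
  have \<Phi>_N: "\<Phi> n \<in> N" if "n \<in> N" for n
  proof -
    have "\<phi> (head Q x) (n x) \<in> W (head Q x, c' t - dbl_shift x)" if x: "x \<in> Ot" for x
      using \<phi>(2)[OF OD(7)[OF x], of "n x"] OD(6)[OF x] \<open>n \<in> N\<close> x by (simp add: N_def)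
    then show ?thesis by (simp add: N_def \<Phi>_def)
  qed
  \<comment> \<open>The splitting of \<open>h2\<close> at the arrows out of \<open>t\<close>,
    collected over all components.\<close>
  have \<Phi>f: "\<Phi> (f v) = K v + f (\<phi> t v)" if v: "v \<in> W (t, c' t - 1)" for v
  proof
    fix x
    show "\<Phi> (f v) x = (K v + f (\<phi> t v)) x"
    proof (cases "x \<in> Ot")
      case True
      have "active c (dbl_bar x)"
        using OD[OF True] by (simp add: active_def ct1)
      then have "h2 (dbl_bar x) v = \<phi> (head Q x) (R (dbl_bar x) v) - R (dbl_bar x) (\<phi> t v)"
        using \<phi>(3)[of "dbl_bar x" v] OD[OF True] v by (simp add: ct1)
      then show ?thesis using True OD[OF True] by (simp add: h2_def \<Phi>_def f_def)
    next
      case False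
      then show ?thesis using K_N[of v] by (simp add: \<Phi>_def f_def N_def)
    qed
  qed
  \<comment> \<open>If the wanted endomorphism \<phi>' at \<open>t\<close> exists, it satisfies
    \<open>\<phi>' (G n) = H n + G (\<Phi> n)\<close>. So \<open>L\<close> has to vanish on the
    kernel of \<open>G\<close>; there \<open>n = f v\<close>, and
    \<open>G (\<Phi> (f v)) = G (K v) = - H (f v)\<close>.\<close>
  define L where "L = (\<lambda>n. H n + G (\<Phi> n))"
  have L_add: "L (n + n') = L n + L n'" and L_scale: "L (fun_scale scale k n) = scale k (L n)" for n n' k
    by (simp_all add: L_def H_add G_add \<Phi>_add H_scale G_scale \<Phi>_scale scale_right_distrib algebra_simps)
  have L_diff: "L (n - n') = L n - L n'" for n n' using L_add[of "n - n'" n'] by simp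
  have L_W: "L n \<in> W (t, c' t)" if "n \<in> N" for n
    unfolding L_def by (intro subspace_add[OF W_sub] H_W G_W \<Phi>_N that)
  have L_ker: "L n = 0" if n: "n \<in> N" "G n = 0" for n
  proof -
    obtain v where v: "v \<in> W (t, c' t - 1)" "n = f v" using exact[OF n] by blast
    have "\<phi> t v \<in> W (t, c' t - 1)" using \<phi>(2)[OF t, of v] v by (simp add: ct1)
    then have "G (\<Phi> n) = G (K v)" by (simp add: v(2) \<Phi>f[OF v(1)] G_add Gf)
    also have "\<dots> = - H n"
      using G_diff[of 0 "\<sigma> (H (f v))"] \<sigma>(3)[OF Hf_im[OF v(1)]] by (simp add: K_def G_zero v(2))
    finally show ?thesis by (simp add: L_def)
  qed
  have L_\<sigma>: "L (\<sigma> (G n)) = L n" if n: "n \<in> N" for n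
  proof -
    have sN: "\<sigma> (G n) \<in> N" using \<sigma>(1) by auto
    have "\<sigma> (G n) - n \<in> N" by (rule F.subspace_diff[OF N_sub sN n])
    moreover have "G (\<sigma> (G n) - n) = 0" using \<sigma>(3)[of "G n"] n by (simp add: G_diff)
    ultimately show ?thesis using L_ker L_diff by fastforce
  qed
  \<comment> \<open>On the image of \<open>G\<close> this is the map induced by \<open>L\<close>.
    The section \<sigma> is linear on the whole type with values in \<open>N\<close>, so the
    composite also maps all of \<open>W (t, c' t)\<close> into itself.\<close>
  define \<phi>' where "\<phi>' = \<phi>(t := (\<lambda>w. L (\<sigma> w)))"
  show "\<exists>\<phi>. (\<forall>u. lin (\<phi> u)) \<and> (\<forall>u\<in>verts \<Gamma>. \<forall>v\<in>W (u, c' u). \<phi> u v \<in> W (u, c' u))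
         \<and> (\<forall>x\<in>arcs Q. active c' x \<longrightarrow> (\<forall>v\<in>W (head Q x, c' (head Q x)).
               h x v = \<phi> (tail Q x) (R x v) - R x (\<phi> (head Q x) v)))"
  proof (intro exI[of _ \<phi>'] conjI allI ballI impI)
    fix u
    show "lin (\<phi>' u)" using \<phi>(1) by (simp add: \<phi>'_def lin_iff \<sigma>_add \<sigma>_scale L_add L_scale)
    fix v assume "u \<in> verts \<Gamma>" "v \<in> W (u, c' u)"
    then show "\<phi>' u v \<in> W (u, c' u)"
      using \<phi>(2)[of u v] L_W[of "\<sigma> v", OF subsetD[OF \<sigma>(1) rangeI]] by (auto simp: \<phi>'_def c_def)
  next
    fix z v assume z: "z \<in> arcs Q" "active c' z" and v: "v \<in> W (head Q z, c' (head Q z))"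
    show "h z v = \<phi>' (tail Q z) (R z v) - R z (\<phi>' (head Q z) v)"
    proof (cases "tail Q z = t")
      case True
      then have zO: "z \<in> Ot" using z by (simp add: Ot_def)
      \<comment> \<open>Testing the identity for \<open>L\<close> on an element with a single
        component isolates the arrow \<open>z\<close>; the common factor \<open>\<epsilon> z\<close>
        is then cancelled.\<close>
      let ?n = "\<lambda>x. if x = z then v else 0"
      have n: "?n \<in> N" using zO v OD[OF zO] subspace_0[OF W_sub] by (simp add: N_def)
      have R0: "R x 0 = 0" and h0: "x \<in> Ot \<Longrightarrow> h x 0 = 0" and \<phi>0: "\<phi> u 0 = 0" for x u
        using RL(2)[of x 0 0] hL(2)[of x 0 0] \<phi>L(2)[of u 0 0] by auto
      have G: "G ?n = scale (\<epsilon> z) (R z v)"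
        unfolding G_def by (subst sum.remove[OF finO zO]) (auto intro!: sum.neutral simp: R0)
      have H: "H ?n = scale (\<epsilon> z) (h z v)"
        unfolding H_def by (subst sum.remove[OF finO zO]) (auto intro!: sum.neutral simp: h0)
      have G\<Phi>: "G (\<Phi> ?n) = scale (\<epsilon> z) (R z (\<phi> (head Q z) v))"
        unfolding G_def using zO
        by (subst sum.remove[OF finO zO]) (auto intro!: sum.neutral simp: R0 \<phi>0 \<Phi>_def)
      have "scale (\<epsilon> z) (L (\<sigma> (R z v))) = L (\<sigma> (G ?n))"
        by (simp add: G \<sigma>_scale L_scale)
      also have "\<dots> = scale (\<epsilon> z) (h z v + R z (\<phi> (head Q z) v))"
        unfolding L_\<sigma>[OF n] by (simp add: L_def H G\<Phi> scale_right_distrib)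
      finally have "L (\<sigma> (R z v)) = h z v + R z (\<phi> (head Q z) v)"
        using eps[OF z(1)] by simp
      then show ?thesis using True OD(4)[OF zO] by (simp add: \<phi>'_def)
    next
      case False
      have hd: "head Q z \<noteq> t"
      proof
        assume h: "head Q z = t"
        from OD(5)[OF bar_O[OF z(1) h]] z h show False by (simp add: active_def)
      qed
      then have "active c z" using z False by (simp add: active_def c_def)
      then have "h2 z v = \<phi> (tail Q z) (R z v) - R z (\<phi> (head Q z) v)"
        using \<phi>(3) z v hd by (simp add: c_def)
      then show ?thesis using hd False by (simp add: \<phi>'_def h2_def)
    qed
  qed
qed

text \<open>Every slice with values at least -1 is obtained by reflections from the constant slice
  -1, where all spaces are zero. The induction undoes one reflection at a time, which lowers the
  total height above -1.\<close>

theorem slice_rigid: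
  assumes "slice c" "\<And>u. u \<in> verts \<Gamma> \<Longrightarrow> - 1 \<le> c u"
  shows "rigid c"
  using assms
proof (induction "\<Sum>u\<in>verts \<Gamma>. nat (c u + 1)" arbitrary: c rule: less_induct)
  case less
  show ?case
  proof (cases "\<forall>u\<in>verts \<Gamma>. c u = - 1")
    case True
    have z: "W (u, c u) = {0}" if "u \<in> verts \<Gamma>" for u using True that W_neg by simp
    show ?thesis
      unfolding rigid_def
    proof (intro allI impI exI[of _ "\<lambda>_. id"] conjI ballI)
      fix h x v
      assume hyp: "\<forall>x\<in>arcs Q. active c x \<longrightarrow>
          lin (h x) \<and> (\<forall>v\<in>W (head Q x, c (head Q x)). h x v \<in> W (tail Q x, c (tail Q x)))"
        and x: "x \<in> arcs Q" "active c x" and v: "v \<in> W (head Q x, c (head Q x))"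
      have "h x v = 0" using hyp x v z Q.tail_in_verts[OF x(1)] by auto
      then show "h x v = id (R x v) - R x (id v)" by simp
    qed (auto simp: lin_iff)
  next
    case False
    define m where "m = Max (c ` verts \<Gamma>)"
    have le_m: "c u \<le> m" if "u \<in> verts \<Gamma>" for u using that by (simp add: m_def)
    obtain u0 where u0: "u0 \<in> verts \<Gamma>" "c u0 \<noteq> - 1" using False by blast
    then have m0: "0 \<le> m" using less.prems(2)[of u0] le_m[of u0] by simp
    have "m \<in> c ` verts \<Gamma>" unfolding m_def using u0 by (intro Max_in) auto
    then obtain u1 where "u1 \<in> verts \<Gamma> \<and> c u1 = m" by auto
    \<comment> \<open>A vertex of largest value and, among those, of least \<open>rk\<close> is a
      sink of the slice: arrows of \<open>\<Gamma>\<close> into it come from value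
      \<open>m - 1\<close>, and arrows out of it stay at value \<open>m\<close>. For the same reason
      lowering the value at \<open>t\<close> leaves a slice.\<close>
    then obtain t where t: "t \<in> verts \<Gamma>" "c t = m"
      and t_min: "\<And>u. u \<in> verts \<Gamma> \<Longrightarrow> c u = m \<Longrightarrow> rk t \<le> rk u"
      using ex_has_least_nat[of "\<lambda>u. u \<in> verts \<Gamma> \<and> c u = m" u1 rk] by blast
    have into: "c (tail \<Gamma> \<gamma>) = m - 1" if g: "\<gamma> \<in> arcs \<Gamma>" "head \<Gamma> \<gamma> = t" for \<gamma>
    proof -
      have "c (tail \<Gamma> \<gamma>) \<noteq> m" using t_min[of "tail \<Gamma> \<gamma>"] rk[OF g(1)] g by auto
      then show ?thesis using less.prems(1) g t unfolding slice_def by fastforce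
    qed
    have out: "c (head \<Gamma> \<gamma>) = m" if g: "\<gamma> \<in> arcs \<Gamma>" "tail \<Gamma> \<gamma> = t" for \<gamma>
      using less.prems(1) g t le_m[of "head \<Gamma> \<gamma>"] unfolding slice_def by fastforce
    have neq: "head \<Gamma> \<gamma> \<noteq> tail \<Gamma> \<gamma>" if "\<gamma> \<in> arcs \<Gamma>" for \<gamma> using rk[OF that] by auto
    show ?thesis
    proof (rule rigid_reflect[OF t(1)])
      show "0 \<le> c t" using m0 t by simp
      show "active c x" if "x \<in> out_arcs Q t" for x
        using that into out t(2) by (auto simp: double_quiver_def active_def)
      let ?c = "c(t := c t - 1)"
      show "rigid ?c"
      proof (rule less.hyps)
        show "(\<Sum>u\<in>verts \<Gamma>. nat (?c u + 1)) < (\<Sum>u\<in>verts \<Gamma>. nat (c u + 1))"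
          using t m0 by (intro sum_strict_mono_ex1) auto
        show "slice ?c"
          unfolding slice_def
        proof
          fix \<gamma> assume g: "\<gamma> \<in> arcs \<Gamma>"
          show "?c (head \<Gamma> \<gamma>) = ?c (tail \<Gamma> \<gamma>) \<or> ?c (head \<Gamma> \<gamma>) = ?c (tail \<Gamma> \<gamma>) + 1"
            using less.prems(1) g into[OF g] out[OF g] neq[OF g] t(2) by (auto simp: slice_def)
        qed
        show "- 1 \<le> ?c u" if "u \<in> verts \<Gamma>" for u using less.prems(2)[OF that] m0 t by auto
      qed
    qed
  qed
qed

text \<open>Rigidity of a slice in which \<open>(t, d)\<close> is a sink, for tuples supported on
  the maps into it. Since \<phi> is indexed by vertices, different arrows with the same head receive
  the same endomorphism.\<close>

lemma rigid_in:
  assumes t: "t \<in> verts \<Gamma>" and d: "0 \<le> d"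
    and h: "\<And>x. x \<in> out_arcs Q t \<Longrightarrow> lin (h x)"
      "\<And>x v. x \<in> out_arcs Q t \<Longrightarrow> v \<in> W (head Q x, d - dbl_shift x) \<Longrightarrow> h x v \<in> W (t, d)"
  obtains \<phi> where "\<And>u. lin (\<phi> u)"
    "\<And>x v. x \<in> out_arcs Q t \<Longrightarrow> v \<in> W (head Q x, d - dbl_shift x) \<Longrightarrow>
       \<phi> (head Q x) v \<in> W (head Q x, d - dbl_shift x)"
    "\<And>x v. x \<in> out_arcs Q t \<Longrightarrow> v \<in> W (head Q x, d - dbl_shift x) \<Longrightarrow>
       h x v = \<phi> t (R x v) - R x (\<phi> (head Q x) v)"
proof -
  \<comment> \<open>By \<open>rk\<close>, tails of arrows into \<open>t\<close> lie one degree lower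
    and heads of arrows out of \<open>t\<close> in the same degree, which makes every arrow of
    \<open>out_arcs Q t\<close> active. For \<open>d = 0\<close> the value -1 occurs.\<close>
  define c where "c = (\<lambda>u. if rk u < rk t then d - 1 else d)"
  have "rigid c"
    by (rule slice_rigid) (use rk d in \<open>fastforce simp: slice_def c_def\<close>)+
  moreover have chd: "c (head Q x) = d - dbl_shift x" if "x \<in> out_arcs Q t" for x
    using that rk by (fastforce simp: double_quiver_def c_def)
  moreover have ct: "c t = d" by (simp add: c_def)
  let ?h = "\<lambda>x. if x \<in> out_arcs Q t then h x else (\<lambda>_. 0)"
  obtain \<phi> where \<phi>: "\<And>u. lin (\<phi> u)" "\<And>u v. u \<in> verts \<Gamma> \<Longrightarrow> v \<in> W (u, c u) \<Longrightarrow> \<phi> u v \<in> W (u, c u)"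
    "\<And>x v. x \<in> arcs Q \<Longrightarrow> active c x \<Longrightarrow> v \<in> W (head Q x, c (head Q x)) \<Longrightarrow>
      ?h x v = \<phi> (tail Q x) (R x v) - R x (\<phi> (head Q x) v)"
  proof (rule rigidD[OF \<open>rigid c\<close>, where h = ?h])
    fix x v assume "x \<in> arcs Q" and v: "v \<in> W (head Q x, c (head Q x))"
    show "?h x v \<in> W (tail Q x, c (tail Q x))"
      using h(2)[of x v] v chd[of x] ct subspace_0[OF W_sub] by auto
  qed (use h(1) in \<open>auto simp: lin_iff\<close>)
  show ?thesis
  proof (rule that[of \<phi>])
    fix x v assume x: "x \<in> out_arcs Q t" and v: "v \<in> W (head Q x, d - dbl_shift x)"
    show "\<phi> (head Q x) v \<in> W (head Q x, d - dbl_shift x)"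
      using \<phi>(2)[of "head Q x" v] v x Q.head_in_verts[of x] by (simp add: chd)
    show "h x v = \<phi> t (R x v) - R x (\<phi> (head Q x) v)"
      using \<phi>(3)[of x v] x v by (simp add: active_def chd ct)
  qed (rule \<phi>(1))
qed

text \<open>The dual choice of slice, with \<open>(t, d)\<close> as a source. The maps out of it
  belong to the reversed arrows, hence the \<open>dbl_bar\<close>.\<close>

lemma rigid_out:
  assumes t: "t \<in> verts \<Gamma>" and d: "0 \<le> d"
    and h: "\<And>x. x \<in> out_arcs Q t \<Longrightarrow> lin (h x)"
      "\<And>x v. x \<in> out_arcs Q t \<Longrightarrow> v \<in> W (t, d) \<Longrightarrow> h x v \<in> W (head Q x, d + 1 - dbl_shift x)"
  obtains \<phi> where "\<And>u. lin (\<phi> u)" "\<And>v. v \<in> W (t, d) \<Longrightarrow> \<phi> t v \<in> W (t, d)"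
    "\<And>x v. x \<in> out_arcs Q t \<Longrightarrow> v \<in> W (head Q x, d + 1 - dbl_shift x) \<Longrightarrow>
       \<phi> (head Q x) v \<in> W (head Q x, d + 1 - dbl_shift x)"
    "\<And>x v. x \<in> out_arcs Q t \<Longrightarrow> v \<in> W (t, d) \<Longrightarrow>
       h x v = \<phi> (head Q x) (R (dbl_bar x) v) - R (dbl_bar x) (\<phi> t v)"
proof -
  \<comment> \<open>Now the vertices of larger \<open>rk\<close> are moved one degree up, so that
    the reversed arrows at \<open>t\<close> are active.\<close>
  define c where "c = (\<lambda>u. if rk t < rk u then d + 1 else d)"
  have "rigid c"
    by (rule slice_rigid) (use rk d in \<open>fastforce simp: slice_def c_def\<close>)+
  moreover have chd: "c (head Q x) = d + 1 - dbl_shift x" if "x \<in> out_arcs Q t" for x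
    using that rk by (fastforce simp: double_quiver_def c_def)
  moreover have ct: "c t = d" by (simp add: c_def)
  let ?h = "\<lambda>z. if dbl_bar z \<in> out_arcs Q t then h (dbl_bar z) else (\<lambda>_. 0)"
  obtain \<phi> where \<phi>: "\<And>u. lin (\<phi> u)" "\<And>u v. u \<in> verts \<Gamma> \<Longrightarrow> v \<in> W (u, c u) \<Longrightarrow> \<phi> u v \<in> W (u, c u)"
    "\<And>x v. x \<in> arcs Q \<Longrightarrow> active c x \<Longrightarrow> v \<in> W (head Q x, c (head Q x)) \<Longrightarrow>
      ?h x v = \<phi> (tail Q x) (R x v) - R x (\<phi> (head Q x) v)"
  proof (rule rigidD[OF \<open>rigid c\<close>, where h = ?h])
    fix x v assume "x \<in> arcs Q" and v: "v \<in> W (head Q x, c (head Q x))"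
    show "?h x v \<in> W (tail Q x, c (tail Q x))"
      using h(2)[of "dbl_bar x" v] v chd[of "dbl_bar x"] ct subspace_0[OF W_sub] by auto
  qed (use h(1) in \<open>auto simp: lin_iff\<close>)
  show ?thesis
  proof (rule that[of \<phi>])
    fix x v assume x: "x \<in> out_arcs Q t"
    show "\<phi> (head Q x) v \<in> W (head Q x, d + 1 - dbl_shift x)" if "v \<in> W (head Q x, d + 1 - dbl_shift x)"
      using \<phi>(2)[of "head Q x" v] that x Q.head_in_verts[of x] by (simp add: chd)
    show "h x v = \<phi> (head Q x) (R (dbl_bar x) v) - R (dbl_bar x) (\<phi> t v)" if "v \<in> W (t, d)"
      using \<phi>(3)[of "dbl_bar x" v] x that by (simp add: active_def chd ct)
  next
    show "\<phi> t v \<in> W (t, d)" if "v \<in> W (t, d)" for v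
      using \<phi>(2)[OF t, of v] that by (simp add: ct)
  qed (rule \<phi>(1))
qed

end

section \<open>Frames and the Zariski topology\<close>

lemma poly_funs_prod:
  assumes "finite A" "\<And>a. a \<in> A \<Longrightarrow> p a \<in> poly_funs M I V r"
  shows "(\<lambda>x. \<Prod>a\<in>A. p a x) \<in> poly_funs M I V r"
  using assms by (induction A rule: finite_induct) (auto intro: poly_funs.intros)

text \<open>The generating sets are a basis and not only a subbasis, because products of polynomial
  functions are polynomial functions.\<close>

lemma openin_zariski_affine_basic:
  assumes "openin (zariski_affine M I V r) T" "x \<in> T"
  shows "\<exists>p\<in>poly_funs M I V r. p x \<noteq> 0 \<and> {x \<in> tuple_space I V r. p x \<noteq> 0} \<subseteq> T"
proof -
  have "generate_topology_on ((\<lambda>p. {x \<in> tuple_space I V r. p x \<noteq> 0}) ` poly_funs M I V r) T"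
    using assms(1) by (simp add: zariski_affine_def openin_topology_generated_by_iff)
  then show ?thesis
    using assms(2)
  proof (induction arbitrary: x rule: generate_topology_on.induct)
    case Empty
    then show ?case by simp
  next
    case (Int S T)
    obtain p where p: "p \<in> poly_funs M I V r" "p x \<noteq> 0" "{x \<in> tuple_space I V r. p x \<noteq> 0} \<subseteq> S"
      using Int.IH(1)[of x] Int.prems by auto
    obtain q where q: "q \<in> poly_funs M I V r" "q x \<noteq> 0" "{x \<in> tuple_space I V r. q x \<noteq> 0} \<subseteq> T"
      using Int.IH(2)[of x] Int.prems by auto
    show ?case
      using p q poly_funs.mult[OF p(1) q(1)] by (intro bexI[of _ "\<lambda>x. p x * q x"]) auto
  next
    case (UN K)
    then obtain S where S: "S \<in> K" "x \<in> S" by auto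
    from UN.IH[OF this] obtain p
      where "p \<in> poly_funs M I V r" "p x \<noteq> 0" "{x \<in> tuple_space I V r. p x \<noteq> 0} \<subseteq> S" by auto
    then show ?case using S by (intro bexI[of _ p]) auto
  next
    case (Basis S)
    then obtain p where "p \<in> poly_funs M I V r" "S = {x \<in> tuple_space I V r. p x \<noteq> 0}" by auto
    then show ?case using Basis.prems by (intro bexI[of _ p]) auto
  qed
qed

text \<open>Replaces the topology on frames by nonvanishing of single polynomial functions, the form
  in which openness is established and used below.\<close>

lemma openin_zariski_frames_iff:
  "openin (subtopology (zariski_affine M I V r) (frames M I V r)) S \<longleftrightarrow>
     S \<subseteq> frames M I V r \<and>
     (\<forall>x\<in>S. \<exists>p\<in>poly_funs M I V r. p x \<noteq> 0 \<and> {x \<in> frames M I V r. p x \<noteq> 0} \<subseteq> S)"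
proof
  assume "openin (subtopology (zariski_affine M I V r) (frames M I V r)) S"
  then obtain T where T: "openin (zariski_affine M I V r) T" "S = T \<inter> frames M I V r"
    by (auto simp: openin_subtopology)
  have "\<exists>p\<in>poly_funs M I V r. p x \<noteq> 0 \<and> {x \<in> frames M I V r. p x \<noteq> 0} \<subseteq> S" if "x \<in> S" for x
  proof -
    from that T have "x \<in> T" by simp
    from openin_zariski_affine_basic[OF T(1) this] obtain p
      where "p \<in> poly_funs M I V r" "p x \<noteq> 0" "{x \<in> tuple_space I V r. p x \<noteq> 0} \<subseteq> T" by auto
    then show ?thesis using T(2) by (intro bexI[of _ p]) (auto simp: frames_def)
  qed
  then show "S \<subseteq> frames M I V r \<and>
     (\<forall>x\<in>S. \<exists>p\<in>poly_funs M I V r. p x \<noteq> 0 \<and> {x \<in> frames M I V r. p x \<noteq> 0} \<subseteq> S)"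
    using T by simp
next
  assume R: "S \<subseteq> frames M I V r \<and>
     (\<forall>x\<in>S. \<exists>p\<in>poly_funs M I V r. p x \<noteq> 0 \<and> {x \<in> frames M I V r. p x \<noteq> 0} \<subseteq> S)"
  then have "\<forall>x\<in>S. \<exists>p. p \<in> poly_funs M I V r \<and> p x \<noteq> 0 \<and> {z \<in> frames M I V r. p z \<noteq> 0} \<subseteq> S"
    by (simp add: Bex_def)
  from bchoice[OF this] obtain p where p: "\<And>x. x \<in> S \<Longrightarrow> p x \<in> poly_funs M I V r"
      "\<And>x. x \<in> S \<Longrightarrow> p x x \<noteq> 0" "\<And>x. x \<in> S \<Longrightarrow> {z \<in> frames M I V r. p x z \<noteq> 0} \<subseteq> S"
    by auto
  let ?T = "\<Union>x\<in>S. {z \<in> tuple_space I V r. p x z \<noteq> 0}"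
  have "openin (zariski_affine M I V r) ?T"
    using p(1) unfolding zariski_affine_def by (intro openin_Union) (auto intro!: topology_generated_by_Basis)
  moreover have "S = ?T \<inter> frames M I V r"
  proof
    show "S \<subseteq> ?T \<inter> frames M I V r"
      using R p(2) by (auto simp: frames_def)
    show "?T \<inter> frames M I V r \<subseteq> S"
      using p(3) by blast
  qed
  ultimately show "openin (subtopology (zariski_affine M I V r) (frames M I V r)) S"
    unfolding openin_subtopology by (intro exI[of _ ?T]) simp
qed

text \<open>Grassmannians are formed in a module with a carrier, whereas the linear algebra above
  lives on a whole type. The injective linear map \<Phi> carries spans and independence from one
  setting to the other.\<close>

locale embedded_space = vec_space scale + M: vectorspace class_ring M
  for scale :: "'k::field \<Rightarrow> 'n::ab_group_add \<Rightarrow> 'n" and M :: "('k, 'm) module" +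
  fixes \<Phi> :: "'m \<Rightarrow> 'n"
  assumes \<Phi>_inj: "inj_on \<Phi> (carrier M)"
    and \<Phi>_add: "u \<in> carrier M \<Longrightarrow> v \<in> carrier M \<Longrightarrow> \<Phi> (u \<oplus>\<^bsub>M\<^esub> v) = \<Phi> u + \<Phi> v"
    and \<Phi>_smult: "v \<in> carrier M \<Longrightarrow> \<Phi> (c \<odot>\<^bsub>M\<^esub> v) = scale c (\<Phi> v)"
begin

lemma \<Phi>_zero [simp]: "\<Phi> \<zero>\<^bsub>M\<^esub> = 0"
  using \<Phi>_add[of "\<zero>\<^bsub>M\<^esub>" "\<zero>\<^bsub>M\<^esub>"] by simp

lemma \<Phi>_finsum:
  assumes "f \<in> A \<rightarrow> carrier M"
  shows "\<Phi> (finsum M f A) = (\<Sum>a\<in>A. \<Phi> (f a))"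
  using assms
proof (induction A rule: infinite_finite_induct)
  case (infinite A)
  then show ?case by (simp add: M.M.finsum_infinite)
next
  case (insert a A)
  then have "finsum M f (insert a A) = f a \<oplus>\<^bsub>M\<^esub> finsum M f A"
    by (intro M.M.finsum_insert) auto
  then show ?case
    using insert \<Phi>_add[of "f a" "finsum M f A"] M.M.finsum_closed[of f A] by (simp add: Pi_iff)
qed simp

lemma smult_closed: "v \<in> carrier M \<Longrightarrow> c \<odot>\<^bsub>M\<^esub> v \<in> carrier M"
  by (rule M.smult_closed) auto

lemma \<Phi>_lincomb:
  assumes "A \<subseteq> carrier M"
  shows "\<Phi> (M.lincomb c A) = (\<Sum>v\<in>A. scale (c v) (\<Phi> v))"
  unfolding M.lincomb_def using assms smult_closed
  by (subst \<Phi>_finsum) (auto intro!: sum.cong \<Phi>_smult)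

lemma \<Phi>_span:
  assumes S: "S \<subseteq> carrier M"
  shows "\<Phi> ` M.span S = span (\<Phi> ` S)"
proof
  show "\<Phi> ` M.span S \<subseteq> span (\<Phi> ` S)"
  proof clarify
    fix v assume "v \<in> M.span S"
    then obtain c A where "v = M.lincomb c A" "A \<subseteq> S" unfolding M.span_def by auto
    then show "\<Phi> v \<in> span (\<Phi> ` S)"
      using S by (auto simp: \<Phi>_lincomb[of A c] intro!: span_sum span_scale intro: span_base)
  qed
  show "span (\<Phi> ` S) \<subseteq> \<Phi> ` M.span S"
  proof
    fix w assume "w \<in> span (\<Phi> ` S)"
    then obtain B c where B: "finite B" "B \<subseteq> \<Phi> ` S" "w = (\<Sum>v\<in>B. scale (c v) v)"
      unfolding span_explicit by auto
    then obtain A where A: "A \<subseteq> S" "inj_on \<Phi> A" "B = \<Phi> ` A"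
      using subset_image_inj[of B \<Phi> S] by auto
    have "w = \<Phi> (M.lincomb (\<lambda>a. c (\<Phi> a)) A)"
      using A S by (subst \<Phi>_lincomb) (auto simp: B(3) sum.reindex)
    moreover have "M.lincomb (\<lambda>a. c (\<Phi> a)) A \<in> M.span S"
      unfolding M.span_def using A B finite_image_iff[of \<Phi> A] by auto
    ultimately show "w \<in> \<Phi> ` M.span S" by blast
  qed
qed

lemma lin_dep_iff:
  assumes T: "T \<subseteq> carrier M"
  shows "M.lin_dep T \<longleftrightarrow> dependent (\<Phi> ` T)"
proof
  assume "M.lin_dep T"
  then obtain A c v where A: "finite A" "A \<subseteq> T" "M.lincomb c A = \<zero>\<^bsub>M\<^esub>" "v \<in> A" "c v \<noteq> 0"
    unfolding M.lin_dep_def by auto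
  have inj: "inj_on \<Phi> A" using \<Phi>_inj A T inj_on_subset by blast
  have "(\<Sum>u\<in>\<Phi> ` A. scale (c (the_inv_into A \<Phi> u)) u) = \<Phi> (M.lincomb c A)"
    using A T by (subst \<Phi>_lincomb) (auto simp: sum.reindex[OF inj] the_inv_into_f_f[OF inj])
  then have "(\<Sum>u\<in>\<Phi> ` A. scale (c (the_inv_into A \<Phi> u)) u) = 0" using A by simp
  moreover have "c (the_inv_into A \<Phi> (\<Phi> v)) \<noteq> 0" using A by (simp add: the_inv_into_f_f[OF inj])
  ultimately show "dependent (\<Phi> ` T)"
    unfolding dependent_explicit using A
    by (intro exI[of _ "\<Phi> ` A"] exI[of _ "\<lambda>u. c (the_inv_into A \<Phi> u)"]) auto
next
  assume "dependent (\<Phi> ` T)"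
  then obtain B c v where B: "finite B" "B \<subseteq> \<Phi> ` T" "(\<Sum>v\<in>B. scale (c v) v) = 0" "v \<in> B" "c v \<noteq> 0"
    unfolding dependent_explicit by auto
  then obtain A where A: "A \<subseteq> T" "inj_on \<Phi> A" "B = \<Phi> ` A"
    using subset_image_inj[of B \<Phi> T] by auto
  have "\<Phi> (M.lincomb (\<lambda>a. c (\<Phi> a)) A) = \<Phi> \<zero>\<^bsub>M\<^esub>"
    using A T B by (subst \<Phi>_lincomb) (auto simp: sum.reindex)
  moreover have "M.lincomb (\<lambda>a. c (\<Phi> a)) A \<in> carrier M"
    using A T by (intro M.lincomb_closed) auto
  ultimately have "M.lincomb (\<lambda>a. c (\<Phi> a)) A = \<zero>\<^bsub>M\<^esub>"
    using inj_onD[OF \<Phi>_inj] M.M.zero_closed by blast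
  moreover have "finite A" using A B by (simp add: finite_image_iff)
  moreover obtain a where "a \<in> A" "v = \<Phi> a" using A B by auto
  ultimately show "M.lin_dep T"
    unfolding M.lin_dep_def using A B
    by (intro exI[of _ A] exI[of _ "\<lambda>a. c (\<Phi> a)"] exI[of _ a]) auto
qed

lemma indep_family_lin_indpt:
  assumes "finite S" "y ` S \<subseteq> carrier M"
  shows "inj_on y S \<and> M.lin_indpt (y ` S) \<longleftrightarrow> indep_family scale S (\<lambda>s. \<Phi> (y s))"
proof -
  have "inj_on (\<lambda>s. \<Phi> (y s)) S \<longleftrightarrow> inj_on y S"
  proof
    show "inj_on (\<lambda>s. \<Phi> (y s)) S \<Longrightarrow> inj_on y S" by (auto simp: inj_on_def)
    show "inj_on y S \<Longrightarrow> inj_on (\<lambda>s. \<Phi> (y s)) S"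
      using comp_inj_on[of y S \<Phi>] inj_on_subset[OF \<Phi>_inj assms(2)] by (simp add: comp_def)
  qed
  then show ?thesis
    using lin_dep_iff[OF assms(2)] indep_family_iff[OF assms(1), of "\<lambda>s. \<Phi> (y s)"]
    by (simp add: image_image)
qed

lemma linear_form_\<Phi>:
  assumes "Vector_Spaces.linear scale (*) \<psi>" "W \<subseteq> carrier M"
  shows "(\<lambda>v. \<psi> (\<Phi> v)) \<in> linear_forms M W"
proof -
  interpret Vector_Spaces.linear scale "(*)" \<psi> by fact
  show ?thesis
    using assms(2) unfolding linear_forms_def module_hom_def
    by (auto simp: \<Phi>_add \<Phi>_smult subset_iff add local.scale)
qed

end

section \<open>Tuples, frames and their spans\<close>

locale subspace_family = embedded_space scale M \<Phi>
  for scale :: "'k::field \<Rightarrow> 'n::ab_group_add \<Rightarrow> 'n" and M :: "('k, 'm) module" and \<Phi> :: "'m \<Rightarrow> 'n" +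
  fixes I :: "'i set" and V :: "'i \<Rightarrow> 'm set" and r :: "'i \<Rightarrow> nat"
  assumes finI: "finite I"
    and V_sub: "i \<in> I \<Longrightarrow> VectorSpace.subspace class_ring (V i) M"
    and V_gen: "i \<in> I \<Longrightarrow> \<exists>S. finite S \<and> S \<subseteq> carrier M \<and> V i = M.span S"
begin

lemma V_carrier: "i \<in> I \<Longrightarrow> V i \<subseteq> carrier M"
  using V_sub by (auto simp: VectorSpace.subspace_def submodule_def)

lemma V_add: "i \<in> I \<Longrightarrow> u \<in> V i \<Longrightarrow> v \<in> V i \<Longrightarrow> u \<oplus>\<^bsub>M\<^esub> v \<in> V i"
  and V_smult: "i \<in> I \<Longrightarrow> v \<in> V i \<Longrightarrow> c \<odot>\<^bsub>M\<^esub> v \<in> V i"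
  using V_sub by (auto simp: VectorSpace.subspace_def submodule_def)

abbreviation tuples where "tuples \<equiv> tuple_space I V r"
abbreviation frms where "frms \<equiv> frames M I V r"
abbreviation polys where "polys \<equiv> poly_funs M I V r"

lemma tupleD: "x \<in> tuples \<Longrightarrow> i \<in> I \<Longrightarrow> j < r i \<Longrightarrow> x i j \<in> V i"
  by (auto simp: tuple_space_def PiE_iff)

lemma tuple_carrier: "x \<in> tuples \<Longrightarrow> i \<in> I \<Longrightarrow> j < r i \<Longrightarrow> x i j \<in> carrier M"
  using tupleD V_carrier by blast

lemma frames_iff:
  "x \<in> frms \<longleftrightarrow> x \<in> tuples \<and> (\<forall>i\<in>I. indep_family scale {..<r i} (\<lambda>j. \<Phi> (x i j)))"
proof -
  have "inj_on (x i) {..<r i} \<and> M.lin_indpt (x i ` {..<r i}) \<longleftrightarrow> indep_family scale {..<r i} (\<lambda>j. \<Phi> (x i j))"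
    if "x \<in> tuples" "i \<in> I" for i
    using tuple_carrier[OF that] by (intro indep_family_lin_indpt) auto
  then show ?thesis by (auto simp: frames_def)
qed

text \<open>The affine line through \<open>x\<close> in direction \<open>w\<close>. Polynomial
  functions restrict to polynomials in \<open>e\<close> on it; since any two tuples lie on a line,
  this is how irreducibility enters the argument.\<close>

definition line :: "('i \<Rightarrow> nat \<Rightarrow> 'm) \<Rightarrow> ('i \<Rightarrow> nat \<Rightarrow> 'm) \<Rightarrow> 'k \<Rightarrow> 'i \<Rightarrow> nat \<Rightarrow> 'm" where
  "line x w e = (\<lambda>i\<in>I. \<lambda>j\<in>{..<r i}. x i j \<oplus>\<^bsub>M\<^esub> (e \<odot>\<^bsub>M\<^esub> w i j))"

lemma line_tuple: "x \<in> tuples \<Longrightarrow> w \<in> tuples \<Longrightarrow> line x w e \<in> tuples"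
  using tupleD V_add V_smult by (simp add: line_def tuple_space_def PiE_iff)

lemma \<Phi>_line:
  assumes "x \<in> tuples" "w \<in> tuples" "i \<in> I" "j < r i"
  shows "\<Phi> (line x w e i j) = \<Phi> (x i j) + scale e (\<Phi> (w i j))"
  using assms tuple_carrier[OF assms(1,3,4)] tuple_carrier[OF assms(2,3,4)]
  by (simp add: line_def \<Phi>_add \<Phi>_smult smult_closed)

lemma tuple_eqI:
  assumes "x \<in> tuples" "y \<in> tuples" "\<And>i j. i \<in> I \<Longrightarrow> j < r i \<Longrightarrow> \<Phi> (x i j) = \<Phi> (y i j)"
  shows "x = y"
proof (rule PiE_ext)
  show "x \<in> (\<Pi>\<^sub>E i\<in>I. {..<r i} \<rightarrow>\<^sub>E V i)" "y \<in> (\<Pi>\<^sub>E i\<in>I. {..<r i} \<rightarrow>\<^sub>E V i)"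
    using assms by (simp_all add: tuple_space_def)
  fix i assume i: "i \<in> I"
  show "x i = y i"
  proof (rule PiE_ext)
    show "x i \<in> {..<r i} \<rightarrow>\<^sub>E V i" "y i \<in> {..<r i} \<rightarrow>\<^sub>E V i"
      using assms(1,2) i by (auto simp: tuple_space_def PiE_iff)
    fix j assume "j \<in> {..<r i}"
    then show "x i j = y i j"
      using assms(3)[of i j] i tuple_carrier[OF assms(1)] tuple_carrier[OF assms(2)]
      by (auto dest: inj_onD[OF \<Phi>_inj])
  qed
qed

lemma line_0: "x \<in> tuples \<Longrightarrow> w \<in> tuples \<Longrightarrow> line x w 0 = x"
  by (rule tuple_eqI) (auto simp: \<Phi>_line line_tuple)

lemma tuple_exists:
  assumes "\<And>i j. i \<in> I \<Longrightarrow> j < r i \<Longrightarrow> n i j \<in> \<Phi> ` V i"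
  obtains w where "w \<in> tuples" "\<And>i j. i \<in> I \<Longrightarrow> j < r i \<Longrightarrow> \<Phi> (w i j) = n i j"
proof -
  define w where "w = (\<lambda>i\<in>I. \<lambda>j\<in>{..<r i}. SOME v. v \<in> V i \<and> \<Phi> v = n i j)"
  have w: "w i j \<in> V i \<and> \<Phi> (w i j) = n i j" if "i \<in> I" "j < r i" for i j
  proof -
    have "\<exists>v. v \<in> V i \<and> \<Phi> v = n i j" using assms[OF that] by auto
    from someI_ex[OF this] show ?thesis using that by (simp add: w_def)
  qed
  have "w \<in> tuples" unfolding tuple_space_def
    by (rule PiE_I, rule PiE_I) (use w in \<open>auto simp: w_def\<close>)
  then show ?thesis using w by (intro that) auto
qed

lemma \<Phi>_V_subspace:
  assumes "i \<in> I"
  shows "subspace (\<Phi> ` V i)"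
  using V_gen[OF assms] \<Phi>_span by (metis subspace_span)

lemma line_through:
  assumes "x \<in> tuples" "y \<in> tuples"
  obtains w where "w \<in> tuples" "line x w 1 = y"
proof -
  obtain w where w: "w \<in> tuples" "\<And>i j. i \<in> I \<Longrightarrow> j < r i \<Longrightarrow> \<Phi> (w i j) = \<Phi> (y i j) - \<Phi> (x i j)"
  proof (rule tuple_exists[where n = "\<lambda>i j. \<Phi> (y i j) - \<Phi> (x i j)"])
    fix i j assume "i \<in> I" "j < r i"
    then show "\<Phi> (y i j) - \<Phi> (x i j) \<in> \<Phi> ` V i"
      using tupleD assms by (intro subspace_diff \<Phi>_V_subspace) auto
  qed blast
  have "line x w 1 = y"
    by (rule tuple_eqI) (use assms w in \<open>auto simp: line_tuple \<Phi>_line\<close>)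
  with w(1) show ?thesis by (rule that)
qed

lemma poly_on_line:
  assumes "p \<in> polys" "x \<in> tuples" "w \<in> tuples"
  shows "\<exists>q. \<forall>e. p (line x w e) = poly q e"
  using assms(1)
proof induction
  case (const c)
  show ?case by (rule exI[of _ "[:c:]"]) simp
next
  case (linear i j \<phi>)
  have "x i j \<in> V i" "w i j \<in> V i" using tupleD assms linear by auto
  then have "\<phi> (line x w e i j) = \<phi> (x i j) + e * \<phi> (w i j)" for e
    using linear V_smult[of i "w i j" e] unfolding linear_forms_def module_hom_def line_def by simp
  then show ?case by (intro exI[of _ "[:\<phi> (x i j), \<phi> (w i j):]"]) simp
next
  case (add p q)
  then obtain p' q' where "\<forall>e. p (line x w e) = poly p' e" "\<forall>e. q (line x w e) = poly q' e" by auto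
  then show ?case by (intro exI[of _ "p' + q'"]) simp
next
  case (mult p q)
  then obtain p' q' where "\<forall>e. p (line x w e) = poly p' e" "\<forall>e. q (line x w e) = poly q' e" by auto
  then show ?case by (intro exI[of _ "p' * q'"]) simp
qed

text \<open>Independence at a single index is open by \<open>indep_family_open\<close>; as
  \<open>I\<close> is finite, the polynomial functions found for the indices can be
  multiplied.\<close>

lemma frames_open:
  assumes x: "x \<in> frms"
  shows "\<exists>p\<in>polys. p x \<noteq> 0 \<and> (\<forall>z\<in>tuples. p z \<noteq> 0 \<longrightarrow> z \<in> frms)"
proof -
  have "\<exists>p\<in>polys. p x \<noteq> 0 \<and> (\<forall>z\<in>tuples. p z \<noteq> 0 \<longrightarrow> indep_family scale {..<r i} (\<lambda>j. \<Phi> (z i j)))"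
    if i: "i \<in> I" for i
  proof (rule indep_family_open[where y = "\<lambda>j z. \<Phi> (z i j)"])
    show "\<exists>p\<in>polys. \<forall>z\<in>tuples. \<psi> (\<Phi> (z i j)) = p z"
      if "j \<in> {..<r i}" and \<psi>: "Vector_Spaces.linear scale (*) \<psi>" for j \<psi>
    proof -
      have "(\<lambda>z. (\<lambda>v. \<psi> (\<Phi> v)) (z i j)) \<in> polys"
        using that i by (intro poly_funs.linear linear_form_\<Phi> V_carrier) auto
      then show ?thesis by (intro bexI) auto
    qed
  qed (use x i in \<open>auto intro: poly_funs.intros simp: frames_iff\<close>)
  then obtain p where p: "\<And>i. i \<in> I \<Longrightarrow> p i \<in> polys" "\<And>i. i \<in> I \<Longrightarrow> p i x \<noteq> 0"
    "\<And>i z. i \<in> I \<Longrightarrow> z \<in> tuples \<Longrightarrow> p i z \<noteq> 0 \<Longrightarrow> indep_family scale {..<r i} (\<lambda>j. \<Phi> (z i j))"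
    by metis
  show ?thesis
  proof (intro bexI conjI ballI impI)
    show "(\<lambda>z. \<Prod>i\<in>I. p i z) \<in> polys" using finI p by (intro poly_funs_prod)
    show "(\<Prod>i\<in>I. p i x) \<noteq> 0" using finI p by simp
    fix z assume z: "z \<in> tuples" "(\<Prod>i\<in>I. p i z) \<noteq> 0"
    then have "p i z \<noteq> 0" if "i \<in> I" for i using finI that by auto
    then show "z \<in> frms" using p(3) z by (simp add: frames_iff)
  qed
qed

lemma \<Phi>_frame_span:
  assumes "x \<in> tuples" "i \<in> I"
  shows "\<Phi> ` frame_span M I r x i = {\<Sum>j<r i. scale (c j) (\<Phi> (x i j)) | c. True}"
proof -
  have "\<Phi> ` frame_span M I r x i = span (\<Phi> ` x i ` {..<r i})"
    using assms tuple_carrier[OF assms] by (auto simp: frame_span_def intro!: \<Phi>_span)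
  also have "\<dots> = span ((\<lambda>j. \<Phi> (x i j)) ` {..<r i})" by (simp add: image_image)
  finally show ?thesis using span_family[of "{..<r i}" "\<lambda>j. \<Phi> (x i j)"] by simp
qed

lemma frame_span_carrier:
  assumes "x \<in> tuples" "i \<in> I"
  shows "frame_span M I r x i \<subseteq> V i"
proof -
  have "submodule class_ring (V i) M" using V_sub[OF assms(2)] by (simp add: VectorSpace.subspace_def)
  then show ?thesis
    using M.span_is_subset[of "x i ` {..<r i}" "V i"] assms tupleD[OF assms] by (auto simp: frame_span_def)
qed

lemma frame_exists:
  assumes U: "U \<in> grassmannians M I V r"
  shows "\<exists>x\<in>frms. frame_span M I r x = U"
proof -
  have "\<exists>f. f \<in> {..<r i} \<rightarrow>\<^sub>E V i \<and> inj_on f {..<r i} \<and> M.lin_indpt (f ` {..<r i}) \<and> M.span (f ` {..<r i}) = U i"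
    if i: "i \<in> I" for i
  proof -
    have UV: "VectorSpace.subspace class_ring (U i) (M\<lparr>carrier := V i\<rparr>)"
      and dimU: "vectorspace.dim class_ring (M\<lparr>carrier := U i\<rparr>) = r i"
      using U i by (auto simp: grassmannians_def PiE_iff)
    have UsV: "U i \<subseteq> V i" using UV by (auto simp: VectorSpace.subspace_def submodule_def)
    have smU: "submodule class_ring (U i) M"
      using UV UsV V_carrier[OF i] M.module_axioms by (auto simp: VectorSpace.subspace_def submodule_def)
    then have sU: "VectorSpace.subspace class_ring (U i) M"
      using M.vectorspace_axioms by (simp add: VectorSpace.subspace_def)
    interpret U: vectorspace class_ring "M\<lparr>carrier := U i\<rparr>" by (rule M.subspace_is_vs[OF sU])
    obtain S where S: "finite S" "S \<subseteq> carrier M" "V i = M.span S" using V_gen[OF i] by auto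
    \<comment> \<open>Independent subsets of \<open>U i\<close> are no larger than a finite
      generating set of \<open>V i\<close>. This provides a maximal one, which is a finite basis and
      therefore has \<open>r i\<close> elements.\<close>
    have bound: "finite A \<and> card A \<le> card S" if A: "A \<subseteq> U i" "U.lin_indpt A" for A
    proof -
      have "M.lin_indpt A" using M.span_li_not_depend(2)[OF A(1) smU] A(2) by simp
      moreover have AV: "A \<subseteq> V i" "A \<subseteq> carrier M" using A UsV V_carrier[OF i] by auto
      ultimately have ind: "independent (\<Phi> ` A)" using lin_dep_iff by blast
      have "\<Phi> ` A \<subseteq> span (\<Phi> ` S)" using image_mono[OF AV(1), of \<Phi>] unfolding S(3) \<Phi>_span[OF S(2)] .
      then have "finite (\<Phi> ` A) \<and> card (\<Phi> ` A) \<le> card (\<Phi> ` S)"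
        using independent_span_bound[OF finite_imageI[OF S(1)] ind] by simp
      moreover have inj: "inj_on \<Phi> A" using \<Phi>_inj AV(2) inj_on_subset by blast
      ultimately show ?thesis
        using card_image_le[OF S(1), of \<Phi>] by (auto simp: card_image finite_image_iff)
    qed
    have "\<exists>A. finite A \<and> maximal A (\<lambda>A. A \<subseteq> U i \<and> U.lin_indpt A)"
    proof (rule maximal_exists)
      show "{} \<subseteq> U i \<and> U.lin_indpt {}" by (auto simp: U.lin_dep_def)
    qed (use bound in auto)
    then obtain A where A: "finite A" "maximal A (\<lambda>A. A \<subseteq> U i \<and> U.lin_indpt A)" by auto
    then have "U.basis A" by (intro U.max_li_is_basis) simp
    then have bas: "U.lin_indpt A" "U.span A = U i" "A \<subseteq> U i" and "card A = r i"
      using U.dim_basis[OF A(1)] dimU by (auto simp: U.basis_def)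
    then obtain f where f: "bij_betw f {..<r i} A"
      using ex_bij_betw_nat_finite[OF A(1)] by (auto simp: atLeast0LessThan)
    let ?f = "restrict f {..<r i}"
    have "?f ` {..<r i} = A" "inj_on ?f {..<r i}" using f by (auto simp: bij_betw_def inj_on_def)
    moreover have "M.lin_indpt A" "M.span A = U i"
      using bas M.span_li_not_depend[OF bas(3) smU] by auto
    ultimately show ?thesis
      using bas UsV by (intro exI[of _ ?f]) (auto simp: image_subset_iff)
  qed
  then obtain f where f: "\<And>i. i \<in> I \<Longrightarrow> f i \<in> {..<r i} \<rightarrow>\<^sub>E V i" "\<And>i. i \<in> I \<Longrightarrow> inj_on (f i) {..<r i}"
    "\<And>i. i \<in> I \<Longrightarrow> M.lin_indpt (f i ` {..<r i})" "\<And>i. i \<in> I \<Longrightarrow> M.span (f i ` {..<r i}) = U i"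
    by metis
  have "restrict f I \<in> frms" using f by (auto simp: frames_def tuple_space_def)
  moreover have "frame_span M I r (restrict f I) = U"
    using f(4) U by (auto simp: frame_span_def grassmannians_def fun_eq_iff PiE_iff extensional_def)
  ultimately show ?thesis by blast
qed

lemma frame_span_grassmannian:
  assumes x: "x \<in> frms"
  shows "frame_span M I r x \<in> grassmannians M I V r"
  unfolding frame_span_def grassmannians_def
proof (rule restrict_PiE_iff[THEN iffD2], intro ballI CollectI conjI)
  fix i assume i: "i \<in> I"
  let ?S = "x i ` {..<r i}"
  have x': "x \<in> tuples" "inj_on (x i) {..<r i}" "M.lin_indpt ?S"
    using x i by (auto simp: frames_def)
  have S: "?S \<subseteq> V i" "?S \<subseteq> carrier M"
    using tupleD[OF x'(1) i] tuple_carrier[OF x'(1) i] by auto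
  have smV: "submodule class_ring (V i) M" using V_sub[OF i] by (simp add: VectorSpace.subspace_def)
  have sub: "VectorSpace.subspace class_ring (M.span ?S) M" by (rule M.span_is_subspace[OF S(2)])
  then have sm: "submodule class_ring (M.span ?S) M" by (simp add: VectorSpace.subspace_def)
  have SS: "?S \<subseteq> M.span ?S" by (rule M.in_own_span[OF S(2)])
  interpret Vi: vectorspace class_ring "M\<lparr>carrier := V i\<rparr>" by (rule M.subspace_is_vs[OF V_sub[OF i]])
  show "VectorSpace.subspace class_ring (M.span ?S) (M\<lparr>carrier := V i\<rparr>)"
    using sm M.span_is_subset[OF S(1) smV] Vi.vectorspace_axioms Vi.module_axioms
    by (auto simp: VectorSpace.subspace_def submodule_def)
  interpret U: vectorspace class_ring "M\<lparr>carrier := M.span ?S\<rparr>" by (rule M.subspace_is_vs[OF sub])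
  have "U.basis ?S"
    using M.span_li_not_depend[OF SS sm] x'(3) SS by (simp add: U.basis_def)
  then show "U.dim = r i"
    using U.dim_basis[of ?S] card_image[OF x'(2)] by simp
qed

end

section \<open>Maximal rank at a general frame\<close>

context subspace_family
begin

text \<open>
  The vectors \<open>y s x\<close> are columns of a matrix depending affinely on the frames \<open>x\<close>. The hypothesis
  \<open>deform\<close> says that at a frame where the rank is not maximal some first-order deformation moves a
  kernel vector out of the image, and this increases the rank at a general point of the line in that
  direction. Hence the maximal rank is attained, and it is an open condition.
\<close>

lemma generic_maximal_rank:
  fixes scale' :: "'k \<Rightarrow> 'p::ab_group_add \<Rightarrow> 'p" and A :: "'s \<Rightarrow> 'p"
    and L :: "'s \<Rightarrow> 'n \<Rightarrow> 'p" and \<iota> :: "'s \<Rightarrow> 'i" and \<kappa> :: "'s \<Rightarrow> nat"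
  defines "y \<equiv> \<lambda>s x. A s + L s (\<Phi> (x (\<iota> s) (\<kappa> s)))"
  assumes inf: "infinite (UNIV :: 'k set)" and vs: "vec_space scale'" and finS: "finite S"
    and L: "\<And>s. s \<in> S \<Longrightarrow> Vector_Spaces.linear scale scale' (L s)"
    and idx: "\<And>s. s \<in> S \<Longrightarrow> (\<forall>v. L s v = 0) \<or> (\<iota> s \<in> I \<and> \<kappa> s < r (\<iota> s))"
    and yE: "\<And>s x. s \<in> S \<Longrightarrow> x \<in> tuples \<Longrightarrow> y s x \<in> E"
    and deform: "\<And>x c w. x \<in> frms \<Longrightarrow> \<exists>s\<in>S. c s \<noteq> 0 \<Longrightarrow> (\<Sum>s\<in>S. scale' (c s) (y s x)) = 0 \<Longrightarrow>
      w \<in> E \<Longrightarrow> \<exists>v\<in>tuples. (\<Sum>s\<in>S. scale' (c s) (L s (\<Phi> (v (\<iota> s) (\<kappa> s))))) - w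
        \<in> Modules.module.span scale' ((\<lambda>s. y s x) ` S)"
    and P: "\<And>x. x \<in> frms \<Longrightarrow> P (frame_span M I r x) \<longleftrightarrow>
      indep_family scale' S (\<lambda>s. y s x) \<or> E \<subseteq> Modules.module.span scale' ((\<lambda>s. y s x) ` S)"
  shows "\<exists>W. openin (zariski_grassmannians M I V r) W
            \<and> zariski_grassmannians M I V r closure_of W = grassmannians M I V r
            \<and> (\<forall>U\<in>W. P U)"
proof -
  interpret E: vec_space scale' by (rule vs)
  \<comment> \<open>The rank condition on the columns. It makes sense for every tuple and not only
    for frames, so it can be followed along lines.\<close>
  define C where "C = (\<lambda>x. indep_family scale' S (\<lambda>s. y s x) \<or> E \<subseteq> E.span ((\<lambda>s. y s x) ` S))"
  have poly_y: "\<exists>p\<in>polys. \<forall>x\<in>tuples. \<psi> (y s x) = p x"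
    if s: "s \<in> S" and \<psi>: "Vector_Spaces.linear scale' (*) \<psi>" for s \<psi>
  proof -
    interpret psi: Vector_Spaces.linear scale' "(*)" \<psi> by (rule \<psi>)
    show ?thesis
    \<comment> \<open>A column with \<open>L s = 0\<close> is constant, and its indices \<iota> and
      \<kappa> are dummies. The columns coming from the fixed map \<open>f\<close> are of this
      kind.\<close>
    proof (cases "\<forall>v. L s v = 0")
      case True
      then show ?thesis by (intro bexI[OF _ poly_funs.const[of "\<psi> (A s)"]]) (simp add: y_def)
    next
      case False
      then have i: "\<iota> s \<in> I" "\<kappa> s < r (\<iota> s)" using idx[OF s] by auto
      have "Vector_Spaces.linear scale (*) (\<psi> \<circ> L s)"
        by (rule Vector_Spaces.linear_compose[OF L[OF s] \<psi>])
      then have "(\<lambda>v. (\<psi> \<circ> L s) (\<Phi> v)) \<in> linear_forms M (V (\<iota> s))"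
        by (rule linear_form_\<Phi>) (rule V_carrier[OF i(1)])
      then have "(\<lambda>x. (\<lambda>v. (\<psi> \<circ> L s) (\<Phi> v)) (x (\<iota> s) (\<kappa> s))) \<in> polys"
        by (rule poly_funs.linear[where i = "\<iota> s" and j = "\<kappa> s" and \<phi> = "\<lambda>v. (\<psi> \<circ> L s) (\<Phi> v)" and r = r, OF i])
      from poly_funs.add[OF poly_funs.const[of "\<psi> (A s)"] this]
      show ?thesis by (rule bexI[rotated]) (simp add: y_def psi.add)
    qed
  qed
  have C_open: "\<exists>p\<in>polys. p x \<noteq> 0 \<and> (\<forall>z\<in>tuples. p z \<noteq> 0 \<longrightarrow> C z)" if x: "x \<in> tuples" "C x" for x
    using x(2) unfolding C_def
  proof
    assume "indep_family scale' S (\<lambda>s. y s x)"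
    then have "\<exists>p\<in>polys. p x \<noteq> 0 \<and> (\<forall>z\<in>tuples. p z \<noteq> 0 \<longrightarrow> indep_family scale' S (\<lambda>s. y s z))"
      by (intro E.indep_family_open poly_funs.const poly_funs.add poly_funs.mult finS poly_y x(1))
    then obtain p where "p \<in> polys" "p x \<noteq> 0"
      "\<forall>z\<in>tuples. p z \<noteq> 0 \<longrightarrow> indep_family scale' S (\<lambda>s. y s z)" by (elim bexE conjE)
    then show "\<exists>p\<in>polys. p x \<noteq> 0 \<and> (\<forall>z\<in>tuples. p z \<noteq> 0 \<longrightarrow>
        indep_family scale' S (\<lambda>s. y s z) \<or> E \<subseteq> E.span ((\<lambda>s. y s z) ` S))" by (intro bexI[of _ p] conjI) simp_all
  next
    assume "E \<subseteq> E.span ((\<lambda>s. y s x) ` S)"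
    then have "\<exists>p\<in>polys. p x \<noteq> 0 \<and> (\<forall>z\<in>tuples. p z \<noteq> 0 \<longrightarrow> E \<subseteq> E.span ((\<lambda>s. y s z) ` S))"
      by (intro E.span_family_open poly_funs.const poly_funs.add poly_funs.mult finS poly_y x(1) yE)
    then obtain p where "p \<in> polys" "p x \<noteq> 0"
      "\<forall>z\<in>tuples. p z \<noteq> 0 \<longrightarrow> E \<subseteq> E.span ((\<lambda>s. y s z) ` S)" by (elim bexE conjE)
    then show "\<exists>p\<in>polys. p x \<noteq> 0 \<and> (\<forall>z\<in>tuples. p z \<noteq> 0 \<longrightarrow>
        indep_family scale' S (\<lambda>s. y s z) \<or> E \<subseteq> E.span ((\<lambda>s. y s z) ` S))" by (intro bexI[of _ p] conjI) simp_all
  qed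
  have C_exists: "\<exists>x\<in>frms. C x" if ne: "frms \<noteq> {}"
  proof -
    \<comment> \<open>The rank is bounded by the number of columns, so some frame attains the
      largest value. If \<open>C\<close> failed there, the deformation would produce a frame of
      larger rank.\<close>
    define \<rho> where "\<rho> = (\<lambda>x. E.dim (E.span ((\<lambda>s. y s x) ` S)))"
    have bound: "\<rho> x < Suc (card S)" for x
      using E.dim_le_card[of "E.span ((\<lambda>s. y s x) ` S)" "(\<lambda>s. y s x) ` S"] finS
        card_image_le[OF finS, of "\<lambda>s. y s x"] by (simp add: \<rho>_def)
    obtain x0 where x0: "x0 \<in> frms" using ne by (auto simp: ex_in_conv[symmetric])
    obtain x where x: "x \<in> frms" and max: "\<And>z. z \<in> frms \<Longrightarrow> \<rho> z \<le> \<rho> x"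
      using ex_has_greatest_nat[of "\<lambda>x. x \<in> frms" x0 \<rho> "Suc (card S)", OF x0] bound
      by auto
    have xt: "x \<in> tuples" using x by (simp add: frames_def)
    have Cx: "C x"
    proof (rule ccontr)
      assume "\<not> C x"
      then have nC: "\<not> indep_family scale' S (\<lambda>s. y s x)" "\<not> E \<subseteq> E.span ((\<lambda>s. y s x) ` S)"
        by (simp_all add: C_def)
      from nC(1) obtain c where c: "\<exists>s\<in>S. c s \<noteq> 0" "(\<Sum>s\<in>S. scale' (c s) (y s x)) = 0"
        unfolding indep_family_def by auto
      from nC(2) obtain w where w: "w \<in> E" "w \<notin> E.span ((\<lambda>s. y s x) ` S)" by auto
      obtain v where v: "v \<in> tuples"
        "(\<Sum>s\<in>S. scale' (c s) (L s (\<Phi> (v (\<iota> s) (\<kappa> s))))) - w \<in> E.span ((\<lambda>s. y s x) ` S)"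
        using deform[OF x c w(1)] by auto
      define z where "z = (\<lambda>s. L s (\<Phi> (v (\<iota> s) (\<kappa> s))))"
      have "(\<Sum>s\<in>S. scale' (c s) (z s)) \<notin> E.span ((\<lambda>s. y s x) ` S)"
      proof
        assume "(\<Sum>s\<in>S. scale' (c s) (z s)) \<in> E.span ((\<lambda>s. y s x) ` S)"
        from E.span_diff[OF this v(2)] w(2) show False by (simp add: z_def)
      qed
      from E.rank_jump[OF finS c(2) this] obtain q where q: "q \<noteq> 0"
        "\<And>e. poly q e \<noteq> 0 \<Longrightarrow> E.dim (E.span ((\<lambda>s. y s x) ` S))
            < E.dim (E.span ((\<lambda>s. y s x + scale' e (z s)) ` S))" by auto
      obtain p where p: "p \<in> polys" "p x \<noteq> 0" "\<And>z. z \<in> tuples \<Longrightarrow> p z \<noteq> 0 \<Longrightarrow> z \<in> frms"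
        using frames_open[OF x] by auto
      obtain q' where q': "\<And>e. p (line x v e) = poly q' e"
        using poly_on_line[OF p(1) xt v(1)] by auto
      have "q' \<noteq> 0" using q'[of 0] p(2) line_0[OF xt v(1)] by auto
      \<comment> \<open>At a general \<open>e\<close> the rank has grown and the point of the line
        is still a frame: \<open>q\<close> controls the former, \<open>q'\<close> the
        latter.\<close>
      then obtain e where "poly (q * q') e \<noteq> 0" using poly_nonzero_value[OF inf, of "q * q'"] q(1) by auto
      then have e: "poly q e \<noteq> 0" "poly q' e \<noteq> 0" by auto
      have "line x v e \<in> frms" using p(3)[OF line_tuple[OF xt v(1)]] q' e by simp
      moreover have "y s (line x v e) = y s x + scale' e (z s)" if s: "s \<in> S" for s
      proof -
        interpret Ls: Vector_Spaces.linear scale scale' "L s" by (rule L[OF s])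
        show ?thesis
        proof (cases "\<forall>v. L s v = 0")
          case True
          then show ?thesis by (simp add: y_def z_def)
        next
          case False
          then have i: "\<iota> s \<in> I" "\<kappa> s < r (\<iota> s)" using idx[OF s] by auto
          show ?thesis by (simp add: y_def z_def \<Phi>_line[OF xt v(1) i] Ls.add Ls.scale)
        qed
      qed
      then have "(\<lambda>s. y s (line x v e)) ` S = (\<lambda>s. y s x + scale' e (z s)) ` S"
        by (intro image_cong) auto
      ultimately show False using max[of "line x v e"] q(2)[OF e(1)] by (simp add: \<rho>_def)
    qed
    show ?thesis by (rule bexI[of C, OF Cx x])
  qed
  let ?G = "grassmannians M I V r" and ?Z = "zariski_grassmannians M I V r"
  define W where "W = {U \<in> ?G. P U}"
  \<comment> \<open>On frames \<open>C\<close> depends only on the spans, so its locus is a full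
    preimage under the quotient map.\<close>
  have pre_W: "{x \<in> frms. frame_span M I r x \<in> W} = {x \<in> frms. C x}"
    using P frame_span_grassmannian by (auto simp: W_def C_def)
  have "openin ?Z W"
    unfolding openin_zariski_grassmannians pre_W openin_zariski_frames_iff
  proof (intro conjI ballI)
    fix x assume "x \<in> {x \<in> frms. C x}"
    then have "x \<in> tuples" "C x" by (auto simp: frames_def)
    from C_open[OF this] obtain p where "p \<in> polys" "p x \<noteq> 0" "\<forall>z\<in>tuples. p z \<noteq> 0 \<longrightarrow> C z" by auto
    then show "\<exists>p\<in>polys. p x \<noteq> 0 \<and> {x \<in> frms. p x \<noteq> 0} \<subseteq> {x \<in> frms. C x}"
      by (intro bexI[of _ p]) (auto simp: frames_def)
  qed (auto simp: W_def)
  moreover have "?Z closure_of W = ?G"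
  proof
    have top: "topspace ?Z = ?G"
      by (rule topspace_zariski_grassmannians[OF M.vectorspace_axioms V_sub])
    show "?Z closure_of W \<subseteq> ?G" using closure_of_subset_topspace[of ?Z W] top by simp
    show "?G \<subseteq> ?Z closure_of W"
    proof
      fix U assume U: "U \<in> ?G"
      have "\<exists>U'. U' \<in> W \<and> U' \<in> T" if T: "U \<in> T" "openin ?Z T" for T
      proof -
        obtain x2 where x2: "x2 \<in> frms" "frame_span M I r x2 = U" using frame_exists[OF U] by auto
        then have "frms \<noteq> {}" by (rule_tac notI) simp
        from C_exists[OF this] obtain x1 where x1: "x1 \<in> frms" "C x1" by auto
        have t: "x1 \<in> tuples" "x2 \<in> tuples" using x1 x2 by (auto simp: frames_def)
        obtain p2 where p2: "p2 \<in> polys" "p2 x2 \<noteq> 0"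
          "{x \<in> frms. p2 x \<noteq> 0} \<subseteq> {x \<in> frms. frame_span M I r x \<in> T}"
        proof -
          have "\<forall>x\<in>{x \<in> frms. frame_span M I r x \<in> T}. \<exists>p\<in>polys. p x \<noteq> 0 \<and>
              {x \<in> frms. p x \<noteq> 0} \<subseteq> {x \<in> frms. frame_span M I r x \<in> T}"
            using T(2) unfolding openin_zariski_grassmannians openin_zariski_frames_iff by simp
          moreover have "x2 \<in> {x \<in> frms. frame_span M I r x \<in> T}" using x2 T(1) by simp
          ultimately show ?thesis using that by (auto dest!: bspec)
        qed
        obtain p1 where p1: "p1 \<in> polys" "p1 x1 \<noteq> 0" "\<And>z. z \<in> tuples \<Longrightarrow> p1 z \<noteq> 0 \<Longrightarrow> C z"
          using C_open[OF t(1) x1(2)] by auto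
        obtain p where p: "p \<in> polys" "p x1 \<noteq> 0" "\<And>z. z \<in> tuples \<Longrightarrow> p z \<noteq> 0 \<Longrightarrow> z \<in> frms"
          using frames_open[OF x1(1)] by auto
        obtain w where w: "w \<in> tuples" "line x1 w 1 = x2" using line_through[OF t] by auto
        obtain q where q0: "\<And>e. p (line x1 w e) = poly q e"
          using poly_on_line[OF p(1) t(1) w(1)] by auto
        obtain q1 where q1: "\<And>e. p1 (line x1 w e) = poly q1 e"
          using poly_on_line[OF p1(1) t(1) w(1)] by auto
        obtain q2 where q2: "\<And>e. p2 (line x1 w e) = poly q2 e"
          using poly_on_line[OF p2(1) t(1) w(1)] by auto
        note q = q0 q1 q2
        \<comment> \<open>Density: the line joins a good frame \<open>x1\<close> at
          \<open>e = 0\<close> to a frame \<open>x2\<close> of \<open>U\<close> at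
          \<open>e = 1\<close>. Being a frame and satisfying \<open>C\<close> are general because
          they hold at 0, and lying over \<open>T\<close> is general because it holds at 1; a
          nonzero value of the product gives all three at once.\<close>
        have "poly q 0 \<noteq> 0" "poly q1 0 \<noteq> 0" "poly q2 1 \<noteq> 0"
          using q[symmetric] line_0[OF t(1) w(1)] w(2) p(2) p1(2) p2(2) by auto
        then have "q * q1 * q2 \<noteq> 0" by auto
        then obtain e where "poly (q * q1 * q2) e \<noteq> 0" using poly_nonzero_value[OF inf] by blast
        then have e: "poly q e \<noteq> 0" "poly q1 e \<noteq> 0" "poly q2 e \<noteq> 0" by auto
        let ?x = "line x1 w e"
        have xt: "?x \<in> tuples" by (rule line_tuple[OF t(1) w(1)])
        have xf: "?x \<in> frms" using p(3)[OF xt] q(1) e(1) by simp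
        have "C ?x" using p1(3)[OF xt] q(2) e(2) by simp
        then have "frame_span M I r ?x \<in> W" using pre_W xf by blast
        moreover have "?x \<in> {x \<in> frms. frame_span M I r x \<in> T}"
          using p2(3) xf q(3)[of e] e(3) by (intro subsetD[OF p2(3)]) simp
        ultimately show ?thesis by blast
      qed
      then show "U \<in> ?Z closure_of W" unfolding in_closure_of top using U by simp
    qed
  qed
  moreover have "\<forall>U\<in>W. P U" by (simp add: W_def)
  ultimately show ?thesis by blast
qed

end

section \<open>Linear maps on finitely supported functions\<close>

definition pscale :: "'k::field \<Rightarrow> ('b \<Rightarrow>\<^sub>0 'k) \<Rightarrow> ('b \<Rightarrow>\<^sub>0 'k)" where
  "pscale c = Poly_Mapping.map ((*) c)"

lemma lookup_pscale [simp]: "Poly_Mapping.lookup (pscale c x) p = c * Poly_Mapping.lookup x p"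
  by (simp add: pscale_def Poly_Mapping.map.rep_eq when_def)

interpretation pm: vec_space pscale
  by unfold_locales (auto intro!: poly_mapping_eqI simp: lookup_add algebra_simps)

abbreviation basis_vec :: "'b \<Rightarrow> ('b \<Rightarrow>\<^sub>0 'k::field)" where
  "basis_vec p \<equiv> Poly_Mapping.single p 1"

abbreviation plin :: "(('b \<Rightarrow>\<^sub>0 'k::field) \<Rightarrow> ('c \<Rightarrow>\<^sub>0 'k)) \<Rightarrow> bool" where
  "plin \<equiv> Vector_Spaces.linear pscale pscale"

lemma plin_iff:
  "plin f \<longleftrightarrow> (\<forall>x y. f (x + y) = f x + f y) \<and> (\<forall>c x. f (pscale c x) = pscale c (f x))"
  by (simp add: Vector_Spaces.linear_iff pm.vector_space_axioms)

lemma plinI: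
  "(\<And>x y. f (x + y) = f x + f y) \<Longrightarrow> (\<And>c x. f (pscale c x) = pscale c (f x)) \<Longrightarrow> plin f"
  by (simp add: plin_iff)

lemma plin_add: "plin f \<Longrightarrow> f (x + y) = f x + f y"
  and plin_scale: "plin f \<Longrightarrow> f (pscale c x) = pscale c (f x)"
  by (auto simp: plin_iff)

lemma plin_zero: "plin f \<Longrightarrow> f 0 = 0"
  using plin_scale[of f 0 0] by simp

lemma plin_diff: "plin f \<Longrightarrow> f (x - y) = f x - f y"
  using plin_add[of f "x - y" y] by simp

lemma plin_sum: "plin f \<Longrightarrow> f (\<Sum>a\<in>A. g a) = (\<Sum>a\<in>A. f (g a))"
  by (induction A rule: infinite_finite_induct) (auto simp: plin_zero plin_add)

lemma plin_compose: "plin f \<Longrightarrow> plin g \<Longrightarrow> plin (\<lambda>x. f (g x))"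
  by (simp add: plin_iff)

lemma plin_id: "plin (\<lambda>x. x)"
  by (simp add: plin_iff)

lemma plin_const_zero: "plin (\<lambda>x. 0)"
  by (simp add: plin_iff)

lemma plin_pscale: "plin f \<Longrightarrow> plin (\<lambda>x. pscale c (f x))"
  by (simp add: plin_iff pm.scale_right_distrib mult.commute)

lemma plin_sum_fun: "(\<And>a. a \<in> A \<Longrightarrow> plin (f a)) \<Longrightarrow> plin (\<lambda>x. \<Sum>a\<in>A. f a x)"
  by (simp add: plin_iff sum.distrib pm.scale_sum_right)

lemma plin_minus_fun: "plin f \<Longrightarrow> plin g \<Longrightarrow> plin (\<lambda>x. f x - g x)"
  by (simp add: plin_iff pm.scale_right_diff_distrib)

lemma poly_mapping_expand:
  assumes "finite A" "Poly_Mapping.keys x \<subseteq> A"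
  shows "x = (\<Sum>p\<in>A. pscale (Poly_Mapping.lookup x p) (basis_vec p))"
proof (rule poly_mapping_eqI)
  fix q
  have "(\<Sum>p\<in>A. Poly_Mapping.lookup x p * (1 when p = q)) =
      (\<Sum>p\<in>A. if p = q then Poly_Mapping.lookup x q else 0)"
    by (rule sum.cong) (auto simp: when_def)
  also have "\<dots> = Poly_Mapping.lookup x q"
  proof -
    have "Poly_Mapping.lookup x q = 0" if "q \<notin> A"
      using assms(2) that by (auto simp: in_keys_iff subset_iff)
    then show ?thesis using assms(1) by auto
  qed
  finally show "Poly_Mapping.lookup x q =
      Poly_Mapping.lookup (\<Sum>p\<in>A. pscale (Poly_Mapping.lookup x p) (basis_vec p)) q"
    by (simp add: lookup_sum lookup_single)
qed

lemma in_span_basis_vec_iff: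
  fixes x :: "'b \<Rightarrow>\<^sub>0 'k::field"
  shows "x \<in> pm.span (basis_vec ` A) \<longleftrightarrow> Poly_Mapping.keys x \<subseteq> A"
proof
  assume "x \<in> pm.span (basis_vec ` A)"
  then show "Poly_Mapping.keys x \<subseteq> A"
  proof (rule pm.span_induct)
    show "pm.subspace {x :: 'b \<Rightarrow>\<^sub>0 'k. Poly_Mapping.keys x \<subseteq> A}"
    proof (rule pm.subspaceI)
      fix x y :: "'b \<Rightarrow>\<^sub>0 'k" assume "x \<in> {x. Poly_Mapping.keys x \<subseteq> A}" "y \<in> {x. Poly_Mapping.keys x \<subseteq> A}"
      then show "x + y \<in> {x. Poly_Mapping.keys x \<subseteq> A}" using keys_add[of x y] by auto
    qed (auto simp: in_keys_iff)
  qed auto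
next
  assume "Poly_Mapping.keys x \<subseteq> A"
  then show "x \<in> pm.span (basis_vec ` A)"
    by (subst poly_mapping_expand[OF finite_keys subset_refl])
      (intro pm.span_sum pm.span_scale pm.span_base, blast)
qed

lemma plin_eqI:
  assumes "plin f" "plin g" "\<And>p. p \<in> Poly_Mapping.keys x \<Longrightarrow> f (basis_vec p) = g (basis_vec p)"
  shows "f x = g x"
proof -
  have x: "x = (\<Sum>p\<in>Poly_Mapping.keys x. pscale (Poly_Mapping.lookup x p) (basis_vec p))"
    by (rule poly_mapping_expand) auto
  have "f x = (\<Sum>p\<in>Poly_Mapping.keys x. pscale (Poly_Mapping.lookup x p) (f (basis_vec p)))"
    using arg_cong[OF x, of f] by (simp add: plin_sum[OF assms(1)] plin_scale[OF assms(1)])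
  also have "\<dots> = (\<Sum>p\<in>Poly_Mapping.keys x. pscale (Poly_Mapping.lookup x p) (g (basis_vec p)))"
    using assms(3) by simp
  also have "\<dots> = g x"
    using arg_cong[OF x, of g] by (simp add: plin_sum[OF assms(2)] plin_scale[OF assms(2)])
  finally show ?thesis .
qed

lemma plin_span_subspace:
  assumes f: "plin f" and x: "x \<in> pm.span S" and T: "pm.subspace T" "\<And>s. s \<in> S \<Longrightarrow> f s \<in> T"
  shows "f x \<in> T"
  using x
proof (rule pm.span_induct)
  show "pm.subspace {x. f x \<in> T}"
    using T(1) by (intro pm.subspaceI)
      (auto simp: plin_zero[OF f] plin_add[OF f] plin_scale[OF f] pm.subspace_0 pm.subspace_add pm.subspace_scale)
qed (use T in auto)

definition pext :: "('b \<Rightarrow> ('c \<Rightarrow>\<^sub>0 'k)) \<Rightarrow> ('b \<Rightarrow>\<^sub>0 'k::field) \<Rightarrow> ('c \<Rightarrow>\<^sub>0 'k)" where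
  "pext F x = (\<Sum>p\<in>Poly_Mapping.keys x. pscale (Poly_Mapping.lookup x p) (F p))"

lemma pext_superset:
  assumes "finite A" "Poly_Mapping.keys x \<subseteq> A"
  shows "pext F x = (\<Sum>p\<in>A. pscale (Poly_Mapping.lookup x p) (F p))"
  unfolding pext_def using assms by (intro sum.mono_neutral_left) (auto simp: in_keys_iff)

lemma plin_pext: "plin (pext (F :: 'b \<Rightarrow> ('c \<Rightarrow>\<^sub>0 'k::field)))"
proof (rule plinI)
  fix x y :: "'b \<Rightarrow>\<^sub>0 'k"
  define A where "A = Poly_Mapping.keys x \<union> Poly_Mapping.keys y \<union> Poly_Mapping.keys (x + y)"
  have A: "finite A" "Poly_Mapping.keys x \<subseteq> A" "Poly_Mapping.keys y \<subseteq> A" "Poly_Mapping.keys (x + y) \<subseteq> A"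
    by (auto simp: A_def)
  show "pext F (x + y) = pext F x + pext F y"
    unfolding pext_superset[OF A(1,2)] pext_superset[OF A(1,3)] pext_superset[OF A(1,4)]
    by (simp add: lookup_add pm.scale_left_distrib sum.distrib)
next
  fix c and x :: "'b \<Rightarrow>\<^sub>0 'k"
  have "Poly_Mapping.keys (pscale c x) \<subseteq> Poly_Mapping.keys x" by (auto simp: in_keys_iff)
  then show "pext F (pscale c x) = pscale c (pext F x)"
    by (subst pext_superset[OF finite_keys]) (simp_all add: pext_def pm.scale_sum_right)
qed

lemma pext_basis_vec [simp]: "pext F (basis_vec p) = F p"
  by (simp add: pext_def)

text \<open>A basis of \<open>J\<close> is extended to a basis of the whole space, and the
  projection kills its part in \<open>J\<close>. The image is a model of the quotient by
  \<open>J\<close> inside the same type.\<close>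

lemma complement_projection:
  assumes J: "pm.subspace (J :: ('b \<Rightarrow>\<^sub>0 'k::field) set)"
  obtains proj where "plin proj" "\<And>j. j \<in> J \<Longrightarrow> proj j = 0" "\<And>y. proj y - y \<in> J"
proof -
  interpret pair: vector_space_pair "pscale :: 'k \<Rightarrow> ('b \<Rightarrow>\<^sub>0 'k) \<Rightarrow> _" "pscale :: 'k \<Rightarrow> ('b \<Rightarrow>\<^sub>0 'k) \<Rightarrow> _" ..
  obtain B where B: "B \<subseteq> J" "pm.independent B" "J \<subseteq> pm.span B"
    using pm.maximal_independent_subset[of J] by auto
  let ?C = "pm.extend_basis B"
  have C: "pm.independent ?C" "pm.span ?C = UNIV"
    using pm.independent_extend_basis[OF B(2)] pm.span_extend_basis[OF B(2)] by auto
  define proj where "proj = pair.construct ?C (\<lambda>b. if b \<in> B then 0 else b)"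
  have lin: "plin proj" unfolding proj_def by (rule pair.linear_construct[OF C(1)])
  have proj: "proj b = (if b \<in> B then 0 else b)" if "b \<in> ?C" for b
    unfolding proj_def by (rule pair.construct_basis[OF C(1) that])
  have BC: "B \<subseteq> ?C" by (rule pm.extend_basis_superset[OF B(2)])
  show ?thesis
  proof (rule that[OF lin])
    fix j assume "j \<in> J"
    then have "j \<in> pm.span B" using B by auto
    then have "proj j \<in> {0}"
      by (rule plin_span_subspace[OF lin]) (use proj BC in \<open>auto simp: pm.subspace_single_0\<close>)
    then show "proj j = 0" by simp
  next
    fix y
    have "y \<in> pm.span ?C" using C by simp
    then show "proj y - y \<in> J"
      by (rule plin_span_subspace[OF plin_minus_fun[OF lin plin_id]])
        (use J proj B in \<open>auto simp: pm.subspace_neg pm.subspace_0\<close>)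
  qed
qed

section \<open>The path algebra as a ring\<close>

definition path_comp :: "('v, 'e) pre_digraph \<Rightarrow> 'v \<times> 'e list \<Rightarrow> 'v \<times> 'e list \<Rightarrow> ('v \<times> 'e list \<Rightarrow>\<^sub>0 'k::field)" where
  "path_comp Q p q = (if pre_digraph.awalk Q (fst q) (snd q) (fst p) then basis_vec (fst q, snd q @ snd p) else 0)"

lemma path_mult_eq: "path_mult Q x y = pext (\<lambda>p. pext (\<lambda>q. path_comp Q p q) y) x"
  unfolding path_mult_def pext_def pm.scale_sum_right
  by (intro sum.cong refl poly_mapping_eqI) (auto simp: path_comp_def lookup_single when_def)

lemma plin_path_mult_left: "plin (\<lambda>x. path_mult Q x y)"
  unfolding path_mult_eq by (rule plin_pext)

lemma plin_path_mult_right: "plin (path_mult Q x)"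
proof -
  have "path_mult Q x = (\<lambda>y. \<Sum>p\<in>Poly_Mapping.keys x. pscale (Poly_Mapping.lookup x p) (pext (path_comp Q p) y))"
    unfolding path_mult_eq by (simp add: pext_def[of _ x])
  then show ?thesis by (simp only:) (intro plin_sum_fun plin_pscale plin_pext)
qed

lemma path_mult_basis_vec [simp]: "path_mult Q (basis_vec p) (basis_vec q) = path_comp Q p q"
  by (simp add: path_mult_eq)

lemma path_mult_zero [simp]: "path_mult Q 0 y = 0" "path_mult Q x 0 = 0"
  using plin_zero[OF plin_path_mult_left] plin_zero[OF plin_path_mult_right] by auto

context wf_digraph
begin

lemma awalk_append_iff_awalk:
  assumes "awalk u p v"
  shows "awalk u (p @ q) w \<longleftrightarrow> awalk v q w"
proof -
  have "awlast u p = v" using assms by (rule awalkE)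
  with assms show ?thesis by (simp add: awalk_append_iff)
qed

text \<open>Both sides are linear in each of the three arguments. The identity is checked on paths
  and extended to general elements one argument at a time.\<close>

lemma path_mult_assoc: "path_mult G (path_mult G x y) z = path_mult G x (path_mult G y z)"
proof -
  have 0: "path_mult G (path_comp G p q) (basis_vec r) = path_mult G (basis_vec p) (path_comp G q r)" for p q r
  proof (cases "awalk (fst r) (snd r) (fst q)")
    case True
    then show ?thesis
      by (simp add: path_comp_def awalk_append_iff_awalk[OF True] del: awalk_append_iff)
  next
    case False
    then show ?thesis by (simp add: path_comp_def)
  qed
  have 1: "path_mult G (path_comp G p q) z = path_mult G (basis_vec p) (path_mult G (basis_vec q) z)" for p q
    by (rule plin_eqI[where f = "path_mult G (path_comp G p q)"
          and g = "\<lambda>z. path_mult G (basis_vec p) (path_mult G (basis_vec q) z)",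
          OF plin_path_mult_right plin_compose[OF plin_path_mult_right plin_path_mult_right]])
      (simp only: path_mult_basis_vec 0)
  have 2: "path_mult G (path_mult G (basis_vec p) y) z = path_mult G (basis_vec p) (path_mult G y z)" for p
    by (rule plin_eqI[where f = "\<lambda>y. path_mult G (path_mult G (basis_vec p) y) z"
          and g = "\<lambda>y. path_mult G (basis_vec p) (path_mult G y z)",
          OF plin_compose[OF plin_path_mult_left plin_path_mult_right]
            plin_compose[OF plin_path_mult_right plin_path_mult_left]])
      (simp only: path_mult_basis_vec 1)
  show ?thesis
    by (rule plin_eqI[where f = "\<lambda>x. path_mult G (path_mult G x y) z" and g = "\<lambda>x. path_mult G x (path_mult G y z)",
          OF plin_compose[OF plin_path_mult_left plin_path_mult_left] plin_path_mult_left])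
      (simp only: 2)
qed

lemma path_comp_paths:
  assumes "p \<in> paths G" "q \<in> paths G"
  shows "Poly_Mapping.keys (path_comp G p q) \<subseteq> paths G"
proof (cases "awalk (fst q) (snd q) (fst p)")
  case True
  obtain v where "awalk (fst p) (snd p) v" using assms(1) by (auto simp: paths_def)
  then have "awalk (fst q) (snd q @ snd p) v" using awalk_append_iff_awalk[OF True] by simp
  then show ?thesis using True by (auto simp: path_comp_def paths_def)
qed (simp add: path_comp_def)

lemma path_mult_paths:
  assumes "Poly_Mapping.keys x \<subseteq> paths G" "Poly_Mapping.keys y \<subseteq> paths G"
  shows "Poly_Mapping.keys (path_mult G x y) \<subseteq> paths G"
proof -
  have "path_mult G x y \<in> pm.span (basis_vec ` paths G)"
    unfolding path_mult_eq pext_def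
  proof (intro pm.span_sum pm.span_scale)
    fix p q assume "p \<in> Poly_Mapping.keys x" "q \<in> Poly_Mapping.keys y"
    then show "path_comp G p q \<in> pm.span (basis_vec ` paths G)"
      using path_comp_paths[OF subsetD[OF assms(1)] subsetD[OF assms(2)]] by (simp add: in_span_basis_vec_iff)
  qed
  then show ?thesis by (simp add: in_span_basis_vec_iff)
qed

end

lemma path_algebra_simps [simp]:
  "carrier (path_algebra Q) = {x. Poly_Mapping.keys x \<subseteq> paths Q}"
  "monoid.mult (path_algebra Q) = path_mult Q"
  "\<one>\<^bsub>path_algebra Q\<^esub> = (\<Sum>v\<in>verts Q. basis_vec (v, []))"
  "\<zero>\<^bsub>path_algebra Q\<^esub> = 0"
  "add (path_algebra Q) = (+)"
  "smult (path_algebra Q) = pscale"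
  by (auto simp: path_algebra_def pscale_def fun_eq_iff)

lemma keys_add_subset: "Poly_Mapping.keys x \<subseteq> A \<Longrightarrow> Poly_Mapping.keys y \<subseteq> A \<Longrightarrow> Poly_Mapping.keys (x + y) \<subseteq> A"
  using keys_add[of x y] by blast

lemma abelian_group_path_algebra: "abelian_group (path_algebra Q)"
proof (rule abelian_groupI)
  fix x assume "x \<in> carrier (path_algebra Q)"
  then show "\<exists>y\<in>carrier (path_algebra Q). y \<oplus>\<^bsub>path_algebra Q\<^esub> x = \<zero>\<^bsub>path_algebra Q\<^esub>"
    by (intro bexI[of _ "- x"]) (auto simp: in_keys_iff subset_iff)
qed (simp_all add: add_ac keys_add_subset)

lemma a_inv_path_algebra:
  assumes "x \<in> carrier (path_algebra Q)"
  shows "\<ominus>\<^bsub>path_algebra Q\<^esub> x = - x"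
proof -
  interpret abelian_group "path_algebra Q" by (rule abelian_group_path_algebra)
  have "- x \<in> carrier (path_algebra Q)" using assms by (auto simp: in_keys_iff subset_iff)
  then show ?thesis
    using assms by (intro minus_equality) simp_all
qed

lemma finsum_path_algebra:
  assumes "f \<in> A \<rightarrow> carrier (path_algebra Q)"
  shows "finsum (path_algebra Q) f A = (\<Sum>a\<in>A. f a)"
proof -
  interpret abelian_group "path_algebra Q" by (rule abelian_group_path_algebra)
  show ?thesis using assms
  proof (induction A rule: infinite_finite_induct)
    case (infinite A)
    show ?case using infinite.hyps by (simp add: finsum_infinite)
  next
    case empty
    show ?case by (simp only: finsum_empty sum.empty path_algebra_simps)
  next
    case (insert a A)
    then have "finsum (path_algebra Q) f (insert a A) = f a \<oplus>\<^bsub>path_algebra Q\<^esub> finsum (path_algebra Q) f A"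
      by (intro finsum_insert) simp_all
    moreover have "f \<in> A \<rightarrow> carrier (path_algebra Q)" using insert.prems by simp
    ultimately show ?case
      using insert.IH insert.hyps by simp
  qed
qed

context fin_digraph
begin

lemma path_one_mult:
  assumes "Poly_Mapping.keys x \<subseteq> paths G"
  shows "path_mult G (\<Sum>v\<in>verts G. basis_vec (v, [])) x = x"
proof -
  have "path_mult G (\<Sum>v\<in>verts G. basis_vec (v, [])) (basis_vec p) = basis_vec p" if "p \<in> Poly_Mapping.keys x" for p
  proof -
    have "p \<in> paths G" by (rule subsetD[OF assms that])
    then obtain u where u: "awalk (fst p) (snd p) u" by (cases p) (simp add: paths_def, elim exE)
    have uv: "u \<in> verts G" using u by (rule awalk_last_in_verts)
    have last: "awlast (fst p) (snd p) = v" if "awalk (fst p) (snd p) v" for v using that by (rule awalkE)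
    have "awalk (fst p) (snd p) v \<longleftrightarrow> v = u" for v
    proof
      assume "awalk (fst p) (snd p) v"
      from last[OF this] last[OF u] show "v = u" by simp
    next
      assume "v = u"
      with u show "awalk (fst p) (snd p) v" by (simp only:)
    qed
    then have "(\<Sum>v\<in>verts G. path_comp G (v, []) p) = (\<Sum>v\<in>verts G. if v = u then basis_vec p else 0)"
      by (intro sum.cong) (simp_all add: path_comp_def)
    then show ?thesis using uv by (simp add: plin_sum[OF plin_path_mult_left])
  qed
  then show ?thesis
    by (rule plin_eqI[OF plin_path_mult_right plin_id])
qed

lemma path_mult_one:
  assumes "Poly_Mapping.keys x \<subseteq> paths G"
  shows "path_mult G x (\<Sum>v\<in>verts G. basis_vec (v, [])) = x"
proof -
  have "path_mult G (basis_vec p) (\<Sum>v\<in>verts G. basis_vec (v, [])) = basis_vec p" if "p \<in> Poly_Mapping.keys x" for p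
  proof -
    have "p \<in> paths G" by (rule subsetD[OF assms that])
    then have pv: "fst p \<in> verts G" by (cases p) (auto simp: paths_def awalk_def)
    have "(\<Sum>v\<in>verts G. path_comp G p (v, [])) = (\<Sum>v\<in>verts G. if v = fst p then basis_vec p else 0)"
      by (intro sum.cong) (auto simp: path_comp_def awalk_Nil_iff)
    then show ?thesis using pv by (simp add: plin_sum[OF plin_path_mult_right])
  qed
  then show ?thesis
    by (rule plin_eqI[OF plin_path_mult_left plin_id])
qed

lemma ring_path_algebra: "ring (path_algebra G :: ('k::field, 'a \<times> 'b list \<Rightarrow>\<^sub>0 'k) module)"
proof (rule ringI)
  let ?A = "path_algebra G :: ('k, 'a \<times> 'b list \<Rightarrow>\<^sub>0 'k) module"
  show "abelian_group ?A" by (rule abelian_group_path_algebra)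
  have "Poly_Mapping.keys (\<Sum>v\<in>verts G. basis_vec (v, []) :: 'a \<times> 'b list \<Rightarrow>\<^sub>0 'k) \<subseteq> paths G"
  proof -
    have "(v, []) \<in> paths G" if "v \<in> verts G" for v using that by (auto simp: paths_def awalk_Nil_iff)
    then have "(\<Sum>v\<in>verts G. basis_vec (v, []) :: 'a \<times> 'b list \<Rightarrow>\<^sub>0 'k) \<in> pm.span (basis_vec ` paths G)"
      by (intro pm.span_sum pm.span_base imageI)
    then show ?thesis by (simp add: in_span_basis_vec_iff)
  qed
  then show "monoid ?A"
    by unfold_locales (simp_all add: path_mult_assoc path_one_mult path_mult_one path_mult_paths)
qed (auto simp: plin_add[OF plin_path_mult_left] plin_add[OF plin_path_mult_right])

end

section \<open>The ideal of the mesh relations\<close>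

locale preprojective = fin_digraph \<Gamma>
  for \<Gamma> :: "('v, 'e) pre_digraph" +
  fixes a b :: "'e \<Rightarrow> 'k::field"
begin

sublocale Q: fin_digraph "double_quiver \<Gamma>"
  by (rule fin_digraph_double_quiver) (rule fin_digraph_axioms)

abbreviation Q where "Q \<equiv> double_quiver \<Gamma>"

abbreviation A :: "('k, 'v \<times> ('e + 'e) list \<Rightarrow>\<^sub>0 'k) module" where "A \<equiv> path_algebra Q"

text \<open>With these signs the two sums of the mesh relation at \<open>t\<close> become one sum
  over the arrows of the double quiver that start at \<open>t\<close>.\<close>

abbreviation eps :: "'e + 'e \<Rightarrow> 'k" where "eps \<equiv> case_sum a (\<lambda>\<gamma>. - b \<gamma>)"

text \<open>The product of the path \<open>(t, k)\<close>, the mesh relation at \<open>t\<close> and the path \<open>(w, l)\<close> ending at \<open>t\<close>.\<close>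

definition mesh_mult :: "'v \<Rightarrow> 'v \<Rightarrow> ('e + 'e) list \<Rightarrow> ('e + 'e) list \<Rightarrow> 'v \<times> ('e + 'e) list \<Rightarrow>\<^sub>0 'k" where
  "mesh_mult t w l k = (\<Sum>x\<in>out_arcs Q t. pscale (eps x) (basis_vec (w, l @ [x, dbl_bar x] @ k)))"

text \<open>The ideal of the mesh relations, given by linear generators so that linear maps can be
  controlled on it generator by generator.\<close>

definition J :: "('v \<times> ('e + 'e) list \<Rightarrow>\<^sub>0 'k) set" where
  "J = pm.span {mesh_mult t w l k | t w l k. Q.awalk w l t \<and> (t, k) \<in> paths Q}"

lemma paths_iff: "(u, p) \<in> paths Q \<longleftrightarrow> (\<exists>v. Q.awalk u p v)"
  by (simp add: paths_def)

lemma walk_two: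
  assumes "x \<in> out_arcs Q t"
  shows "Q.awalk t ([x, dbl_bar x] @ k) v \<longleftrightarrow> Q.awalk t k v"
  using assms by (simp add: Q.awalk_Cons_iff)

lemma walk_insert_two:
  assumes "Q.awalk w l t" "x \<in> out_arcs Q t"
  shows "Q.awalk w (l @ [x, dbl_bar x] @ k) v \<longleftrightarrow> Q.awalk t k v"
  by (simp only: Q.awalk_append_iff_awalk[OF assms(1)] walk_two[OF assms(2)])

lemma path_append:
  assumes "Q.awalk u p v" "(v, q) \<in> paths Q"
  shows "(u, p @ q) \<in> paths Q"
  using assms(2) by (simp only: paths_iff Q.awalk_append_iff_awalk[OF assms(1)])

lemma mesh_mult_keys:
  assumes "Q.awalk w l t" "(t, k) \<in> paths Q"
  shows "Poly_Mapping.keys (mesh_mult t w l k) \<subseteq> paths Q"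
proof -
  have "(w, l @ [x, dbl_bar x] @ k) \<in> paths Q" if "x \<in> out_arcs Q t" for x
    using assms(2) by (simp only: paths_iff walk_insert_two[OF assms(1) that])
  then have "mesh_mult t w l k \<in> pm.span (basis_vec ` paths Q)"
    unfolding mesh_mult_def by (intro pm.span_sum pm.span_scale pm.span_base imageI)
  then show ?thesis by (simp only: in_span_basis_vec_iff)
qed

lemma basis_mult_mesh_mult:
  assumes "Q.awalk w l t"
  shows "path_mult Q (basis_vec r) (mesh_mult t w l k) =
    (if Q.awalk t k (fst r) then mesh_mult t w l (k @ snd r) else 0)"
proof -
  have "path_comp Q r (w, l @ [x, dbl_bar x] @ k) =
      (if Q.awalk t k (fst r) then basis_vec (w, l @ [x, dbl_bar x] @ (k @ snd r)) else 0)"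
    if "x \<in> out_arcs Q t" for x
    unfolding path_comp_def fst_conv snd_conv walk_insert_two[OF assms that] by (simp only: append_assoc)
  then have "path_mult Q (basis_vec r) (mesh_mult t w l k) =
      (\<Sum>x\<in>out_arcs Q t. pscale (eps x)
        (if Q.awalk t k (fst r) then basis_vec (w, l @ [x, dbl_bar x] @ (k @ snd r)) else 0))"
    unfolding mesh_mult_def plin_sum[OF plin_path_mult_right] plin_scale[OF plin_path_mult_right]
      path_mult_basis_vec by (intro sum.cong refl arg_cong[where f = "pscale _"])
  then show ?thesis unfolding mesh_mult_def by simp
qed

lemma mesh_mult_mult_basis:
  "path_mult Q (mesh_mult t w l k) (basis_vec r) =
    (if Q.awalk (fst r) (snd r) w then mesh_mult t (fst r) (snd r @ l) k else 0)"
  by (simp add: mesh_mult_def plin_sum[OF plin_path_mult_left] plin_scale[OF plin_path_mult_left] path_comp_def)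

lemma J_subspace: "pm.subspace J"
  unfolding J_def by (rule pm.subspace_span)

lemma mesh_mult_J:
  assumes "Q.awalk w l t" "(t, k) \<in> paths Q"
  shows "mesh_mult t w l k \<in> J"
  unfolding J_def
  by (rule pm.span_base, rule CollectI, rule exI[of _ t], rule exI[of _ w], rule exI[of _ l],
      rule exI[of _ k], intro conjI refl assms)

lemma J_induct:
  assumes "plin f" "pm.subspace T" "j \<in> J"
    "\<And>t w l k. Q.awalk w l t \<Longrightarrow> (t, k) \<in> paths Q \<Longrightarrow> f (mesh_mult t w l k) \<in> T"
  shows "f j \<in> T"
proof (rule plin_span_subspace[OF assms(1) assms(3)[unfolded J_def] assms(2)])
  fix s assume "s \<in> {mesh_mult t w l k | t w l k. Q.awalk w l t \<and> (t, k) \<in> paths Q}"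
  then show "f s \<in> T" by (elim CollectE exE conjE) (simp only: assms(4))
qed

lemma J_paths: "j \<in> J \<Longrightarrow> Poly_Mapping.keys j \<subseteq> paths Q"
  using J_induct[OF plin_id pm.subspace_span, of j "basis_vec ` paths Q"] mesh_mult_keys
  by (simp only: in_span_basis_vec_iff)

lemma paths_span_mult:
  assumes "Poly_Mapping.keys x \<subseteq> S" "plin f" "pm.subspace T" "\<And>p. p \<in> S \<Longrightarrow> f (basis_vec p) \<in> T"
  shows "f x \<in> T"
  by (rule plin_span_subspace[OF assms(2) _ assms(3), of x "basis_vec ` S"])
    (use assms(1,4) in \<open>auto simp: in_span_basis_vec_iff\<close>)

lemma J_mult_left:
  assumes "j \<in> J" "Poly_Mapping.keys x \<subseteq> paths Q"
  shows "path_mult Q x j \<in> J"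
proof (rule paths_span_mult[OF assms(2) plin_path_mult_left J_subspace])
  fix r assume r: "r \<in> paths Q"
  show "path_mult Q (basis_vec r) j \<in> J"
  proof (rule J_induct[OF plin_path_mult_right J_subspace assms(1)])
    fix t w l k assume *: "Q.awalk w l t" "(t, k) \<in> paths Q"
    have "mesh_mult t w l (k @ snd r) \<in> J" if "Q.awalk t k (fst r)"
      by (rule mesh_mult_J[OF *(1) path_append[OF that]]) (simp only: prod.collapse r)
    then show "path_mult Q (basis_vec r) (mesh_mult t w l k) \<in> J"
      unfolding basis_mult_mesh_mult[OF *(1)] by (simp add: pm.subspace_0[OF J_subspace])
  qed
qed

lemma J_mult_right:
  assumes "j \<in> J"
  shows "path_mult Q j x \<in> J"
proof (rule paths_span_mult[OF subset_UNIV plin_path_mult_right J_subspace])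
  fix r :: "'v \<times> ('e + 'e) list"
  show "path_mult Q j (basis_vec r) \<in> J"
  proof (rule J_induct[OF plin_path_mult_left J_subspace assms(1)])
    fix t w l k assume *: "Q.awalk w l t" "(t, k) \<in> paths Q"
    have "mesh_mult t (fst r) (snd r @ l) k \<in> J" if r: "Q.awalk (fst r) (snd r) w"
      by (rule mesh_mult_J[OF _ *(2)]) (simp only: Q.awalk_append_iff_awalk[OF r] *(1))
    then show "path_mult Q (mesh_mult t w l k) (basis_vec r) \<in> J"
      unfolding mesh_mult_mult_basis by (simp add: pm.subspace_0[OF J_subspace])
  qed
qed

lemma J_ideal: "ideal J A"
proof (rule idealI[OF Q.ring_path_algebra])
  show "subgroup J (add_monoid A)"
  proof
    show "J \<subseteq> carrier (add_monoid A)" using J_paths by (simp add: subset_iff)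
    fix x assume x: "x \<in> J"
    then have "Poly_Mapping.keys x \<subseteq> paths Q" by (rule J_paths)
    then have "inv\<^bsub>add_monoid A\<^esub> x = - x"
      using a_inv_path_algebra[of x Q] by (simp add: a_inv_def)
    then show "inv\<^bsub>add_monoid A\<^esub> x \<in> J" using pm.subspace_neg[OF J_subspace x] by simp
  qed (simp_all add: pm.subspace_0[OF J_subspace] pm.subspace_add[OF J_subspace])
qed (simp_all add: J_mult_left J_mult_right)

lemma arrow_eq: "arrow Q x = basis_vec (tail Q x, [x])"
  by (simp add: arrow_def)

lemma arrow_bar_mult:
  assumes "x \<in> arcs Q"
  shows "path_mult Q (arrow Q (dbl_bar x)) (arrow Q x) = basis_vec (tail Q x, [x, dbl_bar x])"
proof -
  have "Q.awalk (tail Q x) [x] (head Q x)"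
    using assms Q.head_in_verts[OF assms] by (simp add: Q.awalk_Cons_iff Q.awalk_Nil_iff)
  then show ?thesis by (simp add: arrow_eq path_comp_def)
qed

lemma out_arcs_double: "out_arcs Q t = Inl ` out_arcs \<Gamma> t \<union> Inr ` in_arcs \<Gamma> t"
  by (auto simp: double_quiver_def out_arcs_def in_arcs_def)

lemma sum_out_arcs_double:
  "(\<Sum>x\<in>out_arcs Q t. f x) = (\<Sum>\<gamma>\<in>out_arcs \<Gamma> t. f (Inl \<gamma>)) + (\<Sum>\<gamma>\<in>in_arcs \<Gamma> t. f (Inr \<gamma>))"
  for f :: "'e + 'e \<Rightarrow> 'z::comm_monoid_add"
  unfolding out_arcs_double
  by (subst sum.union_disjoint) (auto simp: sum.reindex finite_out_arcs finite_in_arcs)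

lemma mesh_eq:
  assumes t: "t \<in> verts \<Gamma>"
  shows "mesh \<Gamma> a b t = mesh_mult t t [] []"
proof -
  have path: "(t, [x, dbl_bar x]) \<in> paths Q" if "x \<in> out_arcs Q t" for x
    using walk_two[OF that, of "[]"] t by (simp add: paths_iff Q.awalk_Nil_iff)
  have out: "path_mult Q (arrow Q (Inr \<gamma>)) (arrow Q (Inl \<gamma>)) = basis_vec (t, [Inl \<gamma>, Inr \<gamma>])"
    "(t, [Inl \<gamma>, Inr \<gamma>]) \<in> paths Q" if "\<gamma> \<in> out_arcs \<Gamma> t" for \<gamma>
    using arrow_bar_mult[of "Inl \<gamma>"] path[of "Inl \<gamma>"] that by (auto simp: double_quiver_def)
  have "in": "path_mult Q (arrow Q (Inl \<gamma>)) (arrow Q (Inr \<gamma>)) = basis_vec (t, [Inr \<gamma>, Inl \<gamma>])"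
    "(t, [Inr \<gamma>, Inl \<gamma>]) \<in> paths Q" if "\<gamma> \<in> in_arcs \<Gamma> t" for \<gamma>
    using arrow_bar_mult[of "Inr \<gamma>"] path[of "Inr \<gamma>"] that by (auto simp: double_quiver_def)
  have keys: "Poly_Mapping.keys (pscale c (basis_vec p)) \<subseteq> paths Q" if "p \<in> paths Q" for c and p
    using that by (auto simp: in_keys_iff lookup_single when_def split: if_splits)
  have sum_in: "(\<Oplus>\<^bsub>A\<^esub>\<gamma>\<in>in_arcs \<Gamma> t. b \<gamma> \<odot>\<^bsub>A\<^esub> (arrow Q (Inl \<gamma>) \<otimes>\<^bsub>A\<^esub> arrow Q (Inr \<gamma>)))
      = (\<Sum>\<gamma>\<in>in_arcs \<Gamma> t. pscale (b \<gamma>) (basis_vec (t, [Inr \<gamma>, Inl \<gamma>])))"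
    by (subst finsum_path_algebra) (simp_all add: "in" keys Pi_iff)
  have sum_out: "(\<Oplus>\<^bsub>A\<^esub>\<gamma>\<in>out_arcs \<Gamma> t. a \<gamma> \<odot>\<^bsub>A\<^esub> (arrow Q (Inr \<gamma>) \<otimes>\<^bsub>A\<^esub> arrow Q (Inl \<gamma>)))
      = (\<Sum>\<gamma>\<in>out_arcs \<Gamma> t. pscale (a \<gamma>) (basis_vec (t, [Inl \<gamma>, Inr \<gamma>])))"
    by (subst finsum_path_algebra) (simp_all add: out keys Pi_iff)
  have "(\<Sum>\<gamma>\<in>in_arcs \<Gamma> t. pscale (b \<gamma>) (basis_vec (t, [Inr \<gamma>, Inl \<gamma>]))) \<in> pm.span (basis_vec ` paths Q)"
    using "in"(2) by (intro pm.span_sum pm.span_scale pm.span_base imageI)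
  then have neg: "\<ominus>\<^bsub>A\<^esub> (\<Sum>\<gamma>\<in>in_arcs \<Gamma> t. pscale (b \<gamma>) (basis_vec (t, [Inr \<gamma>, Inl \<gamma>])))
      = - (\<Sum>\<gamma>\<in>in_arcs \<Gamma> t. pscale (b \<gamma>) (basis_vec (t, [Inr \<gamma>, Inl \<gamma>])))"
    by (intro a_inv_path_algebra) (simp add: in_span_basis_vec_iff)
  show ?thesis
    unfolding mesh_def Let_def sum_in sum_out a_minus_def neg mesh_mult_def sum_out_arcs_double
    by (simp add: sum_negf)
qed

lemma mesh_sum:
  "(\<Oplus>\<^bsub>A\<^esub>t\<in>verts \<Gamma>. mesh \<Gamma> a b t) = (\<Sum>t\<in>verts \<Gamma>. mesh_mult t t [] [])"
proof -
  have "Poly_Mapping.keys (mesh_mult t t [] []) \<subseteq> paths Q" if "t \<in> verts \<Gamma>" for t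
    using that by (intro mesh_mult_keys) (simp_all add: paths_iff Q.awalk_Nil_iff)
  then show ?thesis
    by (subst finsum_path_algebra) (simp_all add: mesh_eq Pi_iff)
qed

text \<open>The ideal has the single generator \<open>\<Sum> m\<^sub>t\<close>, but multiplying by a
  path that ends at \<open>t\<close> already picks out the mesh relation at
  \<open>t\<close>.\<close>

lemma preproj_ideal_eq: "preproj_ideal \<Gamma> a b = J"
proof -
  interpret R: ring A by (rule Q.ring_path_algebra)
  define m where "m = (\<Sum>t\<in>verts \<Gamma>. mesh_mult t t [] [])"
  have Nil: "Q.awalk t [] t" "(t, []) \<in> paths Q" if "t \<in> verts \<Gamma>" for t
    using that by (simp_all add: paths_iff Q.awalk_Nil_iff)
  have mJ: "m \<in> J"
    unfolding m_def using Nil by (intro pm.subspace_sum[OF J_subspace] mesh_mult_J)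
  have "Idl\<^bsub>A\<^esub> {m} = J"
  proof
    show "Idl\<^bsub>A\<^esub> {m} \<subseteq> J"
      by (rule R.genideal_minimal[OF J_ideal]) (simp add: mJ)
    have mA: "{m} \<subseteq> carrier A" using J_paths[OF mJ] by simp
    interpret I: ideal "Idl\<^bsub>A\<^esub> {m}" A by (rule R.genideal_ideal[OF mA])
    have mI: "m \<in> Idl\<^bsub>A\<^esub> {m}" using R.genideal_self[OF mA] by simp
    show "J \<subseteq> Idl\<^bsub>A\<^esub> {m}"
      unfolding J_def
    proof (rule pm.span_minimal)
      show "pm.subspace (Idl\<^bsub>A\<^esub> {m})"
      proof (rule pm.subspaceI)
        show "0 \<in> Idl\<^bsub>A\<^esub> {m}" using I.zero_closed by simp
        show "x + y \<in> Idl\<^bsub>A\<^esub> {m}" if "x \<in> Idl\<^bsub>A\<^esub> {m}" "y \<in> Idl\<^bsub>A\<^esub> {m}" for x y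
          using I.a_closed[OF that] by simp
        fix c x assume x: "x \<in> Idl\<^bsub>A\<^esub> {m}"
        have one: "\<one>\<^bsub>A\<^esub> \<in> carrier A" by (rule R.one_closed)
        \<comment> \<open>Scaling by \<open>c\<close> is multiplication by the ring element
          \<open>c 1\<close>, so an ideal of the ring is a linear subspace.\<close>
        have "pscale c \<one>\<^bsub>A\<^esub> \<in> carrier A"
          using one by (auto simp: in_keys_iff)
        from I.I_l_closed[OF x this]
        have "path_mult Q (pscale c \<one>\<^bsub>A\<^esub>) x \<in> Idl\<^bsub>A\<^esub> {m}" by simp
        moreover have "path_mult Q (pscale c \<one>\<^bsub>A\<^esub>) x = pscale c (\<one>\<^bsub>A\<^esub> \<otimes>\<^bsub>A\<^esub> x)"
          using plin_scale[OF plin_path_mult_left] by simp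
        moreover have "\<one>\<^bsub>A\<^esub> \<otimes>\<^bsub>A\<^esub> x = x" using I.Icarr[OF x] by (rule R.l_one)
        ultimately show "pscale c x \<in> Idl\<^bsub>A\<^esub> {m}" by simp
      qed
      show "{mesh_mult t w l k | t w l k. Q.awalk w l t \<and> (t, k) \<in> paths Q} \<subseteq> Idl\<^bsub>A\<^esub> {m}"
      proof
        fix g assume "g \<in> {mesh_mult t w l k | t w l k. Q.awalk w l t \<and> (t, k) \<in> paths Q}"
        then obtain t w l k where g: "g = mesh_mult t w l k" and l: "Q.awalk w l t" and k: "(t, k) \<in> paths Q"
          by (elim CollectE exE conjE)
        have tv: "t \<in> verts \<Gamma>" using Q.awalk_last_in_verts[OF l] by simp
        have end_unique: "Q.awalk w l t' \<longleftrightarrow> t' = t" for t'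
        proof
          assume "Q.awalk w l t'"
          then have "Q.awlast w l = t'" by (rule Q.awalkE)
          moreover have "Q.awlast w l = t" using l by (rule Q.awalkE)
          ultimately show "t' = t" by simp
        qed (simp only: l)
        \<comment> \<open>The path \<open>(w, l)\<close> ends at \<open>t\<close> and at no other
          vertex, so right multiplication by it annihilates all other mesh relations.\<close>
        have "path_mult Q m (basis_vec (w, l)) = (\<Sum>t'\<in>verts \<Gamma>. if t' = t then mesh_mult t w l [] else 0)"
          unfolding m_def plin_sum[OF plin_path_mult_left] mesh_mult_mult_basis fst_conv snd_conv end_unique
          by (intro sum.cong) simp_all
        also have "\<dots> = mesh_mult t w l []" using tv by simp
        finally have "path_mult Q (basis_vec (t, k)) (path_mult Q m (basis_vec (w, l))) = mesh_mult t w l k"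
          using basis_mult_mesh_mult[OF l, of "(t, k)" "[]"] tv by (simp add: Q.awalk_Nil_iff)
        moreover have "path_mult Q m (basis_vec (w, l)) \<in> Idl\<^bsub>A\<^esub> {m}"
        proof -
          have "(w, l) \<in> paths Q" using l by (simp only: paths_iff, intro exI)
          then have "basis_vec (w, l) \<in> carrier A" by simp
          from I.I_r_closed[OF mI this] show ?thesis by simp
        qed
        moreover have "basis_vec (t, k) \<in> carrier A" using k by simp
        ultimately show "g \<in> Idl\<^bsub>A\<^esub> {m}" using I.I_l_closed[of "path_mult Q m (basis_vec (w, l))" "basis_vec (t, k)"] g
          by simp
      qed
    qed
  qed
  then show ?thesis unfolding preproj_ideal_def Let_def mesh_sum m_def .
qed

end

section \<open>The preprojective algebra as a quotient\<close>

context preprojective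
begin

abbreviation P where "P \<equiv> preproj_algebra \<Gamma> a b"
abbreviation pr where "pr \<equiv> preproj_proj \<Gamma> a b"

lemma pr_eq: "pr x = {j + x | j. j \<in> J}"
  unfolding preproj_proj_def preproj_ideal_eq a_r_coset_def' path_algebra_simps
  by (simp add: Setcompr_eq_image UNION_singleton_eq_range)

lemma pr_mem: "y \<in> pr x \<longleftrightarrow> y - x \<in> J"
proof
  assume "y \<in> pr x"
  then obtain j where "y = j + x" "j \<in> J" unfolding pr_eq by (elim CollectE exE conjE)
  then show "y - x \<in> J" by simp
next
  assume "y - x \<in> J"
  then show "y \<in> pr x"
    unfolding pr_eq by (intro CollectI exI[of _ "y - x"] conjI) simp_all
qed

lemma pr_eq_iff: "pr x = pr y \<longleftrightarrow> x - y \<in> J"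
proof
  assume "pr x = pr y"
  moreover have "x \<in> pr x" by (simp add: pr_mem pm.subspace_0[OF J_subspace])
  ultimately show "x - y \<in> J" by (simp add: pr_mem)
next
  assume xy: "x - y \<in> J"
  have eq: "z - x \<in> J \<longleftrightarrow> z - y \<in> J" for z
  proof
    assume "z - x \<in> J"
    from pm.subspace_add[OF J_subspace this xy] show "z - y \<in> J" by simp
  next
    assume "z - y \<in> J"
    from pm.subspace_diff[OF J_subspace this xy] show "z - x \<in> J" by simp
  qed
  show "pr x = pr y" by (rule Set.set_eqI) (simp only: pr_mem eq)
qed

lemma P_carrier: "carrier P = pr ` carrier A"
  unfolding preproj_algebra_def Let_def FactRing_def A_RCOSETS_def' preproj_proj_def
  by (simp add: UNION_singleton_eq_range)

lemma P_zero: "\<zero>\<^bsub>P\<^esub> = pr 0"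
  by (simp add: preproj_algebra_def Let_def FactRing_def preproj_ideal_eq pr_eq)

lemma P_add:
  assumes "x \<in> carrier A" "y \<in> carrier A"
  shows "pr x \<oplus>\<^bsub>P\<^esub> pr y = pr (x + y)"
  using ideal.a_rcos_sum[OF J_ideal assms]
  by (simp add: preproj_algebra_def Let_def FactRing_def preproj_proj_def preproj_ideal_eq)

lemma P_mult:
  assumes "x \<in> carrier A" "y \<in> carrier A"
  shows "pr x \<otimes>\<^bsub>P\<^esub> pr y = pr (path_mult Q x y)"
  using ideal.rcoset_mult_add[OF J_ideal assms]
  by (simp add: preproj_algebra_def Let_def FactRing_def preproj_proj_def preproj_ideal_eq)

lemma P_smult: "c \<odot>\<^bsub>P\<^esub> pr x = pr (pscale c x)"
proof -
  have "pr (pscale c y) = pr (pscale c x)" if "y \<in> pr x" for y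
  proof -
    have "pscale c (y - x) \<in> J" using that J_subspace by (simp add: pr_mem pm.subspace_scale)
    then show ?thesis by (simp add: pr_eq_iff pm.scale_right_diff_distrib)
  qed
  then have "(\<Union>y\<in>pr x. pr (pscale c y)) = (\<Union>y\<in>pr x. pr (pscale c x))"
    by (intro SUP_cong refl)
  moreover have "pr x \<noteq> {}"
    using pr_mem[of x x] pm.subspace_0[OF J_subspace] by (intro notI) simp
  ultimately have "(\<Union>y\<in>pr x. pr (pscale c y)) = pr (pscale c x)" by simp
  moreover have "c \<odot>\<^bsub>P\<^esub> pr x = (\<Union>y\<in>pr x. pr (pscale c y))"
    unfolding preproj_algebra_def Let_def preproj_proj_def module.select_convs path_algebra_simps ..
  ultimately show ?thesis by simp
qed

definition quo :: "('v \<times> ('e + 'e) list \<Rightarrow>\<^sub>0 'k) \<Rightarrow> ('v \<times> ('e + 'e) list \<Rightarrow>\<^sub>0 'k)" where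
  "quo = (SOME f. plin f \<and> (\<forall>j\<in>J. f j = 0) \<and> (\<forall>y. f y - y \<in> J))"

lemma quo: "plin quo" "j \<in> J \<Longrightarrow> quo j = 0" "quo y - y \<in> J"
proof -
  have "\<exists>f. plin f \<and> (\<forall>j\<in>J. f j = 0) \<and> (\<forall>y. f y - y \<in> J)"
    using complement_projection[OF J_subspace] by metis
  from someI_ex[OF this] show "plin quo" "j \<in> J \<Longrightarrow> quo j = 0" "quo y - y \<in> J"
    by (simp_all add: quo_def)
qed

lemma quo_eq_iff: "quo x = quo y \<longleftrightarrow> x - y \<in> J"
proof
  assume "quo x = quo y"
  then have "x - y = (quo y - y) - (quo x - x)" by simp
  then show "x - y \<in> J" by (simp only: pm.subspace_diff[OF J_subspace quo(3) quo(3)])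
next
  assume "x - y \<in> J"
  then show "quo x = quo y" using quo(2) plin_diff[OF quo(1), of x y] by simp
qed

lemma quo_zero_iff: "quo x = 0 \<longleftrightarrow> x \<in> J"
  using quo_eq_iff[of x 0] plin_zero[OF quo(1)] by simp

text \<open>The quotient \<open>k Q / J\<close>, embedded in \<open>k Q\<close> by means of a complement of \<open>J\<close>.\<close>

definition rep :: "('v \<times> ('e + 'e) list \<Rightarrow>\<^sub>0 'k) set \<Rightarrow> ('v \<times> ('e + 'e) list \<Rightarrow>\<^sub>0 'k)" where
  "rep X = quo (SOME x. x \<in> X)"

lemma rep_pr [simp]: "rep (pr x) = quo x"
proof -
  have "x \<in> pr x" by (simp add: pr_mem pm.subspace_0[OF J_subspace])
  then have "(SOME y. y \<in> pr x) \<in> pr x" by (rule someI)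
  then show ?thesis unfolding rep_def quo_eq_iff pr_mem .
qed

lemma add_A: "x \<in> carrier A \<Longrightarrow> y \<in> carrier A \<Longrightarrow> x + y \<in> carrier A"
  by (simp add: keys_add_subset)

lemma pscale_A: "x \<in> carrier A \<Longrightarrow> pscale c x \<in> carrier A"
  by (auto simp: in_keys_iff subset_iff)

lemma vectorspace_P: "vectorspace class_ring P"
proof (rule vs_criteria)
  show "\<forall>v w. v \<in> carrier P \<and> w \<in> carrier P \<longrightarrow> v \<oplus>\<^bsub>P\<^esub> w \<in> carrier P"
    unfolding P_carrier by (auto simp: P_add simp del: path_algebra_simps intro!: imageI add_A)
  show "\<forall>v\<in>carrier P. \<exists>neg_v\<in>carrier P. v \<oplus>\<^bsub>P\<^esub> neg_v = \<zero>\<^bsub>P\<^esub>"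
    unfolding P_carrier ball_simps
  proof
    fix x assume x: "x \<in> carrier A"
    have m: "pscale (- 1) x \<in> carrier A" by (rule pscale_A[OF x])
    have "pr x \<oplus>\<^bsub>P\<^esub> pr (pscale (- 1) x) = \<zero>\<^bsub>P\<^esub>"
      unfolding P_add[OF x m] P_zero by simp
    then show "\<exists>neg_v\<in>pr ` carrier A. pr x \<oplus>\<^bsub>P\<^esub> neg_v = \<zero>\<^bsub>P\<^esub>"
      by (rule bexI) (rule imageI[OF m])
  qed
  show "\<forall>c v. c \<in> carrier class_ring \<and> v \<in> carrier P \<longrightarrow> c \<odot>\<^bsub>P\<^esub> v \<in> carrier P"
    unfolding P_carrier by (auto simp: P_smult simp del: path_algebra_simps intro!: imageI pscale_A)
  show "\<forall>v\<in>carrier P. v \<oplus>\<^bsub>P\<^esub> \<zero>\<^bsub>P\<^esub> = v"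
    unfolding P_carrier P_zero
  proof (rule ballI, elim imageE)
    fix v x assume "v = pr x" "x \<in> carrier A"
    then show "v \<oplus>\<^bsub>P\<^esub> pr 0 = v" using P_add[of x 0] by simp
  qed
  show "\<zero>\<^bsub>P\<^esub> \<in> carrier P" unfolding P_carrier P_zero by (rule imageI) simp
qed (use class_field in \<open>auto simp: P_carrier P_zero P_add P_smult add_A pscale_A pm.scale_left_distrib
      pm.scale_right_distrib add_ac simp del: path_algebra_simps(1)\<close>)

sublocale E: embedded_space pscale P rep
proof -
  interpret vectorspace class_ring P by (rule vectorspace_P)
  show "embedded_space pscale P rep"
  proof
    show "inj_on rep (carrier P)"
      unfolding P_carrier by (rule inj_onI, elim imageE) (simp add: quo_eq_iff pr_eq_iff)
    show "rep (u \<oplus>\<^bsub>P\<^esub> v) = rep u + rep v" if "u \<in> carrier P" "v \<in> carrier P" for u v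
      using that by (auto simp: P_carrier P_add plin_add[OF quo(1)] simp del: path_algebra_simps(1))
    show "rep (c \<odot>\<^bsub>P\<^esub> v) = pscale c (rep v)" if "v \<in> carrier P" for c v
      using that by (auto simp: P_carrier P_smult plin_scale[OF quo(1)])
  qed
qed

definition R :: "'e + 'e \<Rightarrow> ('v \<times> ('e + 'e) list \<Rightarrow>\<^sub>0 'k) \<Rightarrow> ('v \<times> ('e + 'e) list \<Rightarrow>\<^sub>0 'k)" where
  "R x y = quo (path_mult Q y (arrow Q x))"

lemma R_lin: "plin (R x)"
  unfolding R_def by (rule plin_compose[OF quo(1) plin_path_mult_left])

text \<open>Right multiplication by an arrow maps \<open>J\<close> into itself, so the result does
  not depend on the representative.\<close>

lemma R_quo: "R x (quo z) = quo (path_mult Q z (arrow Q x))"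
proof -
  have "path_mult Q (quo z) (arrow Q x) - path_mult Q z (arrow Q x) = path_mult Q (quo z - z) (arrow Q x)"
    by (simp add: plin_diff[OF plin_path_mult_left])
  then show ?thesis unfolding R_def quo_eq_iff using J_mult_right[OF quo(3)] by simp
qed

lemma arrow_A: "x \<in> arcs Q \<Longrightarrow> arrow Q x \<in> carrier A"
  using Q.head_in_verts[of x] by (simp add: arrow_eq paths_iff Q.awalk_Cons_iff Q.awalk_Nil_iff)

lemma rep_mult_arrow:
  assumes "X \<in> carrier P" "x \<in> arcs Q"
  shows "rep (X \<otimes>\<^bsub>P\<^esub> (c \<odot>\<^bsub>P\<^esub> pr (arrow Q x))) = pscale c (R x (rep X))"
    and "X \<otimes>\<^bsub>P\<^esub> (c \<odot>\<^bsub>P\<^esub> pr (arrow Q x)) \<in> carrier P"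
    and "rep (X \<otimes>\<^bsub>P\<^esub> pr (arrow Q x)) = R x (rep X)"
    and "X \<otimes>\<^bsub>P\<^esub> pr (arrow Q x) \<in> carrier P"
proof -
  obtain z where z: "z \<in> carrier A" "X = pr z" using assms(1) by (auto simp: P_carrier)
  have x: "arrow Q x \<in> carrier A" by (rule arrow_A[OF assms(2)])
  have xc: "pscale c (arrow Q x) \<in> carrier A" by (rule pscale_A[OF x])
  have in_A: "path_mult Q z y \<in> carrier A" if "y \<in> carrier A" for y
    using Q.path_mult_paths[of z y] z(1) that by simp
  show "rep (X \<otimes>\<^bsub>P\<^esub> (c \<odot>\<^bsub>P\<^esub> pr (arrow Q x))) = pscale c (R x (rep X))"
    unfolding z(2) P_smult P_mult[OF z(1) xc] rep_pr R_quo
    by (simp add: plin_scale[OF plin_path_mult_right] plin_scale[OF quo(1)])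
  show "X \<otimes>\<^bsub>P\<^esub> (c \<odot>\<^bsub>P\<^esub> pr (arrow Q x)) \<in> carrier P"
    unfolding z(2) P_smult P_mult[OF z(1) xc] P_carrier by (rule imageI[OF in_A[OF xc]])
  show "rep (X \<otimes>\<^bsub>P\<^esub> pr (arrow Q x)) = R x (rep X)"
    unfolding z(2) P_mult[OF z(1) x] rep_pr R_quo ..
  show "X \<otimes>\<^bsub>P\<^esub> pr (arrow Q x) \<in> carrier P"
    unfolding z(2) P_mult[OF z(1) x] P_carrier by (rule imageI[OF in_A[OF x]])
qed

section \<open>Graded pieces and right multiplication by arrows\<close>

definition paths_from :: "'v \<Rightarrow> int \<Rightarrow> ('v \<times> ('e + 'e) list) set" where
  "paths_from t c = {p \<in> paths Q. fst p = t \<and> path_degree p = c}"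

definition kQ :: "'v \<times> int \<Rightarrow> ('v \<times> ('e + 'e) list \<Rightarrow>\<^sub>0 'k) set" where
  "kQ i = pm.span (basis_vec ` paths_from (fst i) (snd i))"

definition W :: "'v \<times> int \<Rightarrow> ('v \<times> ('e + 'e) list \<Rightarrow>\<^sub>0 'k) set" where
  "W i = quo ` kQ i"

lemma kQ_subspace: "pm.subspace (kQ i)"
  unfolding kQ_def by (rule pm.subspace_span)

lemma W_subspace: "pm.subspace (W i)"
proof (rule pm.subspaceI)
  show "0 \<in> W i" unfolding W_def
    by (rule image_eqI[of _ _ 0]) (simp_all add: plin_zero[OF quo(1)] pm.subspace_0[OF kQ_subspace])
  show "u + v \<in> W i" if "u \<in> W i" "v \<in> W i" for u v
    using that unfolding W_def
    by (elim imageE) (simp add: plin_add[OF quo(1), symmetric] imageI pm.subspace_add[OF kQ_subspace])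
  show "pscale c u \<in> W i" if "u \<in> W i" for c u
    using that unfolding W_def
    by (elim imageE) (simp add: plin_scale[OF quo(1), symmetric] imageI pm.subspace_scale[OF kQ_subspace])
qed

lemma kQ_induct:
  assumes "plin f" "pm.subspace T" "z \<in> kQ (t, c)" "\<And>l. (t, l) \<in> paths_from t c \<Longrightarrow> f (basis_vec (t, l)) \<in> T"
  shows "f z \<in> T"
proof (rule plin_span_subspace[OF assms(1) _ assms(2)])
  show "z \<in> pm.span (basis_vec ` paths_from t c)" using assms(3) by (simp add: kQ_def)
  fix s :: "'v \<times> ('e + 'e) list \<Rightarrow>\<^sub>0 'k" assume "s \<in> basis_vec ` paths_from t c"
  then obtain p where p: "p \<in> paths_from t c" "s = basis_vec p" by (elim imageE)
  have "p = (t, snd p)" using p(1) by (simp add: paths_from_def prod_eq_iff)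
  with p assms(4)[of "snd p"] show "f s \<in> T" by simp
qed

lemma paths_from_Cons:
  assumes "x \<in> arcs Q"
  shows "(tail Q x, x # l) \<in> paths_from (tail Q x) c \<longleftrightarrow> (head Q x, l) \<in> paths_from (head Q x) (c - dbl_shift x)"
  using assms by (cases x) (auto simp: paths_from_def paths_iff Q.awalk_Cons_iff path_degree_def)

lemma basis_mult_arrow:
  assumes "x \<in> arcs Q"
  shows "path_mult Q (basis_vec (head Q x, l)) (arrow Q x) = (basis_vec (tail Q x, x # l) :: _ \<Rightarrow>\<^sub>0 'k)"
  using assms Q.head_in_verts[OF assms]
  by (simp add: arrow_eq path_comp_def Q.awalk_Cons_iff Q.awalk_Nil_iff)

lemma kQ_mult_arrow:
  assumes "x \<in> arcs Q" "z \<in> kQ (head Q x, c)"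
  shows "path_mult Q z (arrow Q x) \<in> kQ (tail Q x, c + dbl_shift x)"
proof (rule kQ_induct[OF plin_path_mult_left kQ_subspace assms(2)])
  fix l assume "(head Q x, l) \<in> paths_from (head Q x) c"
  then have "(tail Q x, x # l) \<in> paths_from (tail Q x) (c + dbl_shift x)"
    using paths_from_Cons[OF assms(1)] by simp
  then show "path_mult Q (basis_vec (head Q x, l)) (arrow Q x) \<in> kQ (tail Q x, c + dbl_shift x)"
    unfolding basis_mult_arrow[OF assms(1)] kQ_def by (intro pm.span_base imageI) simp
qed

lemma R_W:
  assumes "x \<in> arcs Q" "v \<in> W (head Q x, c)"
  shows "R x v \<in> W (tail Q x, c + dbl_shift x)"
proof -
  obtain z where "z \<in> kQ (head Q x, c)" "v = quo z" using assms(2) by (auto simp: W_def)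
  then show ?thesis unfolding W_def using kQ_mult_arrow[OF assms(1)] by (simp add: R_quo)
qed

lemma W_neg:
  assumes "c < 0"
  shows "W (t, c) = {0}"
proof -
  have "paths_from t c = {}" using assms by (auto simp: paths_from_def path_degree_def)
  then show ?thesis by (simp add: W_def kQ_def plin_zero[OF quo(1)])
qed

text \<open>Right multiplication by an arrow prepends it to the list of arrows. Hence the composite
  of the two maps of the mesh sequence multiplies a path starting at \<open>t\<close> by the mesh
  relation at \<open>t\<close>.\<close>

lemma mesh_mult_via_arrows:
  "(\<Sum>x\<in>out_arcs Q t. pscale (eps x) (path_mult Q (path_mult Q (basis_vec (t, l)) (arrow Q (dbl_bar x))) (arrow Q x)))
    = mesh_mult t t [] l"
  unfolding mesh_mult_def
proof (rule sum.cong[OF refl])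
  fix x assume x: "x \<in> out_arcs Q t"
  then have "path_mult Q (basis_vec (t, l)) (arrow Q (dbl_bar x)) = (basis_vec (head Q x, dbl_bar x # l) :: _ \<Rightarrow>\<^sub>0 'k)"
    using basis_mult_arrow[of "dbl_bar x" l] by simp
  then show "pscale (eps x) (path_mult Q (path_mult Q (basis_vec (t, l)) (arrow Q (dbl_bar x))) (arrow Q x))
      = pscale (eps x) (basis_vec (t, [] @ [x, dbl_bar x] @ l))"
    using basis_mult_arrow[of x "dbl_bar x # l"] x by simp
qed

lemma mesh_zero:
  assumes "t \<in> verts \<Gamma>" "v \<in> W (t, c)"
  shows "(\<Sum>x\<in>out_arcs Q t. pscale (eps x) (R x (R (dbl_bar x) v))) = 0"
proof -
  obtain z where z: "z \<in> kQ (t, c)" "v = quo z" using assms(2) by (auto simp: W_def)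
  define f where "f = (\<lambda>z. \<Sum>x\<in>out_arcs Q t. pscale (eps x)
    (path_mult Q (path_mult Q z (arrow Q (dbl_bar x))) (arrow Q x)))"
  have "plin f"
    unfolding f_def by (intro plin_sum_fun plin_pscale plin_compose[OF plin_path_mult_left plin_path_mult_left])
  then have "f z \<in> J"
  proof (rule kQ_induct[OF _ J_subspace z(1)])
    fix l assume "(t, l) \<in> paths_from t c"
    then have "(t, l) \<in> paths Q" by (simp add: paths_from_def)
    then show "f (basis_vec (t, l)) \<in> J"
      unfolding f_def mesh_mult_via_arrows using assms(1) by (intro mesh_mult_J) (simp_all add: Q.awalk_Nil_iff)
  qed
  then have "quo (f z) = 0" by (rule quo(2))
  then show ?thesis
    by (simp add: f_def z(2) R_quo plin_sum[OF quo(1)] plin_scale[OF quo(1)])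
qed

text \<open>Splitting off the first arrow of a path inverts the right multiplication by this arrow.\<close>

definition peel :: "'e + 'e \<Rightarrow> ('v \<times> ('e + 'e) list \<Rightarrow>\<^sub>0 'k) \<Rightarrow> ('v \<times> ('e + 'e) list \<Rightarrow>\<^sub>0 'k)" where
  "peel x = pext (\<lambda>(u, l). case l of [] \<Rightarrow> 0 | y # l' \<Rightarrow>
     if y = x \<and> u = tail Q x then basis_vec (head Q x, l') else 0)"

lemma plin_peel: "plin (peel x)"
  unfolding peel_def by (rule plin_pext)

lemma peel_Nil [simp]: "peel x (basis_vec (u, [])) = 0"
  and peel_Cons [simp]: "peel x (basis_vec (u, y # l)) =
    (if y = x \<and> u = tail Q x then basis_vec (head Q x, l) else 0)"
  by (simp_all add: peel_def)

lemma peel_mult_arrow: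
  assumes "x' \<in> arcs Q" "z \<in> kQ (head Q x', c)"
  shows "peel x (path_mult Q z (arrow Q x')) = (if x = x' then z else 0)"
proof -
  let ?f = "\<lambda>z. peel x (path_mult Q z (arrow Q x')) - (if x = x' then z else 0)"
  have "plin ?f"
    by (cases "x = x'") (simp_all add: plin_minus_fun plin_compose[OF plin_peel plin_path_mult_left] plin_id)
  then have "?f z \<in> {0}"
    by (rule kQ_induct[OF _ pm.subspace_single_0 assms(2)]) (simp add: basis_mult_arrow[OF assms(1)])
  then show ?thesis by simp
qed

text \<open>Projection onto one component of the grading by starting vertex and degree; it makes a
  congruence modulo \<open>J\<close> homogeneous.\<close>

definition keep :: "'v \<times> int \<Rightarrow> ('v \<times> ('e + 'e) list \<Rightarrow>\<^sub>0 'k) \<Rightarrow> ('v \<times> ('e + 'e) list \<Rightarrow>\<^sub>0 'k)" where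
  "keep i = pext (\<lambda>p. if fst p = fst i \<and> path_degree p = snd i then basis_vec p else 0)"

lemma plin_keep: "plin (keep i)"
  unfolding keep_def by (rule plin_pext)

lemma keep_basis_vec [simp]:
  "keep i (basis_vec p) = (if fst p = fst i \<and> path_degree p = snd i then basis_vec p else 0)"
  by (simp add: keep_def)

lemma keep_kQ:
  assumes "z \<in> kQ (t, c)"
  shows "keep (t, c) z = z"
proof -
  have "keep (t, c) z - z \<in> {0}"
    by (rule kQ_induct[OF plin_minus_fun[OF plin_keep plin_id] pm.subspace_single_0 assms])
      (simp add: paths_from_def)
  then show ?thesis by simp
qed

lemma path_degree_insert: "path_degree (w, l @ [x, dbl_bar x] @ k) = path_degree (w, l) + path_degree (w, k) + 1"
  by (cases x) (simp_all add: path_degree_def)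

text \<open>All terms of a generator of \<open>J\<close> start at the same vertex and, having
  exactly one reversed arrow in the inserted pair, have the same degree. So a generator is kept or
  killed as a whole.\<close>

lemma keep_J:
  assumes "j \<in> J"
  shows "keep i j \<in> J"
proof (rule J_induct[OF plin_keep J_subspace assms])
  fix t w l k assume *: "Q.awalk w l t" "(t, k) \<in> paths Q"
  define C where "C \<longleftrightarrow> w = fst i \<and> path_degree (w, l) + path_degree (w, k) + 1 = snd i"
  have "keep i (basis_vec (w, l @ [x, dbl_bar x] @ k)) = (if C then basis_vec (w, l @ [x, dbl_bar x] @ k) else 0)" for x
    by (simp only: keep_basis_vec path_degree_insert fst_conv C_def)
  then have "keep i (mesh_mult t w l k) = (if C then mesh_mult t w l k else 0)"
    unfolding mesh_mult_def plin_sum[OF plin_keep] plin_scale[OF plin_keep] by (cases C) simp_all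
  then show "keep i (mesh_mult t w l k) \<in> J"
    using mesh_mult_J[OF *] pm.subspace_0[OF J_subspace] by (cases C) simp_all
qed

lemma keep_mult_arrow:
  assumes "x \<in> arcs Q" "Poly_Mapping.keys y \<subseteq> {p \<in> paths Q. fst p = head Q x}"
  shows "keep (tail Q x, c) (path_mult Q y (arrow Q x)) = path_mult Q (keep (head Q x, c - dbl_shift x) y) (arrow Q x)"
proof (rule plin_eqI[OF plin_compose[OF plin_keep plin_path_mult_left] plin_compose[OF plin_path_mult_left plin_keep]])
  fix p assume "p \<in> Poly_Mapping.keys y"
  then have "p \<in> paths Q" "fst p = head Q x" using assms(2) by auto
  then obtain l where p: "p = (head Q x, l)" by (cases p) simp
  have "path_degree (tail Q x, x # l) = c \<longleftrightarrow> path_degree (head Q x, l) = c - dbl_shift x"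
    by (cases x) (auto simp: path_degree_def)
  then show "keep (tail Q x, c) (path_mult Q (basis_vec p) (arrow Q x))
      = path_mult Q (keep (head Q x, c - dbl_shift x) (basis_vec p)) (arrow Q x)"
    unfolding p basis_mult_arrow[OF assms(1)] by (simp add: basis_mult_arrow[OF assms(1)] del: path_mult_basis_vec)
qed

text \<open>
  Modulo \<open>J\<close>, an element of \<open>J e\<^sub>t\<close> is a left multiple of the mesh relation at \<open>t\<close>: the generators of
  \<open>J\<close> with a non-trivial right factor \<open>q = q' x\<close> peel to generators of \<open>J\<close>.
\<close>

lemma peel_J:
  assumes "j \<in> J"
  shows "\<exists>y. Poly_Mapping.keys y \<subseteq> {p \<in> paths Q. fst p = t} \<and>
    (\<forall>x\<in>out_arcs Q t. peel x j - pscale (eps x) (path_mult Q y (arrow Q (dbl_bar x))) \<in> J)"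
proof -
  define T where "T = {j. \<exists>y. y \<in> pm.span (basis_vec ` {p \<in> paths Q. fst p = t}) \<and>
    (\<forall>x\<in>out_arcs Q t. peel x j - pscale (eps x) (path_mult Q y (arrow Q (dbl_bar x))) \<in> J)}"
  have "pm.subspace T"
  proof (rule pm.subspaceI)
    show "0 \<in> T"
      unfolding T_def
      by (rule CollectI, rule exI[of _ 0])
        (simp add: plin_zero[OF plin_peel] pm.span_zero pm.subspace_0[OF J_subspace])
  next
    fix j j' assume "j \<in> T" "j' \<in> T"
    then obtain y y' where y: "y \<in> pm.span (basis_vec ` {p \<in> paths Q. fst p = t})"
        "\<And>x. x \<in> out_arcs Q t \<Longrightarrow> peel x j - pscale (eps x) (path_mult Q y (arrow Q (dbl_bar x))) \<in> J"
        "y' \<in> pm.span (basis_vec ` {p \<in> paths Q. fst p = t})"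
        "\<And>x. x \<in> out_arcs Q t \<Longrightarrow> peel x j' - pscale (eps x) (path_mult Q y' (arrow Q (dbl_bar x))) \<in> J"
      unfolding T_def by auto
    have "peel x (j + j') - pscale (eps x) (path_mult Q (y + y') (arrow Q (dbl_bar x))) \<in> J"
      if x: "x \<in> out_arcs Q t" for x
      using pm.subspace_add[OF J_subspace y(2)[OF x] y(4)[OF x]]
      by (simp add: plin_add[OF plin_peel] plin_add[OF plin_path_mult_left] pm.scale_right_distrib algebra_simps)
    then show "j + j' \<in> T" unfolding T_def using pm.span_add[OF y(1,3)] by blast
  next
    fix c j assume "j \<in> T"
    then obtain y where y: "y \<in> pm.span (basis_vec ` {p \<in> paths Q. fst p = t})"
        "\<And>x. x \<in> out_arcs Q t \<Longrightarrow> peel x j - pscale (eps x) (path_mult Q y (arrow Q (dbl_bar x))) \<in> J"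
      unfolding T_def by auto
    have "peel x (pscale c j) - pscale (eps x) (path_mult Q (pscale c y) (arrow Q (dbl_bar x))) \<in> J"
      if x: "x \<in> out_arcs Q t" for x
      using pm.subspace_scale[OF J_subspace y(2)[OF x], of c]
      by (simp add: plin_scale[OF plin_peel] plin_scale[OF plin_path_mult_left] pm.scale_right_diff_distrib mult.commute)
    then show "pscale c j \<in> T" unfolding T_def using pm.span_scale[OF y(1)] by blast
  qed
  moreover have "mesh_mult t' w l k \<in> T" if w: "Q.awalk w l t'" and k: "(t', k) \<in> paths Q" for t' w l k
  proof (cases l)
    case Nil
    then have wt: "w = t'" using w by (simp add: Q.awalk_Nil_iff)
    show ?thesis
    proof (cases "t' = t")
      \<comment> \<open>The relation stands at the very beginning of the walk. Removing
        \<open>x\<close> leaves \<open>dbl_bar x\<close> followed by \<open>k\<close>, with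
        coefficient \<open>eps x\<close>, so \<open>y\<close> is the path
        \<open>(t, k)\<close>.\<close>
      case True
      have "peel x (mesh_mult t t [] k) = pscale (eps x) (path_mult Q (basis_vec (t, k)) (arrow Q (dbl_bar x)))"
        if x: "x \<in> out_arcs Q t" for x
      proof -
        have "peel x (mesh_mult t t [] k) =
            (\<Sum>x'\<in>out_arcs Q t. if x' = x then pscale (eps x) (basis_vec (head Q x, dbl_bar x # k)) else 0)"
          unfolding mesh_mult_def plin_sum[OF plin_peel] plin_scale[OF plin_peel]
          using x by (intro sum.cong) auto
        also have "\<dots> = pscale (eps x) (basis_vec (head Q x, dbl_bar x # k))"
          using x Q.finite_out_arcs[of t] by simp
        also have "(basis_vec (head Q x, dbl_bar x # k) :: _ \<Rightarrow>\<^sub>0 'k) = path_mult Q (basis_vec (t, k)) (arrow Q (dbl_bar x))"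
          using basis_mult_arrow[of "dbl_bar x" k] x by simp
        finally show ?thesis .
      qed
      moreover have "basis_vec (t, k) \<in> pm.span (basis_vec ` {p \<in> paths Q. fst p = t})"
        using k True by (intro pm.span_base imageI) simp
      ultimately show ?thesis
        unfolding T_def True wt Nil
        by (intro CollectI exI[of _ "basis_vec (t, k)"]) (simp add: pm.subspace_0[OF J_subspace])
    next
      case False
      have "peel x (mesh_mult t' w l k) = 0" if "x \<in> out_arcs Q t" for x
        unfolding mesh_mult_def plin_sum[OF plin_peel] plin_scale[OF plin_peel]
        using that False wt Nil by (intro sum.neutral) simp
      then show ?thesis
        unfolding T_def by (intro CollectI exI[of _ 0]) (simp add: pm.span_zero pm.subspace_0[OF J_subspace])
    qed
  next
    \<comment> \<open>Here peeling only shortens \<open>l\<close>, which gives zero or another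
      generator of \<open>J\<close>; so \<open>y = 0\<close> works.\<close>
    case (Cons z l')
    have "peel x (mesh_mult t' w l k) \<in> J" if "x \<in> out_arcs Q t" for x
    proof -
      have "Q.awalk (head Q z) l' t'" using w Cons by (simp add: Q.awalk_Cons_iff)
      then have "mesh_mult t' (head Q z) l' k \<in> J" using k by (rule mesh_mult_J)
      moreover define C where "C \<longleftrightarrow> z = x \<and> w = tail Q x"
      have "peel x (basis_vec (w, l @ m)) = (if C then basis_vec (head Q z, l' @ m) else 0)" for m
        unfolding C_def Cons append_Cons peel_Cons by (cases "z = x") simp_all
      then have "peel x (mesh_mult t' w l k) = (if C then mesh_mult t' (head Q z) l' k else 0)"
        unfolding mesh_mult_def plin_sum[OF plin_peel] plin_scale[OF plin_peel] by (cases C) simp_all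
      ultimately show ?thesis using pm.subspace_0[OF J_subspace] by (cases C) simp_all
    qed
    then show ?thesis
      unfolding T_def by (intro CollectI exI[of _ 0]) (simp add: pm.span_zero)
  qed
  ultimately have "j \<in> T" by (rule J_induct[OF plin_id _ assms])
  then show ?thesis unfolding T_def in_span_basis_vec_iff by simp
qed

lemma sum_mult_arrow_peel:
  assumes "x \<in> out_arcs Q t" "\<And>x. x \<in> out_arcs Q t \<Longrightarrow> z x \<in> kQ (head Q x, c x)"
  shows "peel x (\<Sum>x'\<in>out_arcs Q t. pscale (eps x') (path_mult Q (z x') (arrow Q x'))) = pscale (eps x) (z x)"
proof -
  have "peel x (\<Sum>x'\<in>out_arcs Q t. pscale (eps x') (path_mult Q (z x') (arrow Q x')))
      = (\<Sum>x'\<in>out_arcs Q t. if x' = x then pscale (eps x) (z x) else 0)"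
    unfolding plin_sum[OF plin_peel] plin_scale[OF plin_peel]
  proof (rule sum.cong[OF refl])
    fix x' assume x': "x' \<in> out_arcs Q t"
    then have "x' \<in> arcs Q" by simp
    from peel_mult_arrow[OF this assms(2)[OF x']]
    show "pscale (eps x') (peel x (path_mult Q (z x') (arrow Q x'))) = (if x' = x then pscale (eps x) (z x) else 0)"
      by auto
  qed
  then show ?thesis using assms(1) Q.finite_out_arcs[of t] by simp
qed

end

section \<open>Acyclic quivers: finiteness and exactness of the mesh sequences\<close>

locale preprojective_acyclic = preprojective \<Gamma> a b
  for \<Gamma> :: "('v, 'e) pre_digraph" and a b :: "'e \<Rightarrow> 'k::field" +
  assumes acyc: "\<nexists>c. pre_digraph.cycle \<Gamma> c"
    and a_nz: "\<gamma> \<in> arcs \<Gamma> \<Longrightarrow> a \<gamma> \<noteq> 0"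
    and b_nz: "\<gamma> \<in> arcs \<Gamma> \<Longrightarrow> b \<gamma> \<noteq> 0"
begin

lemma eps_nz: "x \<in> arcs Q \<Longrightarrow> eps x \<noteq> 0"
  by (cases x) (auto simp: double_quiver_def a_nz b_nz)

definition reach :: "('v \<times> 'v) set" where
  "reach = {(tail \<Gamma> \<gamma>, head \<Gamma> \<gamma>) | \<gamma>. \<gamma> \<in> arcs \<Gamma>}\<^sup>+"

lemma reach_walk:
  assumes "(u, v) \<in> reach"
  shows "\<exists>p. p \<noteq> [] \<and> awalk u p v"
  using assms unfolding reach_def
proof (induction rule: trancl_induct)
  case (base v)
  then obtain \<gamma> where "\<gamma> \<in> arcs \<Gamma>" "u = tail \<Gamma> \<gamma>" "v = head \<Gamma> \<gamma>" by blast
  then have "awalk u [\<gamma>] v" by (simp add: awalk_Cons_iff awalk_Nil_iff)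
  then show ?case by (intro exI[of _ "[\<gamma>]"]) simp
next
  case (step v w)
  then obtain p where p: "p \<noteq> []" "awalk u p v" by (elim exE conjE)
  from step obtain \<gamma> where "\<gamma> \<in> arcs \<Gamma>" "v = tail \<Gamma> \<gamma>" "w = head \<Gamma> \<gamma>" by blast
  then have "awalk v [\<gamma>] w" by (simp add: awalk_Cons_iff awalk_Nil_iff)
  then have "awalk u (p @ [\<gamma>]) w" by (simp only: awalk_append_iff_awalk[OF p(2)])
  then show ?case by (intro exI[of _ "p @ [\<gamma>]"]) simp
qed

lemma reach_irrefl: "(u, u) \<notin> reach"
proof
  assume "(u, u) \<in> reach"
  from reach_walk[OF this] obtain p where "p \<noteq> []" "awalk u p u" by (elim exE conjE)
  then have "closed_w p" unfolding closed_w_def by (intro exI[of _ u]) simp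
  from closed_w_imp_cycle[OF this] acyc show False by simp
qed

text \<open>The number of proper predecessors. Without oriented cycles \<open>u\<close> is not its
  own predecessor, which makes the number grow strictly along arrows.\<close>

definition rk :: "'v \<Rightarrow> nat" where
  "rk u = card {w. (w, u) \<in> reach}"

lemma reach_verts: "{w. (w, u) \<in> reach} \<subseteq> verts \<Gamma>"
proof
  fix w assume "w \<in> {w. (w, u) \<in> reach}"
  then obtain p where "awalk w p u" using reach_walk[of w u] by auto
  then show "w \<in> verts \<Gamma>" by (simp add: awalk_def)
qed

lemma rk_less:
  assumes "\<gamma> \<in> arcs \<Gamma>"
  shows "rk (tail \<Gamma> \<gamma>) < rk (head \<Gamma> \<gamma>)"
proof -
  have e: "(tail \<Gamma> \<gamma>, head \<Gamma> \<gamma>) \<in> reach" unfolding reach_def using assms by blast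
  have "{w. (w, tail \<Gamma> \<gamma>) \<in> reach} \<subset> {w. (w, head \<Gamma> \<gamma>) \<in> reach}"
    using e reach_irrefl trancl_trans[of _ "tail \<Gamma> \<gamma>" _ "head \<Gamma> \<gamma>"] unfolding reach_def by blast
  then show ?thesis unfolding rk_def
    by (intro psubset_card_mono finite_subset[OF reach_verts]) simp_all
qed

text \<open>An arrow of \<open>\<Gamma>\<close> raises \<open>rk\<close> by at least 1, and a
  reversed arrow lowers it by at most the number of vertices. So the degree limits the number of
  steps, and with it the dimension of the graded pieces.\<close>

lemma path_length_bound:
  assumes "Q.awalk u p v"
  shows "int (length p) + int (rk u) \<le> int (rk v) + (int (card (verts \<Gamma>)) + 1) * path_degree (u, p)"
  using assms
proof (induction p arbitrary: u)
  case Nil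
  then show ?case by (simp add: Q.awalk_Nil_iff path_degree_def)
next
  case (Cons x p)
  then have x: "x \<in> arcs Q" "u = tail Q x" "Q.awalk (head Q x) p v" by (simp_all add: Q.awalk_Cons_iff)
  have IH: "int (length p) + int (rk (head Q x)) \<le>
      int (rk v) + (int (card (verts \<Gamma>)) + 1) * path_degree (head Q x, p)"
    by (rule Cons.IH[OF x(3)])
  show ?case
  proof (cases x)
    case (Inl \<gamma>)
    then show ?thesis using IH rk_less[of \<gamma>] x by (auto simp: double_quiver_def path_degree_def)
  next
    case (Inr \<gamma>)
    have "rk u \<le> card (verts \<Gamma>)" unfolding rk_def by (rule card_mono[OF _ reach_verts]) simp
    then show ?thesis using IH Inr x by (auto simp: path_degree_def algebra_simps)
  qed
qed

lemma finite_paths_from: "finite (paths_from t c)"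
proof (rule finite_subset)
  let ?n = "nat (int (card (verts \<Gamma>)) + (int (card (verts \<Gamma>)) + 1) * c)"
  show "paths_from t c \<subseteq> {t} \<times> {l. set l \<subseteq> arcs Q \<and> length l \<le> ?n}"
  proof
    fix p assume p: "p \<in> paths_from t c"
    then obtain l where l: "p = (t, l)" "(t, l) \<in> paths Q" "path_degree (t, l) = c"
      by (cases p) (simp add: paths_from_def)
    then obtain v where v: "Q.awalk t l v" unfolding paths_iff by (elim exE)
    have "rk v \<le> card (verts \<Gamma>)" unfolding rk_def by (rule card_mono[OF _ reach_verts]) simp
    then have "length l \<le> ?n" using path_length_bound[OF v] l(3) by simp
    moreover have "set l \<subseteq> arcs Q" using v by (simp add: Q.awalk_def)
    ultimately show "p \<in> {t} \<times> {l. set l \<subseteq> arcs Q \<and> length l \<le> ?n}" using l by simp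
  qed
  show "finite ({t} \<times> {l. set l \<subseteq> arcs Q \<and> length l \<le> ?n})"
    by (intro finite_cartesian_product finite_lists_length_le) simp_all
qed

text \<open>Lifting the \<open>n x\<close> to elements \<open>z x\<close> of the path algebra gives
  an element \<open>j\<close> of \<open>J\<close>. Peeling \<open>x\<close> off \<open>j\<close>
  returns \<open>eps x\<close> times \<open>z x\<close>, while \<open>peel_J\<close> says that this
  is a left multiple of the reversed arrow, with one factor \<open>y\<close> common to all
  \<open>x\<close>.\<close>

lemma mesh_exact:
  assumes t: "t \<in> verts \<Gamma>"
    and n: "\<And>x. x \<in> out_arcs Q t \<Longrightarrow> n x \<in> W (head Q x, c - dbl_shift x)"
    and zero: "(\<Sum>x\<in>out_arcs Q t. pscale (eps x) (R x (n x))) = 0"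
  shows "\<exists>v\<in>W (t, c - 1). \<forall>x\<in>out_arcs Q t. n x = R (dbl_bar x) v"
proof -
  have "\<forall>x\<in>out_arcs Q t. \<exists>z. z \<in> kQ (head Q x, c - dbl_shift x) \<and> n x = quo z"
    using n unfolding W_def by (simp add: image_iff Bex_def)
  from bchoice[OF this] obtain z where
    z': "\<forall>x\<in>out_arcs Q t. z x \<in> kQ (head Q x, c - dbl_shift x) \<and> n x = quo (z x)" by (elim exE)
  have z: "z x \<in> kQ (head Q x, c - dbl_shift x)" "n x = quo (z x)" if "x \<in> out_arcs Q t" for x
    using bspec[OF z' that] by simp_all
  define j where "j = (\<Sum>x\<in>out_arcs Q t. pscale (eps x) (path_mult Q (z x) (arrow Q x)))"
  have "quo j = (\<Sum>x\<in>out_arcs Q t. pscale (eps x) (R x (n x)))"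
    unfolding j_def plin_sum[OF quo(1)] plin_scale[OF quo(1)] R_quo[symmetric]
    by (rule sum.cong[OF refl]) (simp only: z(2))
  then have "quo j = 0" using zero by simp
  then have jJ: "j \<in> J" by (simp add: quo_zero_iff)
  obtain y where y: "Poly_Mapping.keys y \<subseteq> {p \<in> paths Q. fst p = t}"
    "\<And>x. x \<in> out_arcs Q t \<Longrightarrow> peel x j - pscale (eps x) (path_mult Q y (arrow Q (dbl_bar x))) \<in> J"
    using peel_J[OF jJ, of t] by auto
  \<comment> \<open>The factor \<open>y\<close> need not be homogeneous; only its component of
    degree \<open>c - 1\<close> is relevant for the \<open>z x\<close>.\<close>
  define v where "v = keep (t, c - 1) y"
  have "v \<in> kQ (t, c - 1)"
    unfolding v_def
  proof (rule paths_span_mult[OF y(1) plin_keep kQ_subspace])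
    fix p assume p: "p \<in> {p \<in> paths Q. fst p = t}"
    show "keep (t, c - 1) (basis_vec p) \<in> kQ (t, c - 1)"
    proof (cases "path_degree p = c - 1")
      case True
      then have "p \<in> paths_from t (c - 1)" using p by (simp add: paths_from_def)
      then show ?thesis using p True unfolding kQ_def by (simp add: pm.span_base)
    next
      case False
      then show ?thesis by (simp add: pm.subspace_0[OF kQ_subspace])
    qed
  qed
  moreover have "n x = R (dbl_bar x) (quo v)" if x: "x \<in> out_arcs Q t" for x
  proof -
    have xa: "x \<in> arcs Q" "dbl_bar x \<in> arcs Q" "tail Q x = t" using x by simp_all
    \<comment> \<open>This division is where \<open>a\<close> and \<open>b\<close> have to be
      nonzero.\<close>
    have "pscale (inverse (eps x)) (pscale (eps x) (z x) - pscale (eps x) (path_mult Q y (arrow Q (dbl_bar x)))) \<in> J"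
      using y(2)[OF x] sum_mult_arrow_peel[OF x z(1)] unfolding j_def
      by (intro pm.subspace_scale[OF J_subspace]) simp
    then have "z x - path_mult Q y (arrow Q (dbl_bar x)) \<in> J"
      using eps_nz[OF xa(1)] by (simp add: pm.scale_right_diff_distrib)
    from keep_J[OF this, of "(head Q x, c - dbl_shift x)"]
    have "z x - keep (head Q x, c - dbl_shift x) (path_mult Q y (arrow Q (dbl_bar x))) \<in> J"
      by (simp add: plin_diff[OF plin_keep] keep_kQ[OF z(1)[OF x]])
    moreover have "keep (head Q x, c - dbl_shift x) (path_mult Q y (arrow Q (dbl_bar x)))
        = path_mult Q v (arrow Q (dbl_bar x))"
      using keep_mult_arrow[OF xa(2), of y "c - dbl_shift x"] y(1) xa(3) by (simp add: v_def)
    ultimately show ?thesis by (simp add: z(2)[OF x] R_quo quo_eq_iff)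
  qed
  ultimately show ?thesis unfolding W_def by (intro bexI[of _ "quo v"]) simp_all
qed

text \<open>A path of positive degree is not trivial, so its first arrow can be split off; the
  components are those obtained by \<open>peel\<close>.\<close>

lemma mesh_surj:
  assumes t: "t \<in> verts \<Gamma>" and c: "0 < c" and w: "w \<in> W (t, c)"
  shows "\<exists>n. (\<forall>x\<in>out_arcs Q t. n x \<in> W (head Q x, c - dbl_shift x))
    \<and> w = (\<Sum>x\<in>out_arcs Q t. pscale (eps x) (R x (n x)))"
proof -
  obtain z where z: "z \<in> kQ (t, c)" "w = quo z" using w by (auto simp: W_def)
  have first: "\<exists>x l'. l = x # l' \<and> x \<in> out_arcs Q t" if l: "(t, l) \<in> paths_from t c" for l
  proof (cases l)
    case Nil
    then show ?thesis using l c by (simp add: paths_from_def path_degree_def)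
  next
    case (Cons x l')
    then show ?thesis using l by (auto simp: paths_from_def paths_iff Q.awalk_Cons_iff)
  qed
  have peel_kQ: "peel x z \<in> kQ (head Q x, c - dbl_shift x)" if x: "x \<in> out_arcs Q t" for x
  proof (rule kQ_induct[OF plin_peel kQ_subspace z(1)])
    fix l assume l: "(t, l) \<in> paths_from t c"
    from first[OF l] obtain y l' where y: "l = y # l'" "y \<in> out_arcs Q t" by (elim exE conjE)
    have "basis_vec (head Q y, l') \<in> kQ (head Q y, c - dbl_shift y)"
      unfolding kQ_def using paths_from_Cons[of y l' c] l y by (intro pm.span_base imageI) simp
    moreover have "peel x (basis_vec (t, l)) = (if x = y then basis_vec (head Q y, l') else 0)"
      using y by (cases "x = y") simp_all
    ultimately show "peel x (basis_vec (t, l)) \<in> kQ (head Q x, c - dbl_shift x)"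
      using pm.subspace_0[OF kQ_subspace] by (cases "x = y") simp_all
  qed
  have "(\<Sum>x\<in>out_arcs Q t. path_mult Q (peel x z) (arrow Q x)) - z \<in> {0}"
  proof (rule kQ_induct[OF _ pm.subspace_single_0 z(1)])
    show "plin (\<lambda>z. (\<Sum>x\<in>out_arcs Q t. path_mult Q (peel x z) (arrow Q x)) - z)"
      by (intro plin_minus_fun plin_sum_fun plin_compose[OF plin_path_mult_left plin_peel] plin_id)
    fix l assume l: "(t, l) \<in> paths_from t c"
    from first[OF l] obtain y l' where y: "l = y # l'" "y \<in> out_arcs Q t" by (elim exE conjE)
    have "path_mult Q (peel x (basis_vec (t, l))) (arrow Q x) = (if x = y then basis_vec (t, l) :: _ \<Rightarrow>\<^sub>0 'k else 0)"
      if "x \<in> out_arcs Q t" for x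
      using basis_mult_arrow[of y l'] y by (cases "x = y") simp_all
    then have "(\<Sum>x\<in>out_arcs Q t. path_mult Q (peel x (basis_vec (t, l))) (arrow Q x)) =
        (\<Sum>x\<in>out_arcs Q t. if x = y then basis_vec (t, l) :: _ \<Rightarrow>\<^sub>0 'k else 0)"
      by (rule sum.cong[OF refl])
    also have "\<dots> = basis_vec (t, l)"
      using y(2) Q.finite_out_arcs[of t] by simp
    finally show "(\<Sum>x\<in>out_arcs Q t. path_mult Q (peel x (basis_vec (t, l))) (arrow Q x)) - basis_vec (t, l) \<in> {0}"
      by simp
  qed
  then have z_sum: "z = (\<Sum>x\<in>out_arcs Q t. path_mult Q (peel x z) (arrow Q x))" by simp
  \<comment> \<open>The inverse of \<open>eps x\<close> compensates the weight in the sum.\<close>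
  define n where "n = (\<lambda>x. quo (pscale (inverse (eps x)) (peel x z)))"
  have "n x \<in> W (head Q x, c - dbl_shift x)" if "x \<in> out_arcs Q t" for x
    unfolding n_def W_def by (intro imageI pm.subspace_scale[OF kQ_subspace] peel_kQ that)
  moreover have "w = (\<Sum>x\<in>out_arcs Q t. pscale (eps x) (R x (n x)))"
  proof -
    have "pscale (eps x) (R x (n x)) = quo (path_mult Q (peel x z) (arrow Q x))" if "x \<in> out_arcs Q t" for x
    proof -
      have "R x (n x) = pscale (inverse (eps x)) (quo (path_mult Q (peel x z) (arrow Q x)))"
        unfolding n_def R_quo by (simp only: plin_scale[OF plin_path_mult_left] plin_scale[OF quo(1)])
      then show ?thesis using eps_nz[of x] that by simp
    qed
    then have "(\<Sum>x\<in>out_arcs Q t. pscale (eps x) (R x (n x)))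
        = quo (\<Sum>x\<in>out_arcs Q t. path_mult Q (peel x z) (arrow Q x))"
      unfolding plin_sum[OF quo(1)] by (rule sum.cong[OF refl])
    then show ?thesis using z(2) z_sum by simp
  qed
  ultimately show ?thesis by (intro exI[of _ n]) simp
qed

sublocale MS: mesh_system pscale \<Gamma> eps R W rk
proof (intro mesh_system.intro mesh_system_axioms.intro)
  show "vec_space pscale" by (rule pm.vec_space_axioms)
  show "fin_digraph \<Gamma>" by (rule fin_digraph_axioms)
qed (rule rk_less eps_nz R_lin W_subspace R_W W_neg mesh_zero mesh_exact mesh_surj; assumption)+

end

section \<open>Generic maximal rank\<close>

lemma double_quiver_simps [simp]:
  "Inl \<gamma> \<in> arcs (double_quiver \<Gamma>) \<longleftrightarrow> \<gamma> \<in> arcs \<Gamma>"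
  "Inr \<gamma> \<in> arcs (double_quiver \<Gamma>) \<longleftrightarrow> \<gamma> \<in> arcs \<Gamma>"
  "tail (double_quiver \<Gamma>) (Inl \<gamma>) = tail \<Gamma> \<gamma>"
  "tail (double_quiver \<Gamma>) (Inr \<gamma>) = head \<Gamma> \<gamma>"
  "head (double_quiver \<Gamma>) (Inl \<gamma>) = head \<Gamma> \<gamma>"
  "head (double_quiver \<Gamma>) (Inr \<gamma>) = tail \<Gamma> \<gamma>"
  by (auto simp: double_quiver_def)

text \<open>A pair of functions on the arrows starting and ending at \<open>t\<close> is treated, by
  means of \<open>case_sum\<close>, as a single function on the arrows of the double quiver starting
  at \<open>t\<close>.\<close>

lemma out_in_sum_memI:
  assumes "\<And>x. x \<in> out_arcs (double_quiver \<Gamma>) t \<Longrightarrow> m x \<in> case_sum A B x"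
  shows "(\<lambda>\<gamma>\<in>out_arcs \<Gamma> t. m (Inl \<gamma>), \<lambda>\<gamma>\<in>in_arcs \<Gamma> t. m (Inr \<gamma>)) \<in> out_in_sum \<Gamma> t A B"
  using assms[of "Inl _"] assms[of "Inr _"] by (simp add: out_in_sum_def)

lemma out_in_sum_memD:
  assumes "XY \<in> out_in_sum \<Gamma> t A B" "x \<in> out_arcs (double_quiver \<Gamma>) t"
  shows "case_sum (fst XY) (snd XY) x \<in> case_sum A B x"
  using assms by (cases x) (auto simp: out_in_sum_def PiE_iff)

lemma out_in_sum_eqI:
  assumes "XY \<in> out_in_sum \<Gamma> t A B" "XY' \<in> out_in_sum \<Gamma> t A' B'"
    and "\<And>x. x \<in> out_arcs (double_quiver \<Gamma>) t \<Longrightarrow> case_sum (fst XY) (snd XY) x = case_sum (fst XY') (snd XY') x"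
  shows "XY = XY'"
proof (rule prod_eqI)
  have XY: "fst XY \<in> extensional (out_arcs \<Gamma> t)" "snd XY \<in> extensional (in_arcs \<Gamma> t)"
    "fst XY' \<in> extensional (out_arcs \<Gamma> t)" "snd XY' \<in> extensional (in_arcs \<Gamma> t)"
    using assms(1,2) by (auto simp: out_in_sum_def PiE_def)
  show "fst XY = fst XY'"
    by (rule extensionalityI[OF XY(1,3)]) (use assms(3)[of "Inl _"] in simp)
  show "snd XY = snd XY'"
    by (rule extensionalityI[OF XY(2,4)]) (use assms(3)[of "Inr _"] in simp)
qed

section \<open>Graded pieces as subspaces, and general maximal rank of \<open>g\<close>\<close>

context preprojective_acyclic
begin

abbreviation V where "V \<equiv> graded_piece \<Gamma> a b"

lemma V_span: "V (t, c) = E.M.span (pr ` basis_vec ` paths_from t c)"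
proof -
  have "{pr (basis_vec p) | p. p \<in> paths Q \<and> fst p = t \<and> path_degree p = c} = pr ` basis_vec ` paths_from t c"
    unfolding paths_from_def by blast
  then show ?thesis by (simp add: graded_piece_def)
qed

lemma generators_carrier: "pr ` basis_vec ` paths_from t c \<subseteq> carrier P"
  unfolding P_carrier by (intro image_mono) (auto simp: paths_from_def)

lemma rep_V: "rep ` V i = W i"
proof (cases i)
  case (Pair t c)
  interpret q: module_hom pscale pscale quo
    using quo(1) by (simp add: Vector_Spaces.linear_iff_module_hom)
  have "rep ` V (t, c) = pm.span (quo ` basis_vec ` paths_from t c)"
    unfolding V_span E.\<Phi>_span[OF generators_carrier] by (simp add: image_image)
  also have "\<dots> = W (t, c)"
    unfolding W_def kQ_def using q.span_image by simp
  finally show ?thesis using Pair by simp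
qed

lemma V_subspace: "VectorSpace.subspace class_ring (V i) P"
  by (cases i) (simp only: V_span, rule E.M.span_is_subspace[OF generators_carrier])

lemma V_carrier: "V i \<subseteq> carrier P"
  using V_subspace[of i] by (simp add: VectorSpace.subspace_def submodule_def)

lemma V_finitely_generated: "\<exists>S. finite S \<and> S \<subseteq> carrier P \<and> V i = E.M.span S"
proof (cases i)
  case (Pair t c)
  show ?thesis
    unfolding Pair V_span
    by (intro exI[of _ "pr ` basis_vec ` paths_from t c"] conjI finite_imageI finite_paths_from generators_carrier refl)
qed

lemma subspace_family_V: "finite I \<Longrightarrow> subspace_family pscale P rep I V"
  by (intro subspace_family.intro E.embedded_space_axioms subspace_family_axioms.intro V_subspace
      V_finitely_generated)

text \<open>The index of the space which right multiplication by \<open>x\<close> carries into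
  degree \<open>d\<close> at the tail of \<open>x\<close>.\<close>

definition nb_index :: "int \<Rightarrow> 'e + 'e \<Rightarrow> 'v \<times> int" where
  "nb_index d x = (head Q x, d - dbl_shift x)"

lemma neighbours_eq: "neighbours \<Gamma> t d (d - 1) = nb_index d ` out_arcs Q t"
  unfolding out_arcs_double neighbours_def image_Un image_image
  by (simp add: nb_index_def double_quiver_def)

lemma finite_out_Q: "finite (out_arcs Q t)"
  by (rule Q.finite_out_arcs)

lemma beta_eq: "beta \<Gamma> a b \<gamma> = pr (arrow Q (Inl \<gamma>))" "beta_star \<Gamma> a b \<gamma> = pr (arrow Q (Inr \<gamma>))"
  by (simp_all add: beta_def beta_star_def)

lemma g_map_rep:
  assumes "\<And>x. x \<in> out_arcs Q t \<Longrightarrow> case_sum (fst XY) (snd XY) x \<in> carrier P"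
  shows "g_map \<Gamma> a b t XY \<in> carrier P"
    and "rep (g_map \<Gamma> a b t XY) =
      (\<Sum>x\<in>out_arcs Q t. pscale (eps x) (R x (rep (case_sum (fst XY) (snd XY) x))))"
proof -
  obtain X Y where XY: "XY = (X, Y)" by (cases XY)
  have X: "X \<gamma> \<in> carrier P" "Inl \<gamma> \<in> arcs Q" if "\<gamma> \<in> out_arcs \<Gamma> t" for \<gamma>
    using assms[of "Inl \<gamma>"] that by (simp_all add: XY double_quiver_def)
  have Y: "Y \<gamma> \<in> carrier P" "Inr \<gamma> \<in> arcs Q" if "\<gamma> \<in> in_arcs \<Gamma> t" for \<gamma>
    using assms[of "Inr \<gamma>"] that by (simp_all add: XY double_quiver_def)
  let ?f = "\<lambda>\<gamma>. X \<gamma> \<otimes>\<^bsub>P\<^esub> (a \<gamma> \<odot>\<^bsub>P\<^esub> beta \<Gamma> a b \<gamma>)" and ?g = "\<lambda>\<gamma>. Y \<gamma> \<otimes>\<^bsub>P\<^esub> ((- b \<gamma>) \<odot>\<^bsub>P\<^esub> beta_star \<Gamma> a b \<gamma>)"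
  have f: "?f \<in> out_arcs \<Gamma> t \<rightarrow> carrier P"
    unfolding beta_eq by (intro Pi_I rep_mult_arrow(2) X)
  have g: "?g \<in> in_arcs \<Gamma> t \<rightarrow> carrier P"
    unfolding beta_eq by (intro Pi_I rep_mult_arrow(2) Y)
  have eq: "g_map \<Gamma> a b t XY = finsum P ?f (out_arcs \<Gamma> t) \<oplus>\<^bsub>P\<^esub> finsum P ?g (in_arcs \<Gamma> t)"
    by (simp add: g_map_def XY Let_def)
  have fc: "finsum P ?f (out_arcs \<Gamma> t) \<in> carrier P" by (rule E.M.M.finsum_closed[OF f])
  have gc: "finsum P ?g (in_arcs \<Gamma> t) \<in> carrier P" by (rule E.M.M.finsum_closed[OF g])
  show "g_map \<Gamma> a b t XY \<in> carrier P"
    unfolding eq by (rule E.M.M.add.m_closed[OF fc gc])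
  have "rep (g_map \<Gamma> a b t XY) = (\<Sum>\<gamma>\<in>out_arcs \<Gamma> t. rep (?f \<gamma>)) + (\<Sum>\<gamma>\<in>in_arcs \<Gamma> t. rep (?g \<gamma>))"
    unfolding eq E.\<Phi>_add[OF fc gc] E.\<Phi>_finsum[OF f] E.\<Phi>_finsum[OF g] ..
  also have "(\<Sum>\<gamma>\<in>out_arcs \<Gamma> t. rep (?f \<gamma>)) = (\<Sum>\<gamma>\<in>out_arcs \<Gamma> t. pscale (eps (Inl \<gamma>)) (R (Inl \<gamma>) (rep (X \<gamma>))))"
    by (rule sum.cong[OF refl]) (simp only: beta_eq rep_mult_arrow(1) X sum.case)
  also have "(\<Sum>\<gamma>\<in>in_arcs \<Gamma> t. rep (?g \<gamma>)) = (\<Sum>\<gamma>\<in>in_arcs \<Gamma> t. pscale (eps (Inr \<gamma>)) (R (Inr \<gamma>) (rep (Y \<gamma>))))"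
    by (rule sum.cong[OF refl]) (simp only: beta_eq rep_mult_arrow(1) Y sum.case)
  finally show "rep (g_map \<Gamma> a b t XY) =
      (\<Sum>x\<in>out_arcs Q t. pscale (eps x) (R x (rep (case_sum (fst XY) (snd XY) x))))"
    unfolding sum_out_arcs_double XY fst_conv snd_conv sum.case .
qed

text \<open>All values are multiples of \<open>w\<close>. This prescribes the value at one nonzero
  vector while staying inside every subspace that contains \<open>w\<close>.\<close>

lemma rank_one_map:
  fixes u w :: "'v \<times> ('e + 'e) list \<Rightarrow>\<^sub>0 'k"
  assumes "u \<noteq> 0"
  obtains h where "plin h" "h u = w" "\<forall>v T. pm.subspace T \<longrightarrow> w \<in> T \<longrightarrow> h v \<in> T"
proof -
  obtain \<psi> where \<psi>: "Vector_Spaces.linear pscale (*) \<psi>" "\<psi> u = 1"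
    using pm.linear_functional_exists[OF assms] by metis
  show ?thesis
  proof (rule that[of "\<lambda>v. pscale (\<psi> v) w"])
    show "plin (\<lambda>v. pscale (\<psi> v) w)"
      using \<psi>(1) by (simp add: plin_iff Vector_Spaces.linear_iff pm.scale_left_distrib)
  qed (simp_all add: \<psi>(2) pm.subspace_scale)
qed

lemma g_map_general:
  assumes inf: "infinite (UNIV :: 'k set)" and t: "t \<in> verts \<Gamma>" and d: "0 \<le> d"
  shows "for_general_subspaces P (neighbours \<Gamma> t d (d - 1)) V
     (\<lambda>U. maximal_rank (g_map \<Gamma> a b t)
        (out_in_sum \<Gamma> t (\<lambda>\<gamma>. U (head \<Gamma> \<gamma>, d)) (\<lambda>\<gamma>. U (tail \<Gamma> \<gamma>, d - 1))) (V (t, d)))"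
  unfolding for_general_subspaces_def neighbours_eq
proof
  fix r :: "'v \<times> int \<Rightarrow> nat"
  let ?ix = "nb_index d" and ?O = "out_arcs Q t"
  interpret SF: subspace_family pscale P rep "?ix ` ?O" V r
    by (rule subspace_family_V) (rule finite_imageI[OF finite_out_Q])
  have ixI: "?ix x \<in> ?ix ` ?O" if "x \<in> ?O" for x using that by (rule imageI)
  \<comment> \<open>One column for each arrow and each vector of its frame. Arrows with the same
    \<open>?ix x\<close> share the frame but keep separate columns.\<close>
  define S where "S = Sigma ?O (\<lambda>x. {..<r (?ix x)})"
  have finS: "finite S" unfolding S_def by (intro finite_SigmaI finite_out_Q) simp
  define L where "L = (\<lambda>(s :: ('e + 'e) \<times> nat) v. pscale (eps (fst s)) (R (fst s) v))"
  \<comment> \<open>The summand 0 is the constant part \<open>A\<close> of the columns in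
    \<open>generic_maximal_rank\<close>.\<close>
  define y where "y = (\<lambda>s fr. 0 + L s (rep (fr (?ix (fst s)) (snd s))))"
  have y_eq: "0 + L s (rep (fr (?ix (fst s)) (snd s))) = y s fr" for s fr by (simp only: y_def)
  have S_sum: "(\<Sum>s\<in>S. f s) = (\<Sum>x\<in>?O. \<Sum>j<r (?ix x). f (x, j))" for f :: "_ \<Rightarrow> 'v \<times> ('e + 'e) list \<Rightarrow>\<^sub>0 'k"
    unfolding S_def using sum.Sigma[of ?O "\<lambda>x. {..<r (?ix x)}" "\<lambda>x j. f (x, j)"] finite_out_Q by simp
  have L_lin: "plin (L s)" for s
    unfolding L_def by (intro plin_pscale R_lin)
  have L_sum: "(\<Sum>s\<in>S. pscale (c s) (L s (m s))) =
      (\<Sum>x\<in>?O. pscale (eps x) (R x (\<Sum>j<r (?ix x). pscale (c (x, j)) (m (x, j)))))" for c m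
    unfolding S_sum L_def fst_conv plin_sum[OF R_lin] plin_scale[OF R_lin] pm.scale_sum_right pm.scale_scale
    by (simp only: mult.commute)
  have W_ix: "W (?ix x) = W (head Q x, d - dbl_shift x)" for x by (simp add: nb_index_def)
  have rep_fr: "rep (fr (?ix x) j) \<in> W (?ix x)" if "fr \<in> SF.tuples" "x \<in> ?O" "j < r (?ix x)" for fr x j
    using SF.tupleD[OF that(1) ixI[OF that(2)] that(3)] rep_V[of "?ix x"] by blast
  have fr_ind: "indep_family pscale {..<r (?ix x)} (\<lambda>j. rep (fr (?ix x) j))" if "fr \<in> SF.frms" "x \<in> ?O" for fr x
  proof -
    have "\<forall>i\<in>?ix ` ?O. indep_family pscale {..<r i} (\<lambda>j. rep (fr i j))"
      using that(1) unfolding SF.frames_iff by (rule conjunct2)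
    from bspec[OF this ixI[OF that(2)]] show ?thesis .
  qed
  have y_W: "y s fr \<in> W (t, d)" if s: "s \<in> S" and fr: "fr \<in> SF.tuples" for s fr
  proof -
    obtain x j where xj: "s = (x, j)" "x \<in> ?O" "j < r (?ix x)" using s unfolding S_def by (elim SigmaE) simp
    have "R x (rep (fr (?ix x) j)) \<in> W (tail Q x, d - dbl_shift x + dbl_shift x)"
      using xj(2) rep_fr[OF fr xj(2,3)] by (intro R_W) (simp_all add: W_ix)
    then show ?thesis
      using xj(2) pm.subspace_scale[OF W_subspace] by (simp add: y_def L_def xj(1))
  qed
  show "\<exists>Wo. openin (zariski_grassmannians P (?ix ` ?O) V r) Wo
      \<and> zariski_grassmannians P (?ix ` ?O) V r closure_of Wo = grassmannians P (?ix ` ?O) V r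
      \<and> (\<forall>U\<in>Wo. maximal_rank (g_map \<Gamma> a b t)
        (out_in_sum \<Gamma> t (\<lambda>\<gamma>. U (head \<Gamma> \<gamma>, d)) (\<lambda>\<gamma>. U (tail \<Gamma> \<gamma>, d - 1))) (V (t, d)))"
  proof (rule SF.generic_maximal_rank[where A = "\<lambda>_. 0" and L = L
        and \<iota> = "\<lambda>s. ?ix (fst s)" and \<kappa> = snd and E = "W (t, d)", unfolded y_eq,
        OF inf pm.vec_space_axioms finS L_lin])
    fix s assume "s \<in> S"
    then show "(\<forall>v. L s v = 0) \<or> ?ix (fst s) \<in> ?ix ` ?O \<and> snd s < r (?ix (fst s))"
      unfolding S_def by (elim SigmaE) simp
  next
    fix s fr assume "s \<in> S" "fr \<in> SF.tuples"
    then show "y s fr \<in> W (t, d)" by (rule y_W)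
  next
    fix fr :: "'v \<times> int \<Rightarrow> nat \<Rightarrow> ('v \<times> ('e + 'e) list \<Rightarrow>\<^sub>0 'k) set" and c w
    assume fr: "fr \<in> SF.frms" and nz: "\<exists>s\<in>S. c s \<noteq> 0" and zero: "(\<Sum>s\<in>S. pscale (c s) (y s fr)) = 0"
      and w: "w \<in> W (t, d)"
    have frt: "fr \<in> SF.tuples" using fr by (simp add: frames_def)
    define n where "n = (\<lambda>x. \<Sum>j<r (?ix x). pscale (c (x, j)) (rep (fr (?ix x) j)))"
    have n_W: "n x \<in> W (?ix x)" if "x \<in> ?O" for x
      unfolding n_def using rep_fr[OF frt that]
      by (intro pm.subspace_sum[OF W_subspace] pm.subspace_scale[OF W_subspace]) simp
    have Gn: "(\<Sum>x\<in>?O. pscale (eps x) (R x (n x))) = 0"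
      using zero L_sum[of c "\<lambda>s. rep (fr (?ix (fst s)) (snd s))"] by (simp add: y_def n_def)
    obtain x0 j0 where x0: "x0 \<in> ?O" "j0 < r (?ix x0)" "c (x0, j0) \<noteq> 0"
      using nz unfolding S_def by (elim bexE SigmaE) simp
    \<comment> \<open>A nonzero coefficient gives a nonzero vector because frames are
      independent.\<close>
    have "n x0 \<noteq> 0"
    proof
      assume "n x0 = 0"
      moreover have "indep_family pscale {..<r (?ix x0)} (\<lambda>j. rep (fr (?ix x0) j))"
        by (rule fr_ind[OF fr x0(1)])
      ultimately have "\<forall>j\<in>{..<r (?ix x0)}. c (x0, j) = 0"
        unfolding indep_family_def n_def by (elim allE[of _ "\<lambda>j. c (x0, j)"]) simp
      then show False using x0 by simp
    qed
    \<comment> \<open>The value is chosen so that \<open>\<Sum> eps x (h x (n x)) = - w\<close> once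
      \<open>h\<close> is \<open>h0\<close> at \<open>x0\<close> and zero elsewhere.\<close>
    then obtain h0 where h0: "plin h0" "h0 (n x0) = pscale (inverse (eps x0)) (- w)"
        "\<forall>v T. pm.subspace T \<longrightarrow> pscale (inverse (eps x0)) (- w) \<in> T \<longrightarrow> h0 v \<in> T"
      by (rule rank_one_map[of "n x0" "pscale (inverse (eps x0)) (- w)"])
    define h where "h = (\<lambda>x. if x = x0 then h0 else (\<lambda>_. 0))"
    have hW: "h x v \<in> W (t, d)" for x v
      using h0(3)[rule_format, of "W (t, d)" v, OF W_subspace] w
      by (simp add: h_def pm.subspace_0[OF W_subspace] pm.subspace_scale[OF W_subspace] pm.subspace_neg[OF W_subspace])
    obtain \<phi> where \<phi>: "\<And>u. plin (\<phi> u)"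
      "\<And>x v. x \<in> ?O \<Longrightarrow> v \<in> W (head Q x, d - dbl_shift x) \<Longrightarrow> \<phi> (head Q x) v \<in> W (head Q x, d - dbl_shift x)"
      "\<And>x v. x \<in> ?O \<Longrightarrow> v \<in> W (head Q x, d - dbl_shift x) \<Longrightarrow> h x v = \<phi> t (R x v) - R x (\<phi> (head Q x) v)"
    proof (rule MS.rigid_in[OF t d, where h = h])
      show "plin (h x)" for x by (cases "x = x0") (simp_all add: h_def h0(1) plin_const_zero)
    qed (rule hW, (rule that; assumption))
    \<comment> \<open>The direction of deformation moves each frame by \<phi> at the vertex of its
      index. It depends on the index alone, as the shared subspaces require.\<close>
    obtain v where v: "v \<in> SF.tuples"
      "\<And>i j. i \<in> ?ix ` ?O \<Longrightarrow> j < r i \<Longrightarrow> rep (v i j) = \<phi> (fst i) (rep (fr i j))"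
    proof (rule SF.tuple_exists[where n = "\<lambda>i j. \<phi> (fst i) (rep (fr i j))"])
      fix i j assume "i \<in> ?ix ` ?O" and j: "j < r i"
      then obtain x where x: "x \<in> ?O" "i = ?ix x" by (elim imageE)
      show "\<phi> (fst i) (rep (fr i j)) \<in> rep ` V i"
        unfolding rep_V x(2) using \<phi>(2)[OF x(1), of "rep (fr (?ix x) j)"] rep_fr[OF frt x(1)] j x(2)
        by (simp add: nb_index_def)
    qed (rule that; assumption)
    have "(\<Sum>s\<in>S. pscale (c s) (L s (rep (v (?ix (fst s)) (snd s))))) =
        (\<Sum>x\<in>?O. pscale (eps x) (R x (\<phi> (head Q x) (n x))))"
    proof -
      have "(\<Sum>j<r (?ix x). pscale (c (x, j)) (rep (v (?ix x) j))) = \<phi> (head Q x) (n x)" if x: "x \<in> ?O" for x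
        unfolding n_def plin_sum[OF \<phi>(1)] plin_scale[OF \<phi>(1)]
        by (rule sum.cong[OF refl]) (simp add: v(2)[OF ixI[OF x]], simp add: nb_index_def)
      then show ?thesis
        using L_sum[of c "\<lambda>s. rep (v (?ix (fst s)) (snd s))"] by simp
    qed
    also have "\<dots> = (\<Sum>x\<in>?O. pscale (eps x) (\<phi> t (R x (n x))) - pscale (eps x) (h x (n x)))"
    proof (rule sum.cong[OF refl])
      fix x assume x: "x \<in> ?O"
      have "R x (\<phi> (head Q x) (n x)) = \<phi> t (R x (n x)) - h x (n x)"
        using \<phi>(3)[OF x, of "n x"] n_W[OF x] by (simp add: W_ix)
      then show "pscale (eps x) (R x (\<phi> (head Q x) (n x))) =
          pscale (eps x) (\<phi> t (R x (n x))) - pscale (eps x) (h x (n x))"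
        by (simp add: pm.scale_right_diff_distrib)
    qed
    \<comment> \<open>Pulling \<phi> at \<open>t\<close> out of the sum makes its contribution
      vanish by \<open>Gn\<close>.\<close>
    also have "\<dots> = \<phi> t (\<Sum>x\<in>?O. pscale (eps x) (R x (n x))) - (\<Sum>x\<in>?O. pscale (eps x) (h x (n x)))"
      unfolding sum_subtractf plin_sum[OF \<phi>(1)] plin_scale[OF \<phi>(1)] ..
    also have "\<dots> = - (\<Sum>x\<in>?O. pscale (eps x) (h x (n x)))"
      by (simp add: Gn plin_zero[OF \<phi>(1)])
    also have "(\<Sum>x\<in>?O. pscale (eps x) (h x (n x))) = (\<Sum>x\<in>?O. if x = x0 then pscale (eps x0) (h0 (n x0)) else 0)"
      by (rule sum.cong[OF refl]) (simp add: h_def)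
    also have "\<dots> = - w"
      using x0(1) finite_out_Q[of t] eps_nz[of x0] by (simp add: h0(2))
    finally have "(\<Sum>s\<in>S. pscale (c s) (L s (rep (v (?ix (fst s)) (snd s))))) - w = 0" by simp
    then show "\<exists>v\<in>SF.tuples. (\<Sum>s\<in>S. pscale (c s) (L s (rep (v (?ix (fst s)) (snd s))))) - w
        \<in> pm.span ((\<lambda>s. y s fr) ` S)"
      using v(1) pm.span_zero by (intro bexI[of _ v]) simp_all
  next
    fix fr assume fr: "fr \<in> SF.frms"
    have frt: "fr \<in> SF.tuples" using fr by (simp add: frames_def)
    define U where "U = frame_span P (?ix ` ?O) r fr"
    let ?D = "out_in_sum \<Gamma> t (\<lambda>\<gamma>. U (head \<Gamma> \<gamma>, d)) (\<lambda>\<gamma>. U (tail \<Gamma> \<gamma>, d - 1))" and ?g = "g_map \<Gamma> a b t"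
    have U_ix: "case_sum (\<lambda>\<gamma>. U (head \<Gamma> \<gamma>, d)) (\<lambda>\<gamma>. U (tail \<Gamma> \<gamma>, d - 1)) x = U (?ix x)" for x
      by (cases x) (simp_all add: nb_index_def double_quiver_def)
    have rep_U: "rep ` U (?ix x) = {\<Sum>j<r (?ix x). pscale (c j) (rep (fr (?ix x) j)) | c. True}" if "x \<in> ?O" for x
      unfolding U_def by (rule SF.\<Phi>_frame_span[OF frt ixI[OF that]])
    have U_carrier: "U (?ix x) \<subseteq> carrier P" if "x \<in> ?O" for x
      unfolding U_def using SF.frame_span_carrier[OF frt ixI[OF that]] V_carrier by (rule subset_trans)
    \<comment> \<open>The dictionary between the restricted map and its columns: \<open>c\<close> is
      a coordinate vector of \<open>XY\<close> with respect to the frames.\<close>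
    define coords where "coords = (\<lambda>XY c. XY \<in> ?D \<and>
      (\<forall>x\<in>?O. rep (case_sum (fst XY) (snd XY) x) = (\<Sum>j<r (?ix x). pscale (c (x, j)) (rep (fr (?ix x) j)))))"
    have D_carrier: "case_sum (fst XY) (snd XY) x \<in> carrier P" if "XY \<in> ?D" "x \<in> ?O" for XY x
      using out_in_sum_memD[OF that] U_carrier[OF that(2)] unfolding U_ix by (rule subsetD[rotated])
    have c1: "\<exists>XY. coords XY c" for c
    proof -
      have "\<forall>x\<in>?O. \<exists>m. m \<in> U (?ix x) \<and> rep m = (\<Sum>j<r (?ix x). pscale (c (x, j)) (rep (fr (?ix x) j)))"
      proof
        fix x assume x: "x \<in> ?O"
        have "(\<Sum>j<r (?ix x). pscale (c (x, j)) (rep (fr (?ix x) j))) \<in> rep ` U (?ix x)"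
          unfolding rep_U[OF x] by (intro CollectI exI[of _ "\<lambda>j. c (x, j)"]) simp
        then show "\<exists>m. m \<in> U (?ix x) \<and> rep m = (\<Sum>j<r (?ix x). pscale (c (x, j)) (rep (fr (?ix x) j)))"
          by (elim imageE) (rule exI, rule conjI, assumption, erule sym)
      qed
      from bchoice[OF this] obtain m where
        m: "\<forall>x\<in>?O. m x \<in> U (?ix x) \<and> rep (m x) = (\<Sum>j<r (?ix x). pscale (c (x, j)) (rep (fr (?ix x) j)))" ..
      let ?XY = "(\<lambda>\<gamma>\<in>out_arcs \<Gamma> t. m (Inl \<gamma>), \<lambda>\<gamma>\<in>in_arcs \<Gamma> t. m (Inr \<gamma>))"
      have "?XY \<in> ?D" by (rule out_in_sum_memI) (use m in \<open>simp add: U_ix\<close>)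
      moreover have "case_sum (fst ?XY) (snd ?XY) x = m x" if "x \<in> ?O" for x
        using that by (cases x) (simp_all)
      ultimately have "coords ?XY c" unfolding coords_def using m by simp
      then show ?thesis by (rule exI)
    qed
    have c2: "\<exists>c. coords XY c" if D: "XY \<in> ?D" for XY
    proof -
      have "\<forall>x\<in>?O. \<exists>c. rep (case_sum (fst XY) (snd XY) x) = (\<Sum>j<r (?ix x). pscale (c j) (rep (fr (?ix x) j)))"
      proof
        fix x assume x: "x \<in> ?O"
        have "rep (case_sum (fst XY) (snd XY) x) \<in> rep ` U (?ix x)"
          using out_in_sum_memD[OF D x] unfolding U_ix by (rule imageI)
        then show "\<exists>c. rep (case_sum (fst XY) (snd XY) x) = (\<Sum>j<r (?ix x). pscale (c j) (rep (fr (?ix x) j)))"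
          unfolding rep_U[OF x] by (elim CollectE exE conjE) (rule exI)
      qed
      from bchoice[OF this] obtain c where
        "\<forall>x\<in>?O. rep (case_sum (fst XY) (snd XY) x) = (\<Sum>j<r (?ix x). pscale (c x j) (rep (fr (?ix x) j)))" ..
      then have "coords XY (\<lambda>(x, j). c x j)" unfolding coords_def using D by simp
      then show ?thesis by (rule exI[of _ "\<lambda>(x, j). c x j"])
    qed
    have c3: "rep (?g XY) = (\<Sum>s\<in>S. pscale (c s) (y s fr))" "?g XY \<in> carrier P" if XY: "coords XY c" for XY c
    proof -
      have D: "XY \<in> ?D" using XY by (simp add: coords_def)
      show "?g XY \<in> carrier P" by (rule g_map_rep(1)) (rule D_carrier[OF D])
      have "rep (?g XY) = (\<Sum>x\<in>?O. pscale (eps x) (R x (rep (case_sum (fst XY) (snd XY) x))))"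
        by (rule g_map_rep(2)) (rule D_carrier[OF D])
      also have "\<dots> = (\<Sum>x\<in>?O. pscale (eps x) (R x (\<Sum>j<r (?ix x). pscale (c (x, j)) (rep (fr (?ix x) j)))))"
        by (rule sum.cong[OF refl]) (use XY in \<open>simp add: coords_def\<close>)
      also have "\<dots> = (\<Sum>s\<in>S. pscale (c s) (y s fr))"
        using L_sum[of c "\<lambda>s. rep (fr (?ix (fst s)) (snd s))"] by (simp add: y_def)
      finally show "rep (?g XY) = (\<Sum>s\<in>S. pscale (c s) (y s fr))" .
    qed
    have c4: "XY = XY'" if "coords XY c" "coords XY' c'" "\<forall>s\<in>S. c s = c' s" for XY XY' c c'
    proof (rule out_in_sum_eqI)
      show D: "XY \<in> ?D" "XY' \<in> ?D" using that by (simp_all add: coords_def)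
      fix x assume x: "x \<in> ?O"
      have "rep (case_sum (fst XY) (snd XY) x) = rep (case_sum (fst XY') (snd XY') x)"
        using that x by (simp add: coords_def S_def)
      then show "case_sum (fst XY) (snd XY) x = case_sum (fst XY') (snd XY') x"
        using inj_onD[OF E.\<Phi>_inj _ D_carrier[OF D(1) x] D_carrier[OF D(2) x]] by simp
    qed
    \<comment> \<open>Uniqueness of coordinates in the form needed for kernels: a vector with zero
      coordinates has no others.\<close>
    have c5: "\<forall>s\<in>S. c s = 0" if "coords XY c" "coords XY c'" "\<forall>s\<in>S. c' s = 0" for XY c c'
    proof
      fix s assume "s \<in> S"
      then obtain x j where x: "s = (x, j)" "x \<in> ?O" "j < r (?ix x)" unfolding S_def by (elim SigmaE) simp
      have "(\<Sum>j<r (?ix x). pscale (c (x, j)) (rep (fr (?ix x) j))) = 0"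
        using that x by (simp add: coords_def S_def)
      moreover have "indep_family pscale {..<r (?ix x)} (\<lambda>j. rep (fr (?ix x) j))"
        by (rule fr_ind[OF fr x(2)])
      ultimately have "\<forall>j\<in>{..<r (?ix x)}. c (x, j) = 0"
        unfolding indep_family_def by (elim allE[of _ "\<lambda>j. c (x, j)"]) simp
      then show "c s = 0" using x by simp
    qed
    have "inj_on ?g ?D \<longleftrightarrow> indep_family pscale S (\<lambda>s. y s fr)"
    proof
      assume inj: "inj_on ?g ?D"
      show "indep_family pscale S (\<lambda>s. y s fr)"
        unfolding indep_family_def
      proof (intro allI impI)
        fix c assume c: "(\<Sum>s\<in>S. pscale (c s) (y s fr)) = 0"
        obtain XY where XY: "coords XY c" using c1 ..
        obtain XY0 where XY0: "coords XY0 (\<lambda>_. 0)" using c1 ..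
        have "rep (?g XY) = rep (?g XY0)" unfolding c3(1)[OF XY] c3(1)[OF XY0] c by simp
        then have "?g XY = ?g XY0" using inj_onD[OF E.\<Phi>_inj _ c3(2)[OF XY] c3(2)[OF XY0]] by simp
        then have "XY = XY0" using inj_onD[OF inj, of XY XY0] XY XY0 by (simp add: coords_def)
        then show "\<forall>s\<in>S. c s = 0" using c5[OF XY, of "\<lambda>_. 0"] XY0 by simp
      qed
    next
      assume ind: "indep_family pscale S (\<lambda>s. y s fr)"
      show "inj_on ?g ?D"
      proof (rule inj_onI)
        fix XY XY' assume D: "XY \<in> ?D" "XY' \<in> ?D" and eq: "?g XY = ?g XY'"
        obtain c where c: "coords XY c" using c2[OF D(1)] ..
        obtain c' where c': "coords XY' c'" using c2[OF D(2)] ..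
        have "(\<Sum>s\<in>S. pscale (c s - c' s) (y s fr)) = 0"
          using eq c3(1)[OF c] c3(1)[OF c'] by (simp add: pm.scale_left_diff_distrib sum_subtractf)
        then have "\<forall>s\<in>S. c s - c' s = 0"
          using ind unfolding indep_family_def by (elim allE[of _ "\<lambda>s. c s - c' s"]) simp
        then show "XY = XY'" by (intro c4[OF c c']) simp
      qed
    qed
    moreover have "?g ` ?D = V (t, d) \<longleftrightarrow> W (t, d) \<subseteq> pm.span ((\<lambda>s. y s fr) ` S)"
    proof -
      have im: "rep ` ?g ` ?D = pm.span ((\<lambda>s. y s fr) ` S)"
        unfolding pm.span_family[OF finS]
      proof
        show "rep ` ?g ` ?D \<subseteq> {\<Sum>s\<in>S. pscale (c s) (y s fr) | c. True}"
        proof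
          fix u assume "u \<in> rep ` ?g ` ?D"
          then obtain XY where XY: "XY \<in> ?D" "u = rep (?g XY)" by (elim imageE) simp
          obtain c where c: "coords XY c" using c2[OF XY(1)] ..
          show "u \<in> {\<Sum>s\<in>S. pscale (c s) (y s fr) | c. True}"
            unfolding XY(2) c3(1)[OF c] by (intro CollectI exI[of _ c]) simp
        qed
        show "{\<Sum>s\<in>S. pscale (c s) (y s fr) | c. True} \<subseteq> rep ` ?g ` ?D"
        proof
          fix u assume "u \<in> {\<Sum>s\<in>S. pscale (c s) (y s fr) | c. True}"
          then obtain c where u: "u = (\<Sum>s\<in>S. pscale (c s) (y s fr))" by (elim CollectE exE conjE)
          obtain XY where XY: "coords XY c" using c1 ..
          then have "XY \<in> ?D" by (simp add: coords_def)
          then show "u \<in> rep ` ?g ` ?D" unfolding u c3(1)[OF XY, symmetric] by (intro imageI)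
        qed
      qed
      have gD: "?g ` ?D \<subseteq> carrier P"
      proof
        fix u assume "u \<in> ?g ` ?D"
        then obtain XY where XY: "XY \<in> ?D" "u = ?g XY" by (elim imageE) simp
        obtain c where "coords XY c" using c2[OF XY(1)] ..
        from c3(2)[OF this] show "u \<in> carrier P" using XY by simp
      qed
      have "?g ` ?D = V (t, d) \<longleftrightarrow> rep ` ?g ` ?D = rep ` V (t, d)"
        using inj_on_image_eq_iff[OF E.\<Phi>_inj gD V_carrier] by simp
      also have "\<dots> \<longleftrightarrow> W (t, d) \<subseteq> pm.span ((\<lambda>s. y s fr) ` S)"
      proof -
        have "pm.span ((\<lambda>s. y s fr) ` S) \<subseteq> W (t, d)"
          by (rule pm.span_minimal[OF _ W_subspace]) (intro image_subsetI y_W frt)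
        then show ?thesis unfolding im rep_V by (intro iffI equalityI) simp_all
      qed
      finally show ?thesis .
    qed
    ultimately show "maximal_rank ?g (out_in_sum \<Gamma> t (\<lambda>\<gamma>. frame_span P (?ix ` ?O) r fr (head \<Gamma> \<gamma>, d))
        (\<lambda>\<gamma>. frame_span P (?ix ` ?O) r fr (tail \<Gamma> \<gamma>, d - 1))) (V (t, d)) \<longleftrightarrow>
      indep_family pscale S (\<lambda>s. y s fr) \<or> W (t, d) \<subseteq> pm.span ((\<lambda>s. y s fr) ` S)"
      unfolding maximal_rank_def U_def by simp
  qed
qed

end

section \<open>General maximal rank of \<open>f\<close> modulo the subspaces\<close>

context preprojective_acyclic
begin

lemma in_V_iff:
  assumes "X \<in> carrier P"
  shows "X \<in> V i \<longleftrightarrow> rep X \<in> W i"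
  using inj_on_image_mem_iff[OF E.\<Phi>_inj assms V_carrier] by (simp add: rep_V)

lemma quot_proj_mem:
  assumes U: "U \<subseteq> carrier P" and u: "u \<in> carrier P" and X: "X \<in> carrier P"
  shows "X \<in> quot_proj \<Gamma> a b U u \<longleftrightarrow> rep X - rep u \<in> rep ` U"
proof -
  have *: "X = h \<oplus>\<^bsub>P\<^esub> u \<longleftrightarrow> rep X - rep u = rep h" if h: "h \<in> U" for h
  proof -
    have hc: "h \<in> carrier P" using h U by (rule subsetD[rotated])
    have "X = h \<oplus>\<^bsub>P\<^esub> u \<longleftrightarrow> rep X = rep (h \<oplus>\<^bsub>P\<^esub> u)"
      using inj_on_eq_iff[OF E.\<Phi>_inj X E.M.M.add.m_closed[OF hc u]] by simp
    then show ?thesis by (simp add: E.\<Phi>_add[OF hc u] diff_eq_eq)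
  qed
  have "X \<in> quot_proj \<Gamma> a b U u \<longleftrightarrow> (\<exists>h\<in>U. X = h \<oplus>\<^bsub>P\<^esub> u)"
    by (simp add: quot_proj_def a_r_coset_def')
  also have "\<dots> \<longleftrightarrow> (\<exists>h\<in>U. rep X - rep u = rep h)"
    by (rule bex_cong[OF refl]) (rule *)
  also have "\<dots> \<longleftrightarrow> rep X - rep u \<in> rep ` U" by (simp add: image_iff)
  finally show ?thesis .
qed

lemma quot_proj_eq_iff:
  assumes U: "U \<subseteq> carrier P" "pm.subspace (rep ` U)" and u: "u \<in> carrier P" "u' \<in> carrier P"
  shows "quot_proj \<Gamma> a b U u = quot_proj \<Gamma> a b U u' \<longleftrightarrow> rep u - rep u' \<in> rep ` U"
proof
  assume eq: "quot_proj \<Gamma> a b U u = quot_proj \<Gamma> a b U u'"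
  have "u \<in> quot_proj \<Gamma> a b U u"
    using quot_proj_mem[OF U(1) u(1) u(1)] pm.subspace_0[OF U(2)] by simp
  then show "rep u - rep u' \<in> rep ` U" unfolding eq using quot_proj_mem[OF U(1) u(2) u(1)] by simp
next
  assume d: "rep u - rep u' \<in> rep ` U"
  have sub: "quot_proj \<Gamma> a b U u0 \<subseteq> carrier P" if "u0 \<in> carrier P" for u0
  proof
    fix X assume "X \<in> quot_proj \<Gamma> a b U u0"
    then obtain h where "h \<in> U" "X = h \<oplus>\<^bsub>P\<^esub> u0"
      unfolding quot_proj_def a_r_coset_def' by (elim UN_E singletonE)
    then show "X \<in> carrier P" using U(1) that E.M.M.add.m_closed[of h u0] by (simp add: subsetD)
  qed
  have iff: "X \<in> quot_proj \<Gamma> a b U u \<longleftrightarrow> X \<in> quot_proj \<Gamma> a b U u'" if X: "X \<in> carrier P" for X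
    unfolding quot_proj_mem[OF U(1) u(1) X] quot_proj_mem[OF U(1) u(2) X]
  proof
    assume "rep X - rep u \<in> rep ` U"
    from pm.subspace_add[OF U(2) this d] show "rep X - rep u' \<in> rep ` U" by simp
  next
    assume "rep X - rep u' \<in> rep ` U"
    from pm.subspace_diff[OF U(2) this d] show "rep X - rep u \<in> rep ` U" by simp
  qed
  show "quot_proj \<Gamma> a b U u = quot_proj \<Gamma> a b U u'"
  proof
    show "quot_proj \<Gamma> a b U u \<subseteq> quot_proj \<Gamma> a b U u'"
    proof
      fix X assume X: "X \<in> quot_proj \<Gamma> a b U u"
      show "X \<in> quot_proj \<Gamma> a b U u'" using iff[OF subsetD[OF sub[OF u(1)] X]] X by simp
    qed
    show "quot_proj \<Gamma> a b U u' \<subseteq> quot_proj \<Gamma> a b U u"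
    proof
      fix X assume X: "X \<in> quot_proj \<Gamma> a b U u'"
      show "X \<in> quot_proj \<Gamma> a b U u" using iff[OF subsetD[OF sub[OF u(2)] X]] X by simp
    qed
  qed
qed

lemma W_basis:
  obtains B where "finite B" "B \<subseteq> W i" "pm.independent B" "W i \<subseteq> pm.span B"
proof -
  obtain B where B: "B \<subseteq> W i" "pm.independent B" "W i \<subseteq> pm.span B"
    using pm.maximal_independent_subset[of "W i"] by metis
  obtain S where S: "finite S" "S \<subseteq> carrier P" "V i = E.M.span S"
    using V_finitely_generated[of i] by (elim exE conjE)
  have "W i = pm.span (rep ` S)" unfolding rep_V[symmetric] S(3) by (rule E.\<Phi>_span[OF S(2)])
  then have "finite B"
    using pm.independent_span_bound[OF finite_imageI[OF S(1)] B(2)] B(1) by simp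
  with B show ?thesis by (intro that)
qed

text \<open>A vector is killed modulo \<open>\<Oplus> U\<close> exactly when its image under
  \<open>f\<close> can be cancelled by an element of \<open>\<Oplus> U\<close>, and the composite is
  onto the quotient exactly when the image of \<open>f\<close> and \<open>\<Oplus> U\<close>
  together span. So injectivity and surjectivity can be read off from the sum of \<open>f\<close>
  and the inclusion, whose target does not vary with \<open>U\<close>.\<close>

lemma f_map_general:
  assumes inf: "infinite (UNIV :: 'k set)" and t: "t \<in> verts \<Gamma>" and d: "0 \<le> d"
  shows "for_general_subspaces P (neighbours \<Gamma> t (d + 1) d) V
     (\<lambda>U. maximal_rank
        (out_in_map \<Gamma> t (\<lambda>\<gamma>. quot_proj \<Gamma> a b (U (head \<Gamma> \<gamma>, d + 1))) (\<lambda>\<gamma>. quot_proj \<Gamma> a b (U (tail \<Gamma> \<gamma>, d)))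
          \<circ> f_map \<Gamma> a b t)
        (V (t, d))
        (out_in_sum \<Gamma> t (\<lambda>\<gamma>. quot_proj \<Gamma> a b (U (head \<Gamma> \<gamma>, d + 1)) ` V (head \<Gamma> \<gamma>, d + 1))
          (\<lambda>\<gamma>. quot_proj \<Gamma> a b (U (tail \<Gamma> \<gamma>, d)) ` V (tail \<Gamma> \<gamma>, d))))"
proof -
  have nb: "neighbours \<Gamma> t (d + 1) d = nb_index (d + 1) ` out_arcs Q t"
    using neighbours_eq[of t "d + 1"] by simp
  show ?thesis
  unfolding for_general_subspaces_def nb
proof
  fix r :: "'v \<times> int \<Rightarrow> nat"
  let ?ix = "nb_index (d + 1)" and ?O = "out_arcs Q t"
  interpret SF: subspace_family pscale P rep "?ix ` ?O" V r
    by (rule subspace_family_V) (rule finite_imageI[OF finite_out_Q])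
  have ixI: "?ix x \<in> ?ix ` ?O" if "x \<in> ?O" for x using that by (rule imageI)
  interpret F: vec_space "fun_scale pscale :: 'k \<Rightarrow> ('e + 'e \<Rightarrow> 'v \<times> ('e + 'e) list \<Rightarrow>\<^sub>0 'k) \<Rightarrow> _"
    by (intro vec_space.intro vec_space.vector_space_fun pm.vec_space_axioms)
  obtain B where B: "finite B" "B \<subseteq> W (t, d)" "pm.independent B" "W (t, d) \<subseteq> pm.span B"
    by (rule W_basis)
  define f where "f = (\<lambda>v x. if x \<in> ?O then R (dbl_bar x) v else 0)"
  have W_ix: "W (?ix x) = W (head Q x, d + 1 - dbl_shift x)" for x by (simp add: nb_index_def)
  have f_W: "R (dbl_bar x) v \<in> W (?ix x)" if "x \<in> ?O" "v \<in> W (t, d)" for x v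
    using R_W[of "dbl_bar x" v d] that by (simp add: W_ix add_diff_eq)
  define Sg where "Sg = Sigma ?O (\<lambda>x. {..<r (?ix x)})"
  have finSg: "finite Sg" unfolding Sg_def by (intro finite_SigmaI finite_out_Q) simp
  \<comment> \<open>\<open>Inl\<close> indexes the constant columns, the images under
    \<open>f\<close> of a basis of \<open>W (t, d)\<close>; \<open>Inr\<close> indexes the frame
    vectors, each placed at one arrow.\<close>
  define S where "S = Inl ` B \<union> Inr ` Sg"
  have finS: "finite S" unfolding S_def using B(1) finSg by simp
  define L where "L = case_sum (\<lambda>(_ :: 'v \<times> ('e + 'e) list \<Rightarrow>\<^sub>0 'k) (_ :: 'v \<times> ('e + 'e) list \<Rightarrow>\<^sub>0 'k) (_ :: 'e + 'e). 0)
    (\<lambda>(xj :: ('e + 'e) \<times> nat) v x. if x = fst xj then v :: 'v \<times> ('e + 'e) list \<Rightarrow>\<^sub>0 'k else 0)"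
  define A where "A = case_sum f (\<lambda>(_ :: ('e + 'e) \<times> nat) (_ :: 'e + 'e). 0)"
  \<comment> \<open>The values on \<open>Inl\<close> are dummies, as \<open>L\<close> is zero
    there.\<close>
  define \<iota> where "\<iota> = case_sum (\<lambda>(_ :: 'v \<times> ('e + 'e) list \<Rightarrow>\<^sub>0 'k). (t, d)) (\<lambda>(xj :: ('e + 'e) \<times> nat). ?ix (fst xj))"
  define \<kappa> where "\<kappa> = case_sum (\<lambda>(_ :: 'v \<times> ('e + 'e) list \<Rightarrow>\<^sub>0 'k). 0) (\<lambda>(xj :: ('e + 'e) \<times> nat). snd xj)"
  define y where "y = (\<lambda>s fr. A s + L s (rep (fr (\<iota> s) (\<kappa> s))))"
  have y_eq: "A s + L s (rep (fr (\<iota> s) (\<kappa> s))) = y s fr" for s fr by (simp only: y_def)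
  have S_sum: "(\<Sum>s\<in>S. g s) = (\<Sum>v\<in>B. g (Inl v)) + (\<Sum>x\<in>?O. \<Sum>j<r (?ix x). g (Inr (x, j)))"
    for g :: "_ \<Rightarrow> 'v \<times> ('e + 'e) list \<Rightarrow>\<^sub>0 'k"
  proof -
    have "(\<Sum>s\<in>S. g s) = (\<Sum>v\<in>B. g (Inl v)) + (\<Sum>xj\<in>Sg. g (Inr xj))"
      unfolding S_def using B(1) finSg by (subst sum.union_disjoint) (auto simp: sum.reindex)
    also have "(\<Sum>xj\<in>Sg. g (Inr xj)) = (\<Sum>x\<in>?O. \<Sum>j<r (?ix x). g (Inr (x, j)))"
      unfolding Sg_def using sum.Sigma[of ?O "\<lambda>x. {..<r (?ix x)}" "\<lambda>x j. g (Inr (x, j))"] finite_out_Q by simp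
    finally show ?thesis .
  qed
  have L_lin: "Vector_Spaces.linear pscale (fun_scale pscale) (L s)" for s
    unfolding Vector_Spaces.linear_iff using pm.vector_space_axioms F.vector_space_axioms
    by (cases s) (auto simp: L_def fun_eq_iff)
  have L_sum: "(\<Sum>s\<in>S. fun_scale pscale (c s) (L s (m s))) x =
      (if x \<in> ?O then \<Sum>j<r (?ix x). pscale (c (Inr (x, j))) (m (Inr (x, j))) else 0)" for c m x
  proof -
    have "(\<Sum>s\<in>S. fun_scale pscale (c s) (L s (m s))) x =
        (\<Sum>x'\<in>?O. \<Sum>j<r (?ix x'). pscale (c (Inr (x', j))) (if x = x' then m (Inr (x', j)) else 0))"
      unfolding sum_fun_apply S_sum by (simp add: L_def)
    also have "\<dots> = (\<Sum>x'\<in>?O. if x' = x then \<Sum>j<r (?ix x). pscale (c (Inr (x, j))) (m (Inr (x, j))) else 0)"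
      by (rule sum.cong[OF refl]) simp
    finally show ?thesis using finite_out_Q[of t] by simp
  qed
  \<comment> \<open>The two halves of a coefficient vector: \<open>vv c\<close> is the element of
    \<open>W (t, d)\<close>, and \<open>uu c fr\<close> the element of the direct sum of the
    subspaces.\<close>
  define vv where "vv = (\<lambda>(c :: ('v \<times> ('e + 'e) list \<Rightarrow>\<^sub>0 'k) + ('e + 'e) \<times> nat \<Rightarrow> 'k). \<Sum>v\<in>B. pscale (c (Inl v)) v)"
  define uu where "uu = (\<lambda>(c :: ('v \<times> ('e + 'e) list \<Rightarrow>\<^sub>0 'k) + ('e + 'e) \<times> nat \<Rightarrow> 'k) fr x.
    \<Sum>j<r (?ix x). pscale (c (Inr (x, j))) (rep (fr (?ix x) j)))"
  have y_sum: "(\<Sum>s\<in>S. fun_scale pscale (c s) (y s fr)) x =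
      (if x \<in> ?O then R (dbl_bar x) (vv c) + uu c fr x else 0)" for c fr x
  proof -
    have "(\<Sum>s\<in>S. fun_scale pscale (c s) (y s fr)) =
        (\<Sum>s\<in>S. fun_scale pscale (c s) (A s)) + (\<Sum>s\<in>S. fun_scale pscale (c s) (L s (rep (fr (\<iota> s) (\<kappa> s)))))"
      by (simp only: y_def F.scale_right_distrib sum.distrib)
    moreover have "(\<Sum>s\<in>S. fun_scale pscale (c s) (A s)) x = (if x \<in> ?O then R (dbl_bar x) (vv c) else 0)"
      unfolding sum_fun_apply S_sum
      by (simp add: A_def f_def vv_def plin_sum[OF R_lin] plin_scale[OF R_lin] del: in_out_arcs_conv)
    ultimately show ?thesis
      using L_sum[of c "\<lambda>s. rep (fr (\<iota> s) (\<kappa> s))" x] by (simp add: uu_def \<iota>_def \<kappa>_def)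
  qed
  have y_sum_zero: "(\<Sum>s\<in>S. fun_scale pscale (c s) (y s fr)) = 0 \<longleftrightarrow>
      (\<forall>x\<in>?O. R (dbl_bar x) (vv c) + uu c fr x = 0)" for c fr
    unfolding fun_eq_iff y_sum zero_fun_def by (auto simp del: in_out_arcs_conv)
  have span_y: "F.span ((\<lambda>s. y s fr) ` S) = {\<Sum>s\<in>S. fun_scale pscale (c s) (y s fr) | c. True}" for fr
    by (rule F.span_family[OF finS])
  have vv_W: "vv c \<in> W (t, d)" for c
    unfolding vv_def using B(2) by (intro pm.subspace_sum[OF W_subspace] pm.subspace_scale[OF W_subspace]) (rule subsetD)
  have vv_surj: "\<exists>c. vv c = v \<and> (\<forall>xj. c (Inr xj) = e xj)" if "v \<in> W (t, d)" for v e
  proof -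
    have "v \<in> pm.span B" using that B(4) by (rule subsetD[rotated])
    then obtain u where "v = (\<Sum>b\<in>B. pscale (u b) b)"
      unfolding pm.span_finite[OF B(1)] by (elim rangeE)
    then show ?thesis by (intro exI[of _ "case_sum u e"]) (simp add: vv_def)
  qed
  have vv_zero: "\<forall>v\<in>B. c (Inl v) = 0" if "vv c = 0" for c
  proof
    fix v assume "v \<in> B"
    with that show "c (Inl v) = 0"
      using pm.independentD[OF B(3) B(1) subset_refl, of "\<lambda>v. c (Inl v)"] by (simp add: vv_def)
  qed
  have fr_ind: "indep_family pscale {..<r (?ix x)} (\<lambda>j. rep (fr (?ix x) j))" if "fr \<in> SF.frms" "x \<in> ?O" for fr x
  proof -
    have "\<forall>i\<in>?ix ` ?O. indep_family pscale {..<r i} (\<lambda>j. rep (fr i j))"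
      using that(1) unfolding SF.frames_iff by (rule conjunct2)
    from bspec[OF this ixI[OF that(2)]] show ?thesis .
  qed
  have uu_zero: "\<forall>j<r (?ix x). c (Inr (x, j)) = 0" if "fr \<in> SF.frms" "x \<in> ?O" "uu c fr x = 0" for fr x c
  proof -
    have "\<forall>j\<in>{..<r (?ix x)}. c (Inr (x, j)) = 0"
      using fr_ind[OF that(1,2), unfolded indep_family_def, THEN spec[of _ "\<lambda>j. c (Inr (x, j))"]] that(3)
      by (simp add: uu_def)
    then show ?thesis by simp
  qed
  have c_zero: "\<forall>s\<in>S. c s = 0" if "fr \<in> SF.frms" "vv c = 0" "\<forall>x\<in>?O. uu c fr x = 0" for fr c
  proof
    fix s assume "s \<in> S"
    then show "c s = 0"
      unfolding S_def Sg_def using vv_zero[OF that(2)] uu_zero[OF that(1)] that(3)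
      by (elim UnE imageE SigmaE) simp_all
  qed
  have rep_fr: "rep (fr (?ix x) j) \<in> W (?ix x)" if "fr \<in> SF.tuples" "x \<in> ?O" "j < r (?ix x)" for fr x j
    using SF.tupleD[OF that(1) ixI[OF that(2)] that(3)] rep_V[of "?ix x"] by blast
  have uu_W: "uu c fr x \<in> W (?ix x)" if "fr \<in> SF.tuples" "x \<in> ?O" for c fr x
    unfolding uu_def using rep_fr[OF that]
    by (intro pm.subspace_sum[OF W_subspace] pm.subspace_scale[OF W_subspace]) simp
  define E' where "E' = {n :: 'e + 'e \<Rightarrow> 'v \<times> ('e + 'e) list \<Rightarrow>\<^sub>0 'k.
    (\<forall>x\<in>?O. n x \<in> W (?ix x)) \<and> (\<forall>x. x \<notin> ?O \<longrightarrow> n x = 0)}"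
  have y_E: "y s fr \<in> E'" if s: "s \<in> S" and fr: "fr \<in> SF.tuples" for s fr
  proof (cases s)
    case (Inl v)
    then have "v \<in> W (t, d)" using s B(2) by (auto simp: S_def)
    then show ?thesis
      using Inl f_W by (simp add: E'_def y_def A_def L_def f_def)
  next
    case (Inr xj)
    then have xj: "fst xj \<in> ?O" "snd xj < r (?ix (fst xj))" using s by (auto simp: S_def Sg_def)
    show ?thesis
      using rep_fr[OF fr xj] xj(1) pm.subspace_0[OF W_subspace] Inr
      by (simp add: E'_def y_def A_def L_def \<iota>_def \<kappa>_def)
  qed
  show "\<exists>Wo. openin (zariski_grassmannians P (?ix ` ?O) V r) Wo
      \<and> zariski_grassmannians P (?ix ` ?O) V r closure_of Wo = grassmannians P (?ix ` ?O) V r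
      \<and> (\<forall>U\<in>Wo. maximal_rank
        (out_in_map \<Gamma> t (\<lambda>\<gamma>. quot_proj \<Gamma> a b (U (head \<Gamma> \<gamma>, d + 1))) (\<lambda>\<gamma>. quot_proj \<Gamma> a b (U (tail \<Gamma> \<gamma>, d)))
          \<circ> f_map \<Gamma> a b t)
        (V (t, d))
        (out_in_sum \<Gamma> t (\<lambda>\<gamma>. quot_proj \<Gamma> a b (U (head \<Gamma> \<gamma>, d + 1)) ` V (head \<Gamma> \<gamma>, d + 1))
          (\<lambda>\<gamma>. quot_proj \<Gamma> a b (U (tail \<Gamma> \<gamma>, d)) ` V (tail \<Gamma> \<gamma>, d))))"
  proof (rule SF.generic_maximal_rank[where A = A and L = L and \<iota> = \<iota> and \<kappa> = \<kappa> and E = E', unfolded y_eq,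
        OF inf F.vec_space_axioms finS L_lin])
    fix s assume "s \<in> S"
    then show "(\<forall>v. L s v = 0) \<or> \<iota> s \<in> ?ix ` ?O \<and> \<kappa> s < r (\<iota> s)"
      unfolding S_def Sg_def by (elim UnE imageE SigmaE) (simp_all add: L_def \<iota>_def \<kappa>_def zero_fun_def)
  next
    fix s fr assume "s \<in> S" "fr \<in> SF.tuples"
    then show "y s fr \<in> E'" by (rule y_E)
  next
    fix fr :: "'v \<times> int \<Rightarrow> nat \<Rightarrow> ('v \<times> ('e + 'e) list \<Rightarrow>\<^sub>0 'k) set" and c w
    assume fr: "fr \<in> SF.frms" and nz: "\<exists>s\<in>S. c s \<noteq> 0"
      and zero: "(\<Sum>s\<in>S. fun_scale pscale (c s) (y s fr)) = 0" and w: "w \<in> E'"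
    have frt: "fr \<in> SF.tuples" using fr by (simp add: frames_def)
    have rel: "R (dbl_bar x) (vv c) = - uu c fr x" if "x \<in> ?O" for x
      using bspec[OF zero[unfolded y_sum_zero] that] by (simp add: eq_neg_iff_add_eq_0)
    \<comment> \<open>The inclusion of the subspaces is injective, so a nontrivial relation must
      involve the source of \<open>f\<close>.\<close>
    have "vv c \<noteq> 0"
    proof
      assume v0: "vv c = 0"
      then have "\<forall>x\<in>?O. uu c fr x = 0" using rel plin_zero[OF R_lin] by simp
      from c_zero[OF fr v0 this] nz show False by simp
    qed
    then obtain \<psi> where \<psi>: "Vector_Spaces.linear pscale (*) \<psi>" "\<psi> (vv c) = 1"
      using pm.linear_functional_exists by metis
    \<comment> \<open>One functional \<psi> serves all arrows: \<open>vv c\<close> is sent to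
      \<open>- w x\<close> in every component at once.\<close>
    define h where "h = (\<lambda>x v. pscale (\<psi> v) (- w x))"
    have h_lin: "plin (h x)" for x
      using \<psi>(1) by (simp add: h_def plin_iff Vector_Spaces.linear_iff pm.scale_left_distrib)
    have h_W: "h x v \<in> W (head Q x, d + 1 - dbl_shift x)" if "x \<in> ?O" for x v
    proof -
      have "w x \<in> W (?ix x)" using w that by (simp add: E'_def)
      then show ?thesis
        unfolding h_def W_ix by (intro pm.subspace_scale[OF W_subspace] pm.subspace_neg[OF W_subspace])
    qed
    obtain \<phi> where \<phi>: "\<And>u. plin (\<phi> u)" "\<And>v. v \<in> W (t, d) \<Longrightarrow> \<phi> t v \<in> W (t, d)"
      "\<And>x v. x \<in> ?O \<Longrightarrow> v \<in> W (head Q x, d + 1 - dbl_shift x) \<Longrightarrow> \<phi> (head Q x) v \<in> W (head Q x, d + 1 - dbl_shift x)"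
      "\<And>x v. x \<in> ?O \<Longrightarrow> v \<in> W (t, d) \<Longrightarrow> h x v = \<phi> (head Q x) (R (dbl_bar x) v) - R (dbl_bar x) (\<phi> t v)"
    proof (rule MS.rigid_out[OF t d, where h = h])
      show "plin (h x)" for x by (rule h_lin)
    qed (rule h_W, assumption, (rule that; assumption))
    obtain v where v: "v \<in> SF.tuples"
      "\<And>i j. i \<in> ?ix ` ?O \<Longrightarrow> j < r i \<Longrightarrow> rep (v i j) = \<phi> (fst i) (rep (fr i j))"
    proof (rule SF.tuple_exists[where n = "\<lambda>i j. \<phi> (fst i) (rep (fr i j))"])
      fix i j assume "i \<in> ?ix ` ?O" and j: "j < r i"
      then obtain x where x: "x \<in> ?O" "i = ?ix x" by (elim imageE)
      show "\<phi> (fst i) (rep (fr i j)) \<in> rep ` V i"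
        unfolding rep_V x(2) using \<phi>(3)[OF x(1), of "rep (fr (?ix x) j)"] rep_fr[OF frt x(1)] j x(2)
        by (simp add: nb_index_def)
    qed (rule that; assumption)
    \<comment> \<open>The change of the columns along \<phi> equals \<open>w\<close> only up to
      \<open>f (- \<phi> t (vv c))\<close>. Coefficients of this source vector, with zero frame
      part, show that the difference lies in the span of the columns.\<close>
    obtain e where e: "vv e = - \<phi> t (vv c)" "\<forall>xj. e (Inr xj) = 0"
      using vv_surj[of "- \<phi> t (vv c)" "\<lambda>_. 0"] pm.subspace_neg[OF W_subspace \<phi>(2)[OF vv_W[of c]]] by auto
    have "(\<Sum>s\<in>S. fun_scale pscale (c s) (L s (rep (v (\<iota> s) (\<kappa> s))))) - w
        = (\<Sum>s\<in>S. fun_scale pscale (e s) (y s fr))"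
    proof
      fix x
      show "((\<Sum>s\<in>S. fun_scale pscale (c s) (L s (rep (v (\<iota> s) (\<kappa> s))))) - w) x
          = (\<Sum>s\<in>S. fun_scale pscale (e s) (y s fr)) x"
      proof (cases "x \<in> ?O")
        case True
        have "(\<Sum>s\<in>S. fun_scale pscale (c s) (L s (rep (v (\<iota> s) (\<kappa> s))))) x
            = (\<Sum>j<r (?ix x). pscale (c (Inr (x, j))) (rep (v (?ix x) j)))"
          unfolding L_sum using True by (simp add: \<iota>_def \<kappa>_def)
        also have "\<dots> = \<phi> (head Q x) (uu c fr x)"
          unfolding uu_def plin_sum[OF \<phi>(1)] plin_scale[OF \<phi>(1)]
          by (rule sum.cong[OF refl]) (simp add: v(2)[OF ixI[OF True]], simp add: nb_index_def)
        also have "uu c fr x = - R (dbl_bar x) (vv c)" using rel[OF True] by simp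
        also have "\<phi> (head Q x) (- R (dbl_bar x) (vv c)) = - \<phi> (head Q x) (R (dbl_bar x) (vv c))"
          using plin_diff[OF \<phi>(1), of _ 0 "R (dbl_bar x) (vv c)"] plin_zero[OF \<phi>(1)] by simp
        also have "\<phi> (head Q x) (R (dbl_bar x) (vv c)) = h x (vv c) + R (dbl_bar x) (\<phi> t (vv c))"
          using \<phi>(4)[OF True vv_W[of c]] by simp
        also have "h x (vv c) = - w x" by (simp add: h_def \<psi>(2))
        finally have "(\<Sum>s\<in>S. fun_scale pscale (c s) (L s (rep (v (\<iota> s) (\<kappa> s))))) x
            = - (- w x + R (dbl_bar x) (\<phi> t (vv c)))" .
        then have "((\<Sum>s\<in>S. fun_scale pscale (c s) (L s (rep (v (\<iota> s) (\<kappa> s))))) - w) x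
            = - R (dbl_bar x) (\<phi> t (vv c))"
          unfolding minus_apply by (simp only: minus_add_distrib minus_minus) simp
        also have "\<dots> = R (dbl_bar x) (vv e) + uu e fr x"
          using plin_diff[OF R_lin, of _ 0 "\<phi> t (vv c)"] plin_zero[OF R_lin] e by (simp add: uu_def)
        finally show ?thesis unfolding y_sum using True by simp
      next
        case False
        then have "w x = 0" using w by (simp add: E'_def)
        then show ?thesis unfolding y_sum minus_apply L_sum using False by (simp del: in_out_arcs_conv)
      qed
    qed
    then have "(\<Sum>s\<in>S. fun_scale pscale (c s) (L s (rep (v (\<iota> s) (\<kappa> s))))) - w
        \<in> F.span ((\<lambda>s. y s fr) ` S)"
      unfolding span_y by (intro CollectI exI[of _ e]) simp
    then show "\<exists>v\<in>SF.tuples. (\<Sum>s\<in>S. fun_scale pscale (c s) (L s (rep (v (\<iota> s) (\<kappa> s))))) - w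
        \<in> F.span ((\<lambda>s. y s fr) ` S)"
      using v(1) by (intro bexI[of _ v])
  next
    fix fr assume fr: "fr \<in> SF.frms"
    have frt: "fr \<in> SF.tuples" using fr by (simp add: frames_def)
    define U where "U = frame_span P (?ix ` ?O) r fr"
    let ?qo = "\<lambda>\<gamma>. quot_proj \<Gamma> a b (U (head \<Gamma> \<gamma>, d + 1))" and ?qi = "\<lambda>\<gamma>. quot_proj \<Gamma> a b (U (tail \<Gamma> \<gamma>, d))"
    let ?D = "out_in_sum \<Gamma> t (\<lambda>\<gamma>. ?qo \<gamma> ` V (head \<Gamma> \<gamma>, d + 1)) (\<lambda>\<gamma>. ?qi \<gamma> ` V (tail \<Gamma> \<gamma>, d))"
    let ?h = "out_in_map \<Gamma> t ?qo ?qi \<circ> f_map \<Gamma> a b t"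
    let ?q = "\<lambda>x. quot_proj \<Gamma> a b (U (?ix x))"
    have D_ix: "case_sum (\<lambda>\<gamma>. ?qo \<gamma> ` V (head \<Gamma> \<gamma>, d + 1)) (\<lambda>\<gamma>. ?qi \<gamma> ` V (tail \<Gamma> \<gamma>, d)) x = ?q x ` V (?ix x)" for x
      by (cases x) (simp_all add: nb_index_def)
    have rep_U: "rep ` U (?ix x) = {\<Sum>j<r (?ix x). pscale (c j) (rep (fr (?ix x) j)) | c. True}" if "x \<in> ?O" for x
      unfolding U_def by (rule SF.\<Phi>_frame_span[OF frt ixI[OF that]])
    have uu_U: "uu c fr x \<in> rep ` U (?ix x)" if "x \<in> ?O" for x c
      unfolding rep_U[OF that] uu_def by (intro CollectI exI[of _ "\<lambda>j. c (Inr (x, j))"]) simp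
    have uu_U_ex: "\<exists>e. \<forall>x\<in>?O. z x = (\<Sum>j<r (?ix x). pscale (e (x, j)) (rep (fr (?ix x) j)))"
      if "\<forall>x\<in>?O. z x \<in> rep ` U (?ix x)" for z
    proof -
      have "\<forall>x\<in>?O. \<exists>e. z x = (\<Sum>j<r (?ix x). pscale (e j) (rep (fr (?ix x) j)))"
      proof
        fix x assume x: "x \<in> ?O"
        from bspec[OF that x] show "\<exists>e. z x = (\<Sum>j<r (?ix x). pscale (e j) (rep (fr (?ix x) j)))"
          unfolding rep_U[OF x] by (elim CollectE exE conjE) (rule exI)
      qed
      from bchoice[OF this] obtain e where "\<forall>x\<in>?O. z x = (\<Sum>j<r (?ix x). pscale (e x j) (rep (fr (?ix x) j)))" ..
      then show ?thesis by (intro exI[of _ "\<lambda>(x, j). e x j"]) simp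
    qed
    have U_carrier: "U (?ix x) \<subseteq> carrier P" if "x \<in> ?O" for x
      unfolding U_def using SF.frame_span_carrier[OF frt ixI[OF that]] V_carrier by (rule subset_trans)
    have U_sub: "pm.subspace (rep ` U (?ix x))" if "x \<in> ?O" for x
      unfolding rep_U[OF that] pm.span_family[OF finite_lessThan, symmetric] by (rule pm.subspace_span)
    have mult: "v \<otimes>\<^bsub>P\<^esub> pr (arrow Q (dbl_bar x)) \<in> carrier P"
      "rep (v \<otimes>\<^bsub>P\<^esub> pr (arrow Q (dbl_bar x))) = R (dbl_bar x) (rep v)"
      "v \<otimes>\<^bsub>P\<^esub> pr (arrow Q (dbl_bar x)) \<in> V (?ix x)"
      if "v \<in> V (t, d)" "x \<in> ?O" for v x
    proof -
      have "v \<in> carrier P" "dbl_bar x \<in> arcs Q" using that V_carrier by auto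
      from rep_mult_arrow(3,4)[OF this]
      show 1: "v \<otimes>\<^bsub>P\<^esub> pr (arrow Q (dbl_bar x)) \<in> carrier P"
        and 2: "rep (v \<otimes>\<^bsub>P\<^esub> pr (arrow Q (dbl_bar x))) = R (dbl_bar x) (rep v)" by simp_all
      have "rep v \<in> W (t, d)" using that(1) rep_V by blast
      then show "v \<otimes>\<^bsub>P\<^esub> pr (arrow Q (dbl_bar x)) \<in> V (?ix x)"
        unfolding in_V_iff[OF 1] 2 by (rule f_W[OF that(2)])
    qed
    have h_eq: "?h v = (\<lambda>\<gamma>\<in>out_arcs \<Gamma> t. ?q (Inl \<gamma>) (v \<otimes>\<^bsub>P\<^esub> pr (arrow Q (dbl_bar (Inl \<gamma>)))),
        \<lambda>\<gamma>\<in>in_arcs \<Gamma> t. ?q (Inr \<gamma>) (v \<otimes>\<^bsub>P\<^esub> pr (arrow Q (dbl_bar (Inr \<gamma>)))))" for v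
      unfolding comp_def out_in_map_def f_map_def Let_def beta_eq
      by (simp add: nb_index_def cong: restrict_cong)
    have h_D: "?h v \<in> ?D" if v: "v \<in> V (t, d)" for v
      unfolding h_eq by (rule out_in_sum_memI[where m = "\<lambda>x. ?q x (v \<otimes>\<^bsub>P\<^esub> pr (arrow Q (dbl_bar x)))"])
        (unfold D_ix, rule imageI, rule mult(3)[OF v])
    have h_comp: "case_sum (fst (?h v)) (snd (?h v)) x = ?q x (v \<otimes>\<^bsub>P\<^esub> pr (arrow Q (dbl_bar x)))" if "x \<in> ?O" for v x
      unfolding h_eq using that by (cases x) simp_all
    have h_eq_iff: "?h v = ?h v' \<longleftrightarrow> (\<forall>x\<in>?O. R (dbl_bar x) (rep v - rep v') \<in> rep ` U (?ix x))"
      if v: "v \<in> V (t, d)" "v' \<in> V (t, d)" for v v'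
    proof -
      have comp: "?q x (v \<otimes>\<^bsub>P\<^esub> pr (arrow Q (dbl_bar x))) = ?q x (v' \<otimes>\<^bsub>P\<^esub> pr (arrow Q (dbl_bar x))) \<longleftrightarrow>
          R (dbl_bar x) (rep v - rep v') \<in> rep ` U (?ix x)" if x: "x \<in> ?O" for x
        unfolding quot_proj_eq_iff[OF U_carrier[OF x] U_sub[OF x] mult(1)[OF v(1) x] mult(1)[OF v(2) x]]
          mult(2)[OF v(1) x] mult(2)[OF v(2) x] plin_diff[OF R_lin] ..
      show ?thesis
      proof
        assume eq: "?h v = ?h v'"
        show "\<forall>x\<in>?O. R (dbl_bar x) (rep v - rep v') \<in> rep ` U (?ix x)"
        proof
          fix x assume x: "x \<in> ?O"
          show "R (dbl_bar x) (rep v - rep v') \<in> rep ` U (?ix x)"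
            unfolding comp[OF x, symmetric] h_comp[OF x, symmetric] eq ..
        qed
      next
        assume "\<forall>x\<in>?O. R (dbl_bar x) (rep v - rep v') \<in> rep ` U (?ix x)"
        then show "?h v = ?h v'"
          by (intro out_in_sum_eqI[OF h_D[OF v(1)] h_D[OF v(2)]]) (simp only: h_comp comp)
      qed
    qed
    have "inj_on ?h (V (t, d)) \<longleftrightarrow> indep_family (fun_scale pscale) S (\<lambda>s. y s fr)"
    proof
      assume inj: "inj_on ?h (V (t, d))"
      show "indep_family (fun_scale pscale) S (\<lambda>s. y s fr)"
        unfolding indep_family_def
      proof (intro allI impI)
        fix c assume "(\<Sum>s\<in>S. fun_scale pscale (c s) (y s fr)) = 0"
        then have rel: "R (dbl_bar x) (vv c) + uu c fr x = 0" if "x \<in> ?O" for x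
          using that unfolding y_sum_zero by (rule bspec)
        obtain v where v: "v \<in> V (t, d)" "rep v = vv c" using vv_W[of c] unfolding rep_V[symmetric] by (elim imageE) simp
        obtain v0 where v0: "v0 \<in> V (t, d)" "rep v0 = 0"
          using pm.subspace_0[OF W_subspace, of "(t, d)"] unfolding rep_V[symmetric] by (elim imageE) simp
        have "R (dbl_bar x) (rep v - rep v0) \<in> rep ` U (?ix x)" if x: "x \<in> ?O" for x
        proof -
          have "R (dbl_bar x) (vv c) = - uu c fr x" using rel[OF x] by (simp add: eq_neg_iff_add_eq_0)
          then show ?thesis using pm.subspace_neg[OF U_sub[OF x] uu_U[OF x, of c]] v v0 by simp
        qed
        then have "?h v = ?h v0" unfolding h_eq_iff[OF v(1) v0(1)] by simp
        then have "v = v0" by (rule inj_onD[OF inj _ v(1) v0(1)])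
        then have vc: "vv c = 0" using v v0 by simp
        then have "\<forall>x\<in>?O. uu c fr x = 0" using rel plin_zero[OF R_lin] by simp
        then show "\<forall>s\<in>S. c s = 0" by (rule c_zero[OF fr vc])
      qed
    next
      assume ind: "indep_family (fun_scale pscale) S (\<lambda>s. y s fr)"
      show "inj_on ?h (V (t, d))"
      proof (rule inj_onI)
        fix v v' assume v: "v \<in> V (t, d)" "v' \<in> V (t, d)" and eq: "?h v = ?h v'"
        have w: "rep v - rep v' \<in> W (t, d)"
          using v rep_V by (intro pm.subspace_diff[OF W_subspace]) blast+
        \<comment> \<open>The sign turns membership in the subspaces into a relation, since
          \<open>f\<close> and the inclusion are added in the columns.\<close>
        have "\<forall>x\<in>?O. - R (dbl_bar x) (rep v - rep v') \<in> rep ` U (?ix x)"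
          using eq unfolding h_eq_iff[OF v] using pm.subspace_neg[OF U_sub] by simp
        from uu_U_ex[OF this] obtain e where
          e: "\<forall>x\<in>?O. - R (dbl_bar x) (rep v - rep v') = (\<Sum>j<r (?ix x). pscale (e (x, j)) (rep (fr (?ix x) j)))" ..
        obtain c where c: "vv c = rep v - rep v'" "\<forall>xj. c (Inr xj) = e xj" using vv_surj[OF w, of e] by (elim exE conjE)
        have "R (dbl_bar x) (vv c) + uu c fr x = 0" if x: "x \<in> ?O" for x
        proof -
          have "uu c fr x = - R (dbl_bar x) (vv c)" using bspec[OF e x] c by (simp add: uu_def)
          then show ?thesis by simp
        qed
        then have "(\<Sum>s\<in>S. fun_scale pscale (c s) (y s fr)) = 0" unfolding y_sum_zero by simp
        then have "\<forall>s\<in>S. c s = 0"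
          using ind[unfolded indep_family_def, THEN spec[of _ c]] by simp
        then have "vv c = 0" unfolding vv_def by (intro sum.neutral) (simp add: S_def)
        then have "rep v = rep v'" using c(1) by simp
        then show "v = v'" by (rule inj_onD[OF E.\<Phi>_inj]) (use v V_carrier in auto)
      qed
    qed
    moreover have "?h ` V (t, d) = ?D \<longleftrightarrow> E' \<subseteq> F.span ((\<lambda>s. y s fr) ` S)"
    proof
      assume surj: "?h ` V (t, d) = ?D"
      show "E' \<subseteq> F.span ((\<lambda>s. y s fr) ` S)"
      proof
        fix n assume n: "n \<in> E'"
        have "\<forall>x\<in>?O. \<exists>m. m \<in> V (?ix x) \<and> rep m = n x"
        proof
          fix x assume "x \<in> ?O"
          then have "n x \<in> rep ` V (?ix x)" using n by (simp add: E'_def rep_V)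
          then show "\<exists>m. m \<in> V (?ix x) \<and> rep m = n x"
            by (elim imageE) (rule exI, rule conjI, assumption, erule sym)
        qed
        from bchoice[OF this] obtain m where m: "\<forall>x\<in>?O. m x \<in> V (?ix x) \<and> rep (m x) = n x" ..
        let ?XY = "(\<lambda>\<gamma>\<in>out_arcs \<Gamma> t. ?q (Inl \<gamma>) (m (Inl \<gamma>)), \<lambda>\<gamma>\<in>in_arcs \<Gamma> t. ?q (Inr \<gamma>) (m (Inr \<gamma>)))"
        have "?XY \<in> ?D"
          by (rule out_in_sum_memI[where m = "\<lambda>x. ?q x (m x)"]) (unfold D_ix, rule imageI, use m in simp)
        then obtain v where v: "v \<in> V (t, d)" "?XY = ?h v" unfolding surj[symmetric] by (elim imageE)
        have "n x - R (dbl_bar x) (rep v) \<in> rep ` U (?ix x)" if x: "x \<in> ?O" for x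
        proof -
          have mx: "m x \<in> V (?ix x)" "rep (m x) = n x" using m x by simp_all
          have "case_sum (fst ?XY) (snd ?XY) x = ?q x (m x)" using x by (cases x) simp_all
          then have "?q x (m x) = ?q x (v \<otimes>\<^bsub>P\<^esub> pr (arrow Q (dbl_bar x)))"
            unfolding v(2) h_comp[OF x] by (rule sym)
          then show ?thesis
            unfolding quot_proj_eq_iff[OF U_carrier[OF x] U_sub[OF x] subsetD[OF V_carrier mx(1)] mult(1)[OF v(1) x]]
              mult(2)[OF v(1) x] mx(2) .
        qed
        then have "\<forall>x\<in>?O. n x - R (dbl_bar x) (rep v) \<in> rep ` U (?ix x)" by simp
        from uu_U_ex[OF this] obtain e where
          e: "\<forall>x\<in>?O. n x - R (dbl_bar x) (rep v) = (\<Sum>j<r (?ix x). pscale (e (x, j)) (rep (fr (?ix x) j)))" ..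
        have "rep v \<in> W (t, d)" using v(1) rep_V by blast
        from vv_surj[OF this, of e] obtain c where c: "vv c = rep v" "\<forall>xj. c (Inr xj) = e xj" by (elim exE conjE)
        have "n = (\<Sum>s\<in>S. fun_scale pscale (c s) (y s fr))"
        proof
          fix x
          show "n x = (\<Sum>s\<in>S. fun_scale pscale (c s) (y s fr)) x"
          proof (cases "x \<in> ?O")
            case True
            have "uu c fr x = n x - R (dbl_bar x) (vv c)" using bspec[OF e True] c by (simp add: uu_def)
            then show ?thesis unfolding y_sum using True by simp
          next
            case False
            then show ?thesis unfolding y_sum using n by (simp add: E'_def del: in_out_arcs_conv)
          qed
        qed
        then show "n \<in> F.span ((\<lambda>s. y s fr) ` S)"
          unfolding span_y by (intro CollectI exI[of _ c]) simp
      qed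
    next
      assume span: "E' \<subseteq> F.span ((\<lambda>s. y s fr) ` S)"
      show "?h ` V (t, d) = ?D"
      proof
        show "?h ` V (t, d) \<subseteq> ?D" by (intro image_subsetI h_D)
        show "?D \<subseteq> ?h ` V (t, d)"
        proof
          fix XY assume D: "XY \<in> ?D"
          have "\<forall>x\<in>?O. \<exists>m. m \<in> V (?ix x) \<and> case_sum (fst XY) (snd XY) x = ?q x m"
          proof
            fix x assume "x \<in> ?O"
            from out_in_sum_memD[OF D this] show "\<exists>m. m \<in> V (?ix x) \<and> case_sum (fst XY) (snd XY) x = ?q x m"
              unfolding D_ix by (elim imageE) (rule exI, rule conjI, assumption+)
          qed
          from bchoice[OF this] obtain m where
            m: "\<forall>x\<in>?O. m x \<in> V (?ix x) \<and> case_sum (fst XY) (snd XY) x = ?q x (m x)" ..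
          define n where "n = (\<lambda>x. if x \<in> ?O then rep (m x) else 0)"
          have "rep (m x) \<in> W (?ix x)" if "x \<in> ?O" for x
            using m that rep_V[of "?ix x"] by blast
          then have "n \<in> E'" by (simp add: n_def E'_def)
          then have "n \<in> F.span ((\<lambda>s. y s fr) ` S)" by (rule subsetD[OF span])
          then obtain c where c: "n = (\<Sum>s\<in>S. fun_scale pscale (c s) (y s fr))"
            unfolding span_y by (elim CollectE exE conjE)
          obtain v where v: "v \<in> V (t, d)" "rep v = vv c" using vv_W[of c] unfolding rep_V[symmetric] by (elim imageE) simp
          have "XY = ?h v"
          proof (rule out_in_sum_eqI[OF D h_D[OF v(1)]])
            fix x assume x: "x \<in> ?O"
            have mx: "m x \<in> V (?ix x)" "case_sum (fst XY) (snd XY) x = ?q x (m x)" using m x by simp_all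
            have "n x = R (dbl_bar x) (vv c) + uu c fr x" unfolding c y_sum using x by simp
            then have "rep (m x) - R (dbl_bar x) (rep v) = uu c fr x" using x v(2) by (simp add: n_def)
            then have "rep (m x) - rep (v \<otimes>\<^bsub>P\<^esub> pr (arrow Q (dbl_bar x))) \<in> rep ` U (?ix x)"
              unfolding mult(2)[OF v(1) x] using uu_U[OF x, of c] by simp
            then have "?q x (m x) = ?q x (v \<otimes>\<^bsub>P\<^esub> pr (arrow Q (dbl_bar x)))"
              unfolding quot_proj_eq_iff[OF U_carrier[OF x] U_sub[OF x] subsetD[OF V_carrier mx(1)] mult(1)[OF v(1) x]] .
            then show "case_sum (fst XY) (snd XY) x = case_sum (fst (?h v)) (snd (?h v)) x"
              unfolding mx(2) h_comp[OF x] .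
          qed
          then show "XY \<in> ?h ` V (t, d)" using v(1) by (rule image_eqI)
        qed
      qed
    qed
    ultimately show "maximal_rank
        (out_in_map \<Gamma> t (\<lambda>\<gamma>. quot_proj \<Gamma> a b (frame_span P (?ix ` ?O) r fr (head \<Gamma> \<gamma>, d + 1)))
          (\<lambda>\<gamma>. quot_proj \<Gamma> a b (frame_span P (?ix ` ?O) r fr (tail \<Gamma> \<gamma>, d))) \<circ> f_map \<Gamma> a b t)
        (V (t, d))
        (out_in_sum \<Gamma> t
          (\<lambda>\<gamma>. quot_proj \<Gamma> a b (frame_span P (?ix ` ?O) r fr (head \<Gamma> \<gamma>, d + 1)) ` V (head \<Gamma> \<gamma>, d + 1))
          (\<lambda>\<gamma>. quot_proj \<Gamma> a b (frame_span P (?ix ` ?O) r fr (tail \<Gamma> \<gamma>, d)) ` V (tail \<Gamma> \<gamma>, d))) \<longleftrightarrow>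
      indep_family (fun_scale pscale) S (\<lambda>s. y s fr) \<or> E' \<subseteq> F.span ((\<lambda>s. y s fr) ` S)"
      unfolding maximal_rank_def U_def by (simp only:)
  qed
qed
qed

end

theorem corollary3p3:
  fixes \<Gamma> :: "('v, 'e) pre_digraph"
    and a b :: "'e \<Rightarrow> 'k::alg_closed_field"
    and t :: 'v and d :: nat
  assumes "fin_digraph \<Gamma>"
    and "\<nexists>c. pre_digraph.cycle \<Gamma> c"
    and "\<And>\<gamma>. \<gamma> \<in> arcs \<Gamma> \<Longrightarrow> a \<gamma> \<noteq> 0"
    and "\<And>\<gamma>. \<gamma> \<in> arcs \<Gamma> \<Longrightarrow> b \<gamma> \<noteq> 0"
    and "t \<in> verts \<Gamma>"
    and "graded_piece \<Gamma> a b (t, int d) \<noteq> {\<zero>\<^bsub>preproj_algebra \<Gamma> a b\<^esub>}"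
  shows "for_general_subspaces (preproj_algebra \<Gamma> a b)
           (neighbours \<Gamma> t (int d) (int d - 1)) (graded_piece \<Gamma> a b)
           (\<lambda>U. maximal_rank (g_map \<Gamma> a b t)
              (out_in_sum \<Gamma> t (\<lambda>\<gamma>. U (head \<Gamma> \<gamma>, int d)) (\<lambda>\<gamma>. U (tail \<Gamma> \<gamma>, int d - 1)))
              (graded_piece \<Gamma> a b (t, int d)))
       \<and> for_general_subspaces (preproj_algebra \<Gamma> a b)
           (neighbours \<Gamma> t (int d + 1) (int d)) (graded_piece \<Gamma> a b)
           (\<lambda>U. maximal_rank
              (out_in_map \<Gamma> t
                 (\<lambda>\<gamma>. quot_proj \<Gamma> a b (U (head \<Gamma> \<gamma>, int d + 1)))
                 (\<lambda>\<gamma>. quot_proj \<Gamma> a b (U (tail \<Gamma> \<gamma>, int d)))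
               \<circ> f_map \<Gamma> a b t)
              (graded_piece \<Gamma> a b (t, int d))
              (out_in_sum \<Gamma> t
                 (\<lambda>\<gamma>. quot_proj \<Gamma> a b (U (head \<Gamma> \<gamma>, int d + 1))
                        ` graded_piece \<Gamma> a b (head \<Gamma> \<gamma>, int d + 1))
                 (\<lambda>\<gamma>. quot_proj \<Gamma> a b (U (tail \<Gamma> \<gamma>, int d))
                        ` graded_piece \<Gamma> a b (tail \<Gamma> \<gamma>, int d))))"
proof -
  interpret preprojective_acyclic \<Gamma> a b
    by (intro preprojective_acyclic.intro preprojective.intro preprojective_acyclic_axioms.intro assms(1-4))
  show ?thesis
    using g_map_general[OF infinite_UNIV_alg_closed assms(5), of "int d"]
      f_map_general[OF infinite_UNIV_alg_closed assms(5), of "int d"] by simp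
qed

end
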